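(* Let $$H_0=\frac12\sum_{k=1}^d\left[-\frac{d^2}{dx_k^2}+\omega_k^2x_k^2\right]$$ in $L^2(\mathbb R^d)$, $d\ge1$. Assume the frequencies to be rational multiples of a fixed frequency $\omega>0$, namely $$\omega_k=\frac{p_k}{q_k}\,\omega,\qquad k=1,\ldots,d,$$ where $(p_k,q_k)$ are relatively prime natural numbers. Let $\ell_1<\ell_2<\ldots$ be the distinct eigenvalues of $H_0$, and consider the two assumptions (1) $\delta:=\frac12\inf_r(\ell_{r+1}-\ell_r)>0$; (2) each eigenvalue $\ell_r$, $r=1,2,\ldots$, is either even or odd. Then: (i) If $p_k$ and $q_k$ are both odd, $k=1,\ldots,d$, then $H_0$ is self-adjoint, bounded below, with compact resolvent, $\mathcal P$-symmetric and $\mathcal T$-symmetric, and assumptions (1) and (2) are fulfilled. (ii) If $d=2$, the condition that in $\omega_k=\frac{p_k}{q_k}\omega$ the numbers $p_k$ and $q_k$ are both odd is also necessary for the validity of assumption (2), while assumption (1) holds independently of the parity of $p_k$, $q_k$.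
   Context: $H_0$ is the standard self-adjoint realization of the $d$-dimensional harmonic oscillator; its eigenvalues are $\omega_1n_1+\ldots+\omega_dn_d+\frac12(\omega_1+\ldots+\omega_d)$, $n_i\in\{0,1,2,\ldots\}$. The parity operator is $(\mathcal P\psi)(x)=\psi(-x)$. $H_0$ is $\mathcal P$-symmetric if $\mathcal P H_0\psi=H_0\mathcal P\psi$ for all $\psi\in D(H_0)$ and $\mathcal T$-symmetric if $\overline{H_0\psi}=H_0\overline\psi$ for all $\psi\in D(H_0)$. An eigenvalue $\ell_r$ is even (odd) if all vectors of a basis of its eigenspace, hence all functions in the eigenspace, are even (odd) under $x\mapsto -x$.
   Formalization: In (ii), necessity is proved as: the frequencies can be written with some reference frequency ω'>0 and coprime odd p'_k, q'_k; for the given p_k, q_k and fixed ω it fails, e.g. ω_1=ω_2=2ω (p_k=2, q_k=1) satisfies (2). *)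

theory Defs
  imports "HOL-Analysis.Analysis"
begin

section \<open>The complex Hilbert space of square-integrable functions\<close>

definition square_integrable :: "('a::euclidean_space \<Rightarrow> complex) set" where
  "square_integrable =
     {f \<in> borel_measurable lborel. integrable lborel (\<lambda>x. (cmod (f x))\<^sup>2)}"

lemma square_integrable_measurable:
  "f \<in> square_integrable \<Longrightarrow> f \<in> borel_measurable lborel"
  by (simp add: square_integrable_def)

lemma square_integrable_zero: "(\<lambda>x. 0) \<in> square_integrable"
  by (simp add: square_integrable_def)

lemma square_integrable_cmult:
  assumes "f \<in> square_integrable" shows "(\<lambda>x. c * f x) \<in> square_integrable"
  using assms by (auto simp: square_integrable_def norm_mult power_mult_distrib)

lemma square_integrable_add:
  assumes "f \<in> square_integrable" "g \<in> square_integrable"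
  shows "(\<lambda>x. f x + g x) \<in> square_integrable"
proof -
  have m: "f \<in> borel_measurable lborel" "g \<in> borel_measurable lborel"
    using assms by (auto dest: square_integrable_measurable)
  have b: "(cmod (f x + g x))\<^sup>2 \<le> 2 * (cmod (f x))\<^sup>2 + 2 * (cmod (g x))\<^sup>2" for x
  proof -
    have "(cmod (f x + g x))\<^sup>2 \<le> (cmod (f x) + cmod (g x))\<^sup>2"
      by (intro power_mono norm_triangle_ineq) auto
    also have "\<dots> \<le> 2 * (cmod (f x))\<^sup>2 + 2 * (cmod (g x))\<^sup>2"
      using sum_squares_bound[of "cmod (f x)" "cmod (g x)"] by (simp add: power2_sum)
    finally show ?thesis .
  qed
  have "integrable lborel (\<lambda>x. 2 * (cmod (f x))\<^sup>2 + 2 * (cmod (g x))\<^sup>2)"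
    using assms by (auto simp: square_integrable_def)
  then have "integrable lborel (\<lambda>x. (cmod (f x + g x))\<^sup>2)"
    by (rule Bochner_Integration.integrable_bound) (use m b in auto)
  then show ?thesis using m by (simp add: square_integrable_def)
qed

lemma square_integrable_cnj:
  assumes "f \<in> square_integrable" shows "(\<lambda>x. cnj (f x)) \<in> square_integrable"
proof -
  have "(\<lambda>x. cnj (f x)) \<in> borel_measurable lborel"
    by (rule measurable_compose[OF square_integrable_measurable[OF assms]
          borel_measurable_continuous_onI[OF continuous_on_cnj[OF continuous_on_id]]])
  then show ?thesis using assms by (simp add: square_integrable_def)
qed

lemma lborel_distr_uminus_euclidean:
  "distr lborel borel uminus = (lborel :: 'a::euclidean_space measure)"
proof -
  have e: "(0 + (\<Sum>j\<in>Basis. (- 1 * (x \<bullet> j)) *\<^sub>R j)) = - x" for x :: 'a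
    using euclidean_representation[of "-x"] by simp
  have "(lborel :: 'a measure) = density (distr lborel borel uminus) (\<lambda>_. 1)"
    using lborel_affine_euclidean[of "\<lambda>_. -1" "0::'a"] by (simp only: e) simp
  also have "\<dots> = distr lborel borel uminus" by (simp add: density_1)
  finally show ?thesis by simp
qed

lemma square_integrable_reflect:
  fixes f :: "'a::euclidean_space \<Rightarrow> complex"
  assumes "f \<in> square_integrable" shows "(\<lambda>x. f (- x)) \<in> square_integrable"
proof -
  have m: "f \<in> borel_measurable borel"
    using assms by (auto dest: square_integrable_measurable)
  have "integrable (distr lborel borel uminus) (\<lambda>x::'a. (cmod (f x))\<^sup>2)"
    using assms by (simp add: lborel_distr_uminus_euclidean square_integrable_def)
  then have "integrable lborel (\<lambda>x. (cmod (f (- x)))\<^sup>2)"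
    by (subst (asm) integrable_distr_eq) (use m in auto)
  moreover have "(\<lambda>x. f (- x)) \<in> borel_measurable lborel"
    using m by measurable
  ultimately show ?thesis by (simp add: square_integrable_def)
qed

lemma AE_lborel_reflect:
  fixes P :: "'a::euclidean_space \<Rightarrow> bool"
  assumes "AE x in lborel. P x" shows "AE x in lborel. P (- x)"
proof -
  have "AE x in distr lborel borel uminus. P x"
    using assms by (simp only: lborel_distr_uminus_euclidean)
  then show ?thesis by (rule AE_distrD[rotated]) simp
qed

lemma square_integrable_cnj_mult:
  assumes "f \<in> square_integrable" "g \<in> square_integrable"
  shows "integrable lborel (\<lambda>x. cnj (f x) * g x)"
proof -
  have i: "integrable lborel (\<lambda>x. (cmod (f x))\<^sup>2 + (cmod (g x))\<^sup>2)"
    using assms by (auto simp: square_integrable_def)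
  have m: "(\<lambda>x. cnj (f x)) \<in> borel_measurable lborel" "g \<in> borel_measurable lborel"
    by (rule square_integrable_measurable[OF square_integrable_cnj[OF assms(1)]],
        rule square_integrable_measurable[OF assms(2)])
  show ?thesis
  proof (rule Bochner_Integration.integrable_bound[OF i])
    show "(\<lambda>x. cnj (f x) * g x) \<in> borel_measurable lborel"
      using m by measurable
    have "cmod (f x) * cmod (g x) \<le> (cmod (f x))\<^sup>2 + (cmod (g x))\<^sup>2" for x
      using sum_squares_bound[of "cmod (f x)" "cmod (g x)"]
        mult_nonneg_nonneg[OF norm_ge_zero norm_ge_zero, of "f x" "g x"]
      unfolding mult.assoc by linarith
    then show "AE x in lborel. cmod (cnj (f x) * g x) \<le> norm ((cmod (f x))\<^sup>2 + (cmod (g x))\<^sup>2)"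
      by (simp add: norm_mult)
  qed
qed

lemma Re_integral_cnj_mult_self:
  "Re (LINT x|M. cnj (f x) * f x) = (LINT x|M. (cmod (f x))\<^sup>2)"
proof -
  have "cnj (f x) * f x = complex_of_real ((cmod (f x))\<^sup>2)" for x
    using complex_norm_square[of "f x"] by (simp add: mult.commute)
  then have "(LINT x|M. cnj (f x) * f x) = complex_of_real (LINT x|M. (cmod (f x))\<^sup>2)"
    by (simp only: integral_complex_of_real)
  then show ?thesis by simp
qed

text \<open>
  Elements are classes of square-integrable functions modulo equality almost everywhere;
  \<open>abs_L2 f\<close> is the class of \<open>f\<close> and is meaningful only for \<open>f \<in> square_integrable\<close>.
\<close>

quotient_type (overloaded) 'a L2 = "'a::euclidean_space \<Rightarrow> complex" /
  partial: "\<lambda>f g. f \<in> square_integrable \<and> g \<in> square_integrable \<and> (AE x in lborel. f x = g x)"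
  morphisms rep_L2 abs_L2
proof (rule part_equivpI)
  show "\<exists>x::'a \<Rightarrow> complex. x \<in> square_integrable \<and> x \<in> square_integrable \<and> (AE xa in lborel. x xa = x xa)"
    using square_integrable_zero by auto
  show "symp (\<lambda>f g :: 'a \<Rightarrow> complex. f \<in> square_integrable \<and> g \<in> square_integrable \<and> (AE x in lborel. f x = g x))"
    by (auto intro!: sympI elim: eventually_mono)
  show "transp (\<lambda>f g :: 'a \<Rightarrow> complex. f \<in> square_integrable \<and> g \<in> square_integrable \<and> (AE x in lborel. f x = g x))"
    by (rule transpI) (auto elim: eventually_elim2)
qed

text \<open>The inner product is conjugate-linear in its first argument.\<close>

lift_definition cinner :: "'a::euclidean_space L2 \<Rightarrow> 'a L2 \<Rightarrow> complex"
  is "\<lambda>f g. LINT x|lborel. cnj (f x) * g x"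
proof -
  fix f f' g g' :: "'a \<Rightarrow> complex"
  assume a: "f \<in> square_integrable \<and> f' \<in> square_integrable \<and> (AE x in lborel. f x = f' x)"
    "g \<in> square_integrable \<and> g' \<in> square_integrable \<and> (AE x in lborel. g x = g' x)"
  have m: "(\<lambda>x. cnj (f x) * g x) \<in> borel_measurable lborel"
    "(\<lambda>x. cnj (f' x) * g' x) \<in> borel_measurable lborel"
    using a by (blast intro: borel_measurable_integrable square_integrable_cnj_mult)+
  have "AE x in lborel. cnj (f x) * g x = cnj (f' x) * g' x"
    using a by (auto elim: eventually_elim2)
  then show "(LINT x|lborel. cnj (f x) * g x) = (LINT x|lborel. cnj (f' x) * g' x)"
    by (rule integral_cong_AE[OF m])
qed

lift_definition scaleC :: "complex \<Rightarrow> 'a::euclidean_space L2 \<Rightarrow> 'a L2" (infixr \<open>*\<^sub>C\<close> 75)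
  is "\<lambda>c f x. c * f x"
  by (auto intro: square_integrable_cmult elim: eventually_mono)

instantiation L2 :: (euclidean_space) real_vector
begin

lift_definition zero_L2 :: "'a L2" is "\<lambda>x. 0"
  by (auto simp: square_integrable_zero)

lift_definition plus_L2 :: "'a L2 \<Rightarrow> 'a L2 \<Rightarrow> 'a L2" is "\<lambda>f g x. f x + g x"
  by (auto intro: square_integrable_add elim: eventually_elim2)

lift_definition uminus_L2 :: "'a L2 \<Rightarrow> 'a L2" is "\<lambda>f x. - f x"
  using square_integrable_cmult[of _ "-1"] by (auto elim: eventually_mono)

definition minus_L2 :: "'a L2 \<Rightarrow> 'a L2 \<Rightarrow> 'a L2" where
  "minus_L2 u v = u + (- v)"

definition scaleR_L2 :: "real \<Rightarrow> 'a L2 \<Rightarrow> 'a L2" where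
  "scaleR_L2 r u = complex_of_real r *\<^sub>C u"

instance
proof
  fix u v w :: "'a L2" and a b :: real
  show "u + v + w = u + (v + w)"
    by transfer (auto intro!: square_integrable_add simp: add.assoc)
  show "u + v = v + u"
    by transfer (auto intro!: square_integrable_add simp: add.commute)
  show "0 + u = u"
    by transfer auto
  show "- u + u = 0"
    by transfer (auto simp: square_integrable_zero)
  show "u - v = u + - v"
    by (fact minus_L2_def)
  show "a *\<^sub>R (u + v) = a *\<^sub>R u + a *\<^sub>R v"
    unfolding scaleR_L2_def
    by transfer (auto intro!: square_integrable_cmult square_integrable_add simp: distrib_left)
  show "(a + b) *\<^sub>R u = a *\<^sub>R u + b *\<^sub>R u"
    unfolding scaleR_L2_def
    by transfer (auto intro!: square_integrable_cmult square_integrable_add simp: distrib_right)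
  show "a *\<^sub>R b *\<^sub>R u = (a * b) *\<^sub>R u"
    unfolding scaleR_L2_def
    by transfer (auto intro!: square_integrable_cmult simp: mult.assoc)
  show "1 *\<^sub>R u = u"
    unfolding scaleR_L2_def by transfer auto
qed

end

instantiation L2 :: (euclidean_space) real_inner
begin

definition inner_L2 :: "'a L2 \<Rightarrow> 'a L2 \<Rightarrow> real" where
  "inner_L2 u v = Re (cinner u v)"

definition norm_L2 :: "'a L2 \<Rightarrow> real" where
  "norm_L2 u = sqrt (Re (cinner u u))"

definition sgn_L2 :: "'a L2 \<Rightarrow> 'a L2" where
  "sgn_L2 u = u /\<^sub>R norm u"

definition dist_L2 :: "'a L2 \<Rightarrow> 'a L2 \<Rightarrow> real" where
  "dist_L2 u v = norm (u - v)"

definition uniformity_L2 :: "('a L2 \<times> 'a L2) filter" where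
  "uniformity_L2 = (INF e\<in>{0<..}. principal {(u, v). dist u v < e})"

definition open_L2 :: "'a L2 set \<Rightarrow> bool" where
  "open_L2 U \<longleftrightarrow> (\<forall>u\<in>U. eventually (\<lambda>(u', v). u' = u \<longrightarrow> v \<in> U) uniformity)"

instance
proof
  fix u v w :: "'a L2" and r :: real
  show "sgn u = u /\<^sub>R norm u"
    by (fact sgn_L2_def)
  show "dist u v = norm (u - v)"
    by (fact dist_L2_def)
  show "(uniformity :: ('a L2 \<times> 'a L2) filter) = (INF e\<in>{0<..}. principal {(u, v). dist u v < e})"
    by (fact uniformity_L2_def)
  show "open U \<longleftrightarrow> (\<forall>u\<in>U. eventually (\<lambda>(u', v). u' = u \<longrightarrow> v \<in> U) uniformity)" for U :: "'a L2 set"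
    by (fact open_L2_def)
  have "cinner u v = cnj (cinner v u)"
    by transfer (subst Bochner_Integration.integral_cnj[symmetric], simp add: mult.commute)
  then show "u \<bullet> v = v \<bullet> u"
    by (simp add: inner_L2_def)
  have "cinner (u + v) w = cinner u w + cinner v w"
    by transfer (simp add: distrib_right square_integrable_cnj_mult)
  then show "(u + v) \<bullet> w = u \<bullet> w + v \<bullet> w"
    by (simp add: inner_L2_def)
  have "cinner (complex_of_real r *\<^sub>C u) v = complex_of_real r * cinner u v"
    by transfer (simp add: mult.assoc)
  then show "(r *\<^sub>R u) \<bullet> v = r * (u \<bullet> v)"
    by (simp add: inner_L2_def scaleR_L2_def)
  show "0 \<le> u \<bullet> u"
    unfolding inner_L2_def by transfer (simp only: Re_integral_cnj_mult_self, simp)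
  show "u \<bullet> u = 0 \<longleftrightarrow> u = 0"
    unfolding inner_L2_def
  proof transfer
    fix f :: "'a \<Rightarrow> complex"
    assume "f \<in> square_integrable \<and> f \<in> square_integrable \<and> (AE x in lborel. f x = f x)"
    then have f: "f \<in> square_integrable" by simp
    then have "(LINT x|lborel. (cmod (f x))\<^sup>2) = 0 \<longleftrightarrow> (AE x in lborel. (cmod (f x))\<^sup>2 = 0)"
      by (intro integral_nonneg_eq_0_iff_AE) (auto simp: square_integrable_def)
    then show "Re (LINT x|lborel. cnj (f x) * f x) = 0 \<longleftrightarrow>
        f \<in> square_integrable \<and> (\<lambda>x. 0) \<in> square_integrable \<and> (AE x in lborel. f x = 0)"
      using f by (simp add: Re_integral_cnj_mult_self square_integrable_zero)
  qed
  show "norm u = sqrt (u \<bullet> u)"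
    by (simp add: norm_L2_def inner_L2_def)
qed

end

lift_definition parity :: "'a::euclidean_space L2 \<Rightarrow> 'a L2" is "\<lambda>f x. f (- x)"
  using square_integrable_reflect AE_lborel_reflect by blast

lift_definition conjugation :: "'a::euclidean_space L2 \<Rightarrow> 'a L2" is "\<lambda>f x. cnj (f x)"
  by (auto intro: square_integrable_cnj elim: eventually_mono)


section \<open>Unbounded operators\<close>

text \<open>
  An unbounded operator is represented by its graph, so that its domain is
  \<^term>\<open>Domain T\<close> and \<^term>\<open>(u, v) \<in> T\<close> means that \<open>u\<close> is in the domain and is mapped to \<open>v\<close>.
\<close>

type_synonym 'a L2_op = "('a L2 \<times> 'a L2) set"

definition linear_operator :: "'a::euclidean_space L2_op \<Rightarrow> bool" where
  "linear_operator T \<longleftrightarrow>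
     single_valued T \<and> (0, 0) \<in> T \<and>
     (\<forall>(u, v)\<in>T. \<forall>(u', v')\<in>T. (u + u', v + v') \<in> T) \<and>
     (\<forall>(u, v)\<in>T. \<forall>c. (c *\<^sub>C u, c *\<^sub>C v) \<in> T)"

definition adjoint_op :: "'a::euclidean_space L2_op \<Rightarrow> 'a L2_op" where
  "adjoint_op T = {(w, z). \<forall>(u, v)\<in>T. cinner w v = cinner z u}"

definition self_adjoint :: "'a::euclidean_space L2_op \<Rightarrow> bool" where
  "self_adjoint T \<longleftrightarrow> linear_operator T \<and> closure (Domain T) = UNIV \<and> adjoint_op T = T"

definition bounded_below :: "'a::euclidean_space L2_op \<Rightarrow> bool" where
  "bounded_below T \<longleftrightarrow> (\<exists>c::real. \<forall>(u, v)\<in>T. c * (norm u)\<^sup>2 \<le> Re (cinner u v))"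

text \<open>\<open>resolvent T z\<close> is the everywhere defined inverse of \<open>T - z\<close>; it is meaningful only for
  \<open>z\<close> in the resolvent set.\<close>

definition resolvent :: "'a::euclidean_space L2_op \<Rightarrow> complex \<Rightarrow> 'a L2 \<Rightarrow> 'a L2" where
  "resolvent T z v = (THE u. (u, z *\<^sub>C u + v) \<in> T)"

definition resolvent_set :: "'a::euclidean_space L2_op \<Rightarrow> complex set" where
  "resolvent_set T =
     {z. (\<forall>v. \<exists>!u. (u, z *\<^sub>C u + v) \<in> T) \<and> bounded_linear (resolvent T z)}"

definition compact_operator :: "('a::euclidean_space L2 \<Rightarrow> 'a L2) \<Rightarrow> bool" where
  "compact_operator A \<longleftrightarrow> bounded_linear A \<and> compact (closure (A ` cball 0 1))"

definition compact_resolvent :: "'a::euclidean_space L2_op \<Rightarrow> bool" where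
  "compact_resolvent T \<longleftrightarrow>
     resolvent_set T \<noteq> {} \<and> (\<forall>z\<in>resolvent_set T. compact_operator (resolvent T z))"

text \<open>For single-valued \<open>T\<close> the next two conditions say that the symmetry maps the domain of \<open>T\<close>
  into itself and commutes with \<open>T\<close> there.\<close>

definition P_symmetric :: "'a::euclidean_space L2_op \<Rightarrow> bool" where
  "P_symmetric T \<longleftrightarrow> (\<forall>(u, v)\<in>T. (parity u, parity v) \<in> T)"

definition T_symmetric :: "'a::euclidean_space L2_op \<Rightarrow> bool" where
  "T_symmetric T \<longleftrightarrow> (\<forall>(u, v)\<in>T. (conjugation u, conjugation v) \<in> T)"

definition eigenspace :: "'a::euclidean_space L2_op \<Rightarrow> complex \<Rightarrow> 'a L2 set" where
  "eigenspace T z = {u. (u, z *\<^sub>C u) \<in> T}"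

definition eigenvalues :: "'a::euclidean_space L2_op \<Rightarrow> complex set" where
  "eigenvalues T = {z. \<exists>u\<in>eigenspace T z. u \<noteq> 0}"

definition even_eigenvalue :: "'a::euclidean_space L2_op \<Rightarrow> complex \<Rightarrow> bool" where
  "even_eigenvalue T z \<longleftrightarrow> z \<in> eigenvalues T \<and> (\<forall>u\<in>eigenspace T z. parity u = u)"

definition odd_eigenvalue :: "'a::euclidean_space L2_op \<Rightarrow> complex \<Rightarrow> bool" where
  "odd_eigenvalue T z \<longleftrightarrow> z \<in> eigenvalues T \<and> (\<forall>u\<in>eigenspace T z. parity u = - u)"

text \<open>Enumeration of the distinct eigenvalues in increasing order, starting at index \<open>0\<close>.\<close>

definition enumerates_eigenvalues :: "(nat \<Rightarrow> real) \<Rightarrow> 'a::euclidean_space L2_op \<Rightarrow> bool" where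
  "enumerates_eigenvalues l T \<longleftrightarrow>
     strict_mono l \<and> eigenvalues T = complex_of_real ` range l"

definition gap :: "(nat \<Rightarrow> real) \<Rightarrow> real" where
  "gap l = (1 / 2) * (INF r. l (Suc r) - l r)"

definition definite_parity :: "(nat \<Rightarrow> real) \<Rightarrow> 'a::euclidean_space L2_op \<Rightarrow> bool" where
  "definite_parity l T \<longleftrightarrow>
     (\<forall>r. even_eigenvalue T (complex_of_real (l r)) \<or> odd_eigenvalue T (complex_of_real (l r)))"


section \<open>The harmonic oscillator\<close>

definition partial_deriv :: "'n::finite \<Rightarrow> (real^'n \<Rightarrow> complex) \<Rightarrow> real^'n \<Rightarrow> complex" where
  "partial_deriv k f x = vector_derivative (\<lambda>t. f (x + t *\<^sub>R axis k 1)) (at 0)"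

text \<open>
  \<open>foldr partial_deriv ks f\<close> is the iterated partial derivative of \<open>f\<close> along the list of
  directions \<open>ks\<close>. All of them being differentiable amounts to smoothness of \<open>f\<close>.
\<close>

definition schwartz :: "(real^'n \<Rightarrow> complex) set" where
  "schwartz =
     {f. \<forall>ks. foldr partial_deriv ks f differentiable_on UNIV \<and>
              (\<forall>m::nat. bounded (range (\<lambda>x. norm x ^ m *\<^sub>R foldr partial_deriv ks f x)))}"

definition oscillator_expr ::
    "('n::finite \<Rightarrow> real) \<Rightarrow> (real^'n \<Rightarrow> complex) \<Rightarrow> real^'n \<Rightarrow> complex" where
  "oscillator_expr \<omega> f x =
     (1 / 2) * (\<Sum>k\<in>UNIV. - partial_deriv k (partial_deriv k f) x
                          + complex_of_real ((\<omega> k)\<^sup>2 * (x $ k)\<^sup>2) * f x)"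

text \<open>
  The standard realization is the closure of the differential expression on Schwartz functions,
  which is essentially self-adjoint there. Since Schwartz functions are square-integrable and
  the expression preserves them, \<open>abs_L2\<close> is meaningful here.
\<close>

definition harmonic_oscillator :: "('n::finite \<Rightarrow> real) \<Rightarrow> (real^'n) L2_op" where
  "harmonic_oscillator \<omega> =
     closure {(abs_L2 f, abs_L2 (oscillator_expr \<omega> f)) | f. f \<in> schwartz}"

end

theory Submission
  imports Defs "HOL-Probability.Levy" "HOL-Probability.Sinc_Integral"
    "HOL-Computational_Algebra.Polynomial"
begin

text \<open>
  The products of one-dimensional Hermite functions are Schwartz eigenfunctions of the oscillator.
  They are orthogonal because the one-coordinate oscillators are symmetric and separate their
  multi-indices. They are total: if \<open>f\<close> is orthogonal to all of them, then, one
  coordinate at a time, the moments of the exponentially integrable function \<open>f\<close> times a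
  Gaussian vanish, hence so does its Fourier transform in that coordinate, and Levy's uniqueness
  theorem allows the Hermite polynomial to be replaced by an arbitrary indicator function; in the
  end the integral over every box is zero. So the closure of the differential
  expression is the diagonal operator in this basis, which gives its spectral properties.

  With \<open>Q\<close> the product of the \<open>q k\<close>, the eigenvalues are
  \<open>\<omega>\<^sub>0 / Q * (\<Sum>k. w k * n k) + const\<close> with positive integers \<open>w k\<close>, whence the gap. If
  all \<open>p k\<close> and \<open>q k\<close> are odd, so are the \<open>w k\<close>, and the eigenvalue determines the parity of
  \<open>\<Sum>k. n k\<close>, which is the parity of the eigenfunction. In dimension two, with
  \<open>w a : w c = P : R\<close> in lowest terms, the multi-indices \<open>(R, 0)\<close> and \<open>(0, P)\<close> share an
  eigenvalue, so definite parity forces \<open>P\<close> and \<open>R\<close> to be both odd.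
\<close>

section \<open>The Hilbert space structure of \<open>L2\<close>\<close>

text \<open>The operator is given only as the closure of its graph on Schwartz functions, so
  self-adjointness has to be derived. The closure is identified with a maximal diagonal relation:
  the coefficient identity holds on Schwartz functions by symmetry and is a closed condition, and
  conversely the truncated Hermite expansions of \<open>u\<close> and \<open>v\<close> stay in the
  graph and converge together.

  Commensurable frequencies can make total energies coincide. Orthogonality therefore cannot be read
  off the full oscillator, which is why the single-coordinate operators appear.

  Totality is obtained without slicing functions along coordinates: a signed weight on the whole
  space is pushed forward under one coordinate function. This requires integrability of the weight
  against \<open>exp (t * \<bar>x $ k\<bar>)\<close> for every \<open>t\<close>, which the Gaussian
  factor supplies. The integrability bounds for Gaussians and Schwartz functions go through the
  single product weight \<open>cauchy_weight\<close>.\<close>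

lemma Re_cinner_self: "Re (cinner u u) = (norm u)\<^sup>2"
  using power2_norm_eq_inner[of u] by (simp add: inner_L2_def)

lemma cinner_commute: "cinner u v = cnj (cinner v u)"
  by transfer (subst Bochner_Integration.integral_cnj[symmetric], simp add: mult.commute)

lemma cinner_add_left: "cinner (u + v) w = cinner u w + cinner v w"
  by transfer (simp add: distrib_right square_integrable_cnj_mult)

lemma cinner_scaleC_left: "cinner (c *\<^sub>C u) v = cnj c * cinner u v"
  by transfer (simp add: mult.assoc)

lemma cinner_add_right: "cinner u (v + w) = cinner u v + cinner u w"
  by (subst (1 2 3) cinner_commute) (simp add: cinner_add_left)

lemma cinner_scaleC_right: "cinner u (c *\<^sub>C v) = c * cinner u v"
  by (subst (1 2) cinner_commute) (simp add: cinner_scaleC_left)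

lemma uminus_L2_eq_scaleC: "- u = (-1) *\<^sub>C (u :: 'a::euclidean_space L2)"
  using scaleR_L2_def[of "-1" u] by simp

lemma cinner_minus_left: "cinner (- u) v = - cinner u v"
  by (simp add: uminus_L2_eq_scaleC cinner_scaleC_left)

lemma cinner_minus_right: "cinner u (- v) = - cinner u v"
  by (simp add: uminus_L2_eq_scaleC cinner_scaleC_right)

lemma cinner_diff_left: "cinner (u - v) w = cinner u w - cinner v w"
  using cinner_add_left[of u "-v" w] by (simp add: cinner_minus_left)

lemma cinner_diff_right: "cinner u (v - w) = cinner u v - cinner u w"
  using cinner_add_right[of u v "-w"] by (simp add: cinner_minus_right)

lemma cinner_zero_left [simp]: "cinner 0 u = 0"
  using cinner_diff_left[of 0 0 u] by simp

lemma cinner_zero_right [simp]: "cinner u 0 = 0"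
  using cinner_diff_right[of u 0 0] by simp

lemma cinner_sum_right: "cinner u (\<Sum>i\<in>A. f i) = (\<Sum>i\<in>A. cinner u (f i))"
  by (induction A rule: infinite_finite_induct) (simp_all add: cinner_add_right)

lemma cinner_sum_left: "cinner (\<Sum>i\<in>A. f i) u = (\<Sum>i\<in>A. cinner (f i) u)"
  by (induction A rule: infinite_finite_induct) (simp_all add: cinner_add_left)

lemma scaleC_scaleC: "a *\<^sub>C (b *\<^sub>C u) = (a * b) *\<^sub>C (u :: 'a::euclidean_space L2)"
  by transfer (auto simp: mult.assoc intro!: square_integrable_cmult)

lemma scaleC_one [simp]: "1 *\<^sub>C u = (u :: 'a::euclidean_space L2)"
  by transfer simp

lemma scaleC_add_right: "a *\<^sub>C (u + v) = a *\<^sub>C u + a *\<^sub>C (v :: 'a::euclidean_space L2)"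
  by transfer (auto simp: distrib_left intro!: square_integrable_cmult square_integrable_add)

lemma scaleC_add_left: "(a + b) *\<^sub>C u = a *\<^sub>C u + b *\<^sub>C (u :: 'a::euclidean_space L2)"
  by transfer (auto simp: distrib_right intro!: square_integrable_cmult square_integrable_add)

lemma scaleC_zero_left [simp]: "0 *\<^sub>C u = (0 :: 'a::euclidean_space L2)"
  using scaleR_L2_def[of 0 u] by simp

lemma scaleC_zero_right [simp]: "c *\<^sub>C (0 :: 'a::euclidean_space L2) = 0"
  using scaleC_add_right[of c "0 :: 'a L2" 0] by simp

lemma scaleC_minus_left: "(- a) *\<^sub>C u = - (a *\<^sub>C (u :: 'a::euclidean_space L2))"
  by (simp add: uminus_L2_eq_scaleC scaleC_scaleC)

lemma norm_scaleC: "norm (c *\<^sub>C (u :: 'a::euclidean_space L2)) = cmod c * norm u"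
proof -
  have "(norm (c *\<^sub>C u))\<^sup>2 = Re ((cnj c * c) * cinner u u)"
    by (simp only: Re_cinner_self[symmetric] cinner_scaleC_left cinner_scaleC_right
        ac_simps)
  also have "cnj c * c = complex_of_real ((cmod c)\<^sup>2)"
    using complex_norm_square[of c] by (simp add: mult.commute)
  also have "Re (complex_of_real ((cmod c)\<^sup>2) * cinner u u) = (cmod c * norm u)\<^sup>2"
    by (simp add: Re_cinner_self power_mult_distrib del: of_real_power)
  finally show ?thesis by (simp add: power2_eq_iff_nonneg)
qed

lemma cinner_eq_Complex: "cinner u v = Complex (u \<bullet> v) ((\<i> *\<^sub>C u) \<bullet> v)"
  by (simp add: inner_L2_def cinner_scaleC_left complex_eq_iff)

text \<open>Multiplying \<open>u\<close> by the imaginary unit turns the imaginary part of the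
  product into a real part, so continuity and limits reduce to the real inner product.\<close>

lemma cinner_eq_inner: "cinner u v = of_real (u \<bullet> v) + \<i> * of_real ((\<i> *\<^sub>C u) \<bullet> v)"
  by (simp add: cinner_eq_Complex complex_eq_iff)

lemma continuous_on_cinner_right [continuous_intros]:
  assumes "continuous_on S f" shows "continuous_on S (\<lambda>x. cinner u (f x))"
  unfolding cinner_eq_inner using assms by (intro continuous_intros)

lemma tendsto_cinner_right [tendsto_intros]:
  assumes "(f \<longlongrightarrow> v) F" shows "((\<lambda>x. cinner u (f x)) \<longlongrightarrow> cinner u v) F"
  unfolding cinner_eq_inner using assms by (intro tendsto_intros)

lemma tendsto_cinner_left [tendsto_intros]:
  assumes "(f \<longlongrightarrow> v) F" shows "((\<lambda>x. cinner (f x) u) \<longlongrightarrow> cinner v u) F"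
  by (subst (1 2) cinner_commute) (use assms in \<open>intro tendsto_intros\<close>)

text \<open>Scaling \<open>u\<close> by \<open>c = cinner u v\<close> makes the product real and
  equal to the squared modulus of \<open>c\<close>, so the real Cauchy-Schwarz inequality
  applies.\<close>

lemma cmod_cinner_le: "cmod (cinner u v) \<le> norm u * norm v"
proof -
  define c where "c = cinner u v"
  have "(cmod c)\<^sup>2 = Re (cinner (c *\<^sub>C u) v)"
    using complex_norm_square[of c]
    by (simp add: cinner_scaleC_left c_def[symmetric] mult.commute complex_eq_iff)
  also have "\<dots> \<le> norm (c *\<^sub>C u) * norm v"
    using norm_cauchy_schwarz[of "c *\<^sub>C u" v] by (simp add: inner_L2_def)
  finally have "cmod c * cmod c \<le> cmod c * (norm u * norm v)"
    by (simp add: norm_scaleC power2_eq_square mult.assoc)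
  then show ?thesis
    unfolding c_def[symmetric]
    by (cases "c = 0") auto
qed

lemma bounded_linear_scaleC_left: "bounded_linear (\<lambda>c. c *\<^sub>C (u :: 'a::euclidean_space L2))"
proof (rule bounded_linear_intro[where K = "norm u"])
  show "(r *\<^sub>R c) *\<^sub>C u = r *\<^sub>R (c *\<^sub>C u)" for r c
    by (simp add: scaleR_L2_def scaleC_scaleC scaleR_conv_of_real)
qed (simp_all add: scaleC_add_left norm_scaleC)

section \<open>Parity and conjugation as isometric symmetries\<close>

lemma cinner_parity_parity: "cinner (parity u) (parity v) = cinner u v"
proof transfer
  fix f g :: "'a \<Rightarrow> complex"
  assume a: "f \<in> square_integrable \<and> f \<in> square_integrable \<and> (AE x in lborel. f x = f x)"
    "g \<in> square_integrable \<and> g \<in> square_integrable \<and> (AE x in lborel. g x = g x)"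
  have m: "(\<lambda>x. cnj (f x) * g x) \<in> borel_measurable borel"
    using borel_measurable_integrable[OF square_integrable_cnj_mult[of f g]] a by simp
  have "(LINT x|lborel. cnj (f x) * g x) = (LINT x|distr lborel borel uminus. cnj (f x) * g x)"
    by (simp only: lborel_distr_uminus_euclidean)
  also have "\<dots> = (LINT x|lborel. cnj (f (- x)) * g (- x))"
    by (subst integral_distr) (use m in auto)
  finally show "(LINT x|lborel. cnj (f (- x)) * g (- x)) = (LINT x|lborel. cnj (f x) * g x)" ..
qed

lemma parity_parity [simp]: "parity (parity u) = u"
  by transfer (auto intro: square_integrable_reflect)

lemma cinner_conjugation: "cinner (conjugation u) (conjugation v) = cnj (cinner u v)"
  by transfer (subst Bochner_Integration.integral_cnj[symmetric], simp)

section \<open>Square-integrable representatives of L2 classes\<close>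

lemma abs_L2_eqI:
  "f \<in> square_integrable \<Longrightarrow> g \<in> square_integrable \<Longrightarrow> AE x in lborel. f x = g x \<Longrightarrow>
     abs_L2 f = abs_L2 g"
  by (rule Quotient_rel_abs[OF Quotient_L2]) simp

lemma abs_L2_cases:
  obtains f where "f \<in> square_integrable" "u = abs_L2 f"
  by (induction u rule: L2.abs_induct) blast

lemma norm_abs_L2:
  "f \<in> square_integrable \<Longrightarrow> (norm (abs_L2 f))\<^sup>2 = (LINT x|lborel. (cmod (f x))\<^sup>2)"
  by (simp add: Re_cinner_self[symmetric] cinner.abs_eq Re_integral_cnj_mult_self)

lemma abs_L2_diff:
  assumes "f \<in> square_integrable" "g \<in> square_integrable"
  shows "abs_L2 f - abs_L2 g = abs_L2 (\<lambda>x. f x - g x)"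
  using assms square_integrable_cmult[OF assms(2), of "-1"]
  by (simp add: minus_L2_def uminus_L2.abs_eq plus_L2.abs_eq)

lemma square_integrable_diff:
  assumes "f \<in> square_integrable" "g \<in> square_integrable"
  shows "(\<lambda>x. f x - g x) \<in> square_integrable"
  using square_integrable_add[OF assms(1) square_integrable_cmult[OF assms(2), of "-1"]] by simp

lemma nn_integral_cmod_square:
  "f \<in> square_integrable \<Longrightarrow>
     (\<integral>\<^sup>+x. ennreal ((cmod (f x))\<^sup>2) \<partial>lborel) = ennreal ((norm (abs_L2 f))\<^sup>2)"
  by (subst nn_integral_eq_integral) (auto simp: norm_abs_L2 square_integrable_def)

lemma square_integrableI_nn_integral:
  assumes "f \<in> borel_measurable lborel"
    and "(\<integral>\<^sup>+x. ennreal ((cmod (f x))\<^sup>2) \<partial>lborel) < \<infinity>"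
  shows "f \<in> square_integrable"
  unfolding square_integrable_def mem_Collect_eq
  by (rule conjI[OF assms(1)], rule integrableI_bounded) (use assms in auto)

section \<open>Completeness and orthonormal bases\<close>

text \<open>Geometric decay of the distances makes the increments absolutely summable at almost
  every point, which yields a pointwise limit. Fatou's lemma then turns the distance bounds between
  members of the sequence into bounds for the limit.\<close>

lemma L2_fast_Cauchy_limit:
  fixes F :: "nat \<Rightarrow> 'a::euclidean_space \<Rightarrow> complex"
  assumes F: "\<And>k. F k \<in> square_integrable"
    and d: "\<And>k n. k \<le> n \<Longrightarrow> norm (abs_L2 (F n) - abs_L2 (F k)) \<le> (1 / 2) ^ k"
  obtains f where "f \<in> square_integrable" "\<And>k. norm (abs_L2 f - abs_L2 (F k)) \<le> (1 / 2) ^ k"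
proof -
  have Fm [measurable]: "F k \<in> borel_measurable borel" for k
    using square_integrable_measurable[OF F[of k]] by simp
  have sq: "(\<lambda>x. F n x - F k x) \<in> square_integrable" for n k
    by (intro square_integrable_diff F)
  have bd: "(\<integral>\<^sup>+x. ennreal ((cmod (F n x - F k x))\<^sup>2) \<partial>lborel) \<le> ennreal (((1 / 2) ^ k)\<^sup>2)"
    if "k \<le> n" for n k
    using d[OF that] by (subst nn_integral_cmod_square[OF sq])
      (simp add: abs_L2_diff F ennreal_leI power_mono)
  \<comment> \<open>The weight \<open>2 ^ k\<close> balances two demands: the integral of
    \<open>g k\<close> is at most \<open>2 ^ k * (1 / 4) ^ k = (1 / 2) ^ k\<close>, hence summable,
    while an increment of modulus \<open>t\<close> still satisfies
    \<open>t \<le> (1 / 2) ^ k + 2 ^ k * t\<^sup>2\<close>. Square summability thus becomes absolute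
    summability.\<close>
  define g where "g k x = 2 ^ k * (cmod (F (Suc k) x - F k x))\<^sup>2" for k x
  have g0: "0 \<le> g k x" for k x
    by (simp add: g_def)
  have gm [measurable]: "g k \<in> borel_measurable borel" for k
    unfolding g_def by measurable
  have "(\<integral>\<^sup>+x. (\<Sum>k. ennreal (g k x)) \<partial>lborel) = (\<Sum>k. \<integral>\<^sup>+x. ennreal (g k x) \<partial>lborel)"
    by (rule nn_integral_suminf) measurable
  also have "\<dots> \<le> (\<Sum>k. ennreal ((1 / 2) ^ k))"
  proof (rule suminf_le)
    fix k
    have "(\<integral>\<^sup>+x. ennreal (g k x) \<partial>lborel)
        = ennreal (2 ^ k) * (\<integral>\<^sup>+x. ennreal ((cmod (F (Suc k) x - F k x))\<^sup>2) \<partial>lborel)"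
      by (subst nn_integral_cmult[symmetric]) (auto simp: g_def ennreal_mult)
    also have "\<dots> \<le> ennreal (2 ^ k) * ennreal (((1 / 2) ^ k)\<^sup>2)"
      by (intro mult_left_mono bd) auto
    also have "\<dots> = ennreal ((1 / 2) ^ k)"
      by (subst ennreal_mult[symmetric]) (simp_all add: power2_eq_square power_divide)
    finally show "(\<integral>\<^sup>+x. ennreal (g k x) \<partial>lborel) \<le> ennreal ((1 / 2) ^ k)" .
  qed auto
  also have "\<dots> = ennreal (\<Sum>k. (1 / 2) ^ k)"
    by (intro suminf_ennreal2) auto
  finally have "(\<integral>\<^sup>+x. (\<Sum>k. ennreal (g k x)) \<partial>lborel) \<noteq> \<infinity>"
    by (auto simp: top_unique)
  then have "AE x in lborel. (\<Sum>k. ennreal (g k x)) \<noteq> \<infinity>"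
    by (intro nn_integral_noteq_infinite) auto
  then have conv: "AE x in lborel. convergent (\<lambda>n. F n x)"
  proof eventually_elim
    fix x
    assume "(\<Sum>k. ennreal (g k x)) \<noteq> \<infinity>"
    then have "summable (\<lambda>k. g k x)"
      using g0 by (intro summable_suminf_not_top) auto
    then have s: "summable (\<lambda>k. (1 / 2) ^ k + g k x)"
      by (intro summable_add) auto
    have "cmod (F (Suc k) x - F k x) \<le> (1 / 2) ^ k + g k x" for k
    proof -
      define t where "t = cmod (F (Suc k) x - F k x)"
      define s :: real where "s = 2 ^ k"
      have "s > 0" "t \<ge> 0" by (simp_all add: s_def t_def)
      have "t \<le> 1 / s + s * t\<^sup>2"
      proof (cases "t \<le> 1 / s")
        case True
        then show ?thesis using \<open>s > 0\<close> by (simp add: add_increasing2)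
      next
        case False
        then have "1 \<le> s * t" using \<open>s > 0\<close> by (simp add: field_simps)
        then have "t * 1 \<le> t * (s * t)" using \<open>t \<ge> 0\<close> by (rule mult_left_mono)
        moreover have "1 / s \<ge> 0" using \<open>s > 0\<close> by simp
        moreover have "t * (s * t) = s * t\<^sup>2"
          by (simp add: power2_eq_square)
        ultimately show ?thesis by linarith
      qed
      then show ?thesis by (simp add: g_def t_def s_def power_divide)
    qed
    then have "summable (\<lambda>k. F (Suc k) x - F k x)"
      by (intro summable_comparison_test'[OF s, of 0]) auto
    then have "(\<lambda>n. \<Sum>k<n. F (Suc k) x - F k x) \<longlonglongrightarrow> (\<Sum>k. F (Suc k) x - F k x)"
      by (rule summable_LIMSEQ)
    then have "(\<lambda>n. F n x - F 0 x) \<longlonglongrightarrow> (\<Sum>k. F (Suc k) x - F k x)"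
      by (subst (asm) sum_lessThan_telescope)
    then have "(\<lambda>n. (F n x - F 0 x) + F 0 x) \<longlonglongrightarrow> (\<Sum>k. F (Suc k) x - F k x) + F 0 x"
      by (intro tendsto_intros)
    then show "convergent (\<lambda>n. F n x)"
      by (auto simp: convergent_def)
  qed
  define f where "f x = lim (\<lambda>n. F n x)" for x
  have fm [measurable]: "f \<in> borel_measurable borel"
    unfolding f_def by measurable
  \<comment> \<open>Fatou's lemma in the index \<open>n\<close>, with \<open>k\<close>
    fixed.\<close>
  have fb: "(\<integral>\<^sup>+x. ennreal ((cmod (f x - F k x))\<^sup>2) \<partial>lborel) \<le> ennreal (((1 / 2) ^ k)\<^sup>2)" for k
  proof -
    have "(\<integral>\<^sup>+x. ennreal ((cmod (f x - F k x))\<^sup>2) \<partial>lborel)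
        = (\<integral>\<^sup>+x. liminf (\<lambda>n. ennreal ((cmod (F n x - F k x))\<^sup>2)) \<partial>lborel)"
    proof (rule nn_integral_cong_AE, use conv in eventually_elim)
      fix x
      assume "convergent (\<lambda>n. F n x)"
      then have "(\<lambda>n. F n x) \<longlonglongrightarrow> f x"
        by (simp add: f_def convergent_LIMSEQ_iff)
      then have "(\<lambda>n. ennreal ((cmod (F n x - F k x))\<^sup>2)) \<longlonglongrightarrow> ennreal ((cmod (f x - F k x))\<^sup>2)"
        by (intro tendsto_intros)
      then show "ennreal ((cmod (f x - F k x))\<^sup>2)
          = liminf (\<lambda>n. ennreal ((cmod (F n x - F k x))\<^sup>2))"
        by (metis lim_imp_Liminf sequentially_bot)
    qed
    also have "\<dots> \<le> liminf (\<lambda>n. \<integral>\<^sup>+x. ennreal ((cmod (F n x - F k x))\<^sup>2) \<partial>lborel)"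
      by (rule nn_integral_liminf) measurable
    also have "\<dots> \<le> ennreal (((1 / 2) ^ k)\<^sup>2)"
      by (rule Liminf_le) (use bd in \<open>auto intro!: eventually_sequentiallyI[of k]\<close>)
    finally show ?thesis .
  qed
  have fd: "(\<lambda>x. f x - F k x) \<in> square_integrable" for k
    by (rule square_integrableI_nn_integral)
      (use fb[of k] in \<open>auto simp: le_less_trans ennreal_less_top\<close>)
  have "(\<lambda>x. (f x - F 0 x) + F 0 x) \<in> square_integrable"
    by (intro square_integrable_add fd F)
  then have f: "f \<in> square_integrable" by simp
  have "norm (abs_L2 f - abs_L2 (F k)) \<le> (1 / 2) ^ k" for k
  proof -
    have "ennreal ((norm (abs_L2 f - abs_L2 (F k)))\<^sup>2) \<le> ennreal (((1 / 2) ^ k)\<^sup>2)"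
      using fb[of k] by (simp add: nn_integral_cmod_square[OF fd] abs_L2_diff f F)
    then show ?thesis
      by (subst (asm) ennreal_le_iff) (auto dest: power2_le_imp_le)
  qed
  then show ?thesis using that f by blast
qed

instance L2 :: (euclidean_space) complete_space
proof
  fix X :: "nat \<Rightarrow> 'a L2"
  assume "Cauchy X"
  then have "\<exists>N. \<forall>m\<ge>N. \<forall>n\<ge>N. dist (X m) (X n) < (1 / 2) ^ k" for k :: nat
    by (intro metric_CauchyD) auto
  then obtain N where N: "\<And>k m n. m \<ge> N k \<Longrightarrow> n \<ge> N k \<Longrightarrow> dist (X m) (X n) < (1 / 2) ^ k"
    by metis
  \<comment> \<open>Adding up the thresholds makes the indices monotone and keeps each of them at
    least \<open>N k\<close>.\<close>
  define r where "r k = (\<Sum>i\<le>k. N i)" for k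
  have rN: "N k \<le> r k" for k
    unfolding r_def by (rule member_le_sum) auto
  have rm: "r k \<le> r n" if "k \<le> n" for k n
    unfolding r_def using that by (intro sum_mono2) auto
  have "\<exists>f. f \<in> square_integrable \<and> X (r k) = abs_L2 f" for k
    by (metis abs_L2_cases)
  then obtain F where F: "\<And>k. F k \<in> square_integrable" "\<And>k. X (r k) = abs_L2 (F k)"
    by metis
  have d: "norm (abs_L2 (F n) - abs_L2 (F k)) \<le> (1 / 2) ^ k" if "k \<le> n" for k n
    using N[of k "r n" "r k"] rN[of k] rm[OF that] by (simp add: dist_norm F)
  obtain f where f: "\<And>k. norm (abs_L2 f - abs_L2 (F k)) \<le> (1 / 2) ^ k"
    using L2_fast_Cauchy_limit[OF F(1) d] by blast
  have "X \<longlonglongrightarrow> abs_L2 f"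
  proof (rule metric_LIMSEQ_I)
    fix e :: real
    assume "0 < e"
    then obtain k :: nat where k: "(1 / 2) ^ k < e / 2"
      using real_arch_pow_inv[of "e / 2" "1 / 2"] by auto
    have "dist (X n) (abs_L2 f) < e" if "n \<ge> N k" for n
    proof -
      have "dist (X n) (abs_L2 f) \<le> dist (X n) (X (r k)) + dist (X (r k)) (abs_L2 f)"
        by (rule dist_triangle)
      also have "dist (X (r k)) (abs_L2 f) \<le> (1 / 2) ^ k"
        using f[of k] by (simp add: F dist_norm norm_minus_commute)
      also have "dist (X n) (X (r k)) < (1 / 2) ^ k"
        using N[OF that rN] .
      finally show ?thesis using k by simp
    qed
    then show "\<exists>no. \<forall>n\<ge>no. dist (X n) (abs_L2 f) < e" by blast
  qed
  then show "convergent X" by (auto simp: convergent_def)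
qed

text \<open>Totality is required as triviality of the orthogonal complement, the form in which it is
  proved for Hermite functions. Convergence of expansions then comes from completeness of the
  space.\<close>

locale orthonormal_basis =
  fixes b :: "nat \<Rightarrow> 'a::euclidean_space L2"
  assumes orthonormal: "cinner (b i) (b j) = (if i = j then 1 else 0)"
    and total: "(\<And>j. cinner (b j) u = 0) \<Longrightarrow> u = 0"
begin

lemma b_nonzero: "b j \<noteq> 0"
  using orthonormal[of j j] by auto

lemma norm_b [simp]: "norm (b j) = 1"
  using orthonormal[of j j] by (simp add: norm_L2_def)

lemma cinner_b_sum:
  "finite A \<Longrightarrow> cinner (b i) (\<Sum>j\<in>A. a j *\<^sub>C b j) = (if i \<in> A then a i else 0)"
  by (simp add: cinner_sum_right cinner_scaleC_right orthonormal if_distrib[of "\<lambda>x. _ * x"]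
      cong: if_cong)

lemma norm_sum_b:
  assumes "finite A"
  shows "(norm (\<Sum>j\<in>A. a j *\<^sub>C b j))\<^sup>2 = (\<Sum>j\<in>A. (cmod (a j))\<^sup>2)"
proof -
  have "cinner (\<Sum>j\<in>A. a j *\<^sub>C b j) (\<Sum>j\<in>A. a j *\<^sub>C b j) = (\<Sum>j\<in>A. cnj (a j) * a j)"
    unfolding cinner_sum_left cinner_scaleC_left by (simp add: cinner_b_sum assms)
  also have "\<dots> = (\<Sum>j\<in>A. complex_of_real ((cmod (a j))\<^sup>2))"
    by (intro sum.cong refl) (metis complex_norm_square mult.commute of_real_power)
  finally show ?thesis
    by (simp add: Re_cinner_self[symmetric])
qed

lemma Bessel: "(\<Sum>j<n. (cmod (cinner (b j) u))\<^sup>2) \<le> (norm u)\<^sup>2"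
proof -
  define S where "S = (\<Sum>j<n. cinner (b j) u *\<^sub>C b j)"
  have "cinner S (u - S) = 0"
    by (subst S_def)
      (simp add: cinner_sum_left cinner_scaleC_left cinner_diff_right cinner_b_sum S_def)
  then have o: "S \<bullet> (u - S) = 0" by (simp add: inner_L2_def)
  have "(norm u)\<^sup>2 = (norm (S + (u - S)))\<^sup>2" by simp
  also have "\<dots> = (norm S)\<^sup>2 + (norm (u - S))\<^sup>2"
    unfolding power2_norm_eq_inner inner_add_left inner_add_right
    using o by (simp add: inner_commute)
  finally show ?thesis by (simp add: S_def norm_sum_b)
qed

lemma summable_coefficients: "summable (\<lambda>j. (cmod (cinner (b j) u))\<^sup>2)"
proof (rule bounded_imp_summable)
  show "(\<Sum>j\<le>n. (cmod (cinner (b j) u))\<^sup>2) \<le> (norm u)\<^sup>2" for n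
    using Bessel[where n = "Suc n"] by (simp add: lessThan_Suc_atMost)
qed simp

lemma Riesz_Fischer:
  assumes "summable (\<lambda>j. (cmod (a j))\<^sup>2)"
  obtains u where "(\<lambda>n. \<Sum>j<n. a j *\<^sub>C b j) \<longlonglongrightarrow> u" "\<And>j. cinner (b j) u = a j"
proof -
  have "Cauchy (\<lambda>n. \<Sum>j<n. a j *\<^sub>C b j)"
  proof (rule CauchyI)
    fix e :: real
    assume "0 < e"
    then obtain N where N: "\<And>m n. N \<le> m \<Longrightarrow> norm (\<Sum>j\<in>{m..<n}. (cmod (a j))\<^sup>2) < e\<^sup>2"
      using assms unfolding summable_Cauchy by (metis zero_less_power)
    have *: "norm ((\<Sum>j<n. a j *\<^sub>C b j) - (\<Sum>j<m. a j *\<^sub>C b j)) < e" if "N \<le> m" "m \<le> n" for m n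
    proof -
      have "(\<Sum>j<n. a j *\<^sub>C b j) - (\<Sum>j<m. a j *\<^sub>C b j) = (\<Sum>j\<in>{m..<n}. a j *\<^sub>C b j)"
        using sum_diff_nat_ivl[of 0 m n "\<lambda>j. a j *\<^sub>C b j"] that by (simp add: lessThan_atLeast0)
      then have "(norm ((\<Sum>j<n. a j *\<^sub>C b j) - (\<Sum>j<m. a j *\<^sub>C b j)))\<^sup>2
          = (\<Sum>j\<in>{m..<n}. (cmod (a j))\<^sup>2)"
        by (simp add: norm_sum_b)
      then show ?thesis
        using N[OF that(1), of n] \<open>0 < e\<close> by (intro power2_less_imp_less[of _ e]) auto
    qed
    then show "\<exists>M. \<forall>m\<ge>M. \<forall>n\<ge>M.
        norm ((\<Sum>j<m. a j *\<^sub>C b j) - (\<Sum>j<n. a j *\<^sub>C b j)) < e"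
      by (metis nle_le norm_minus_commute)
  qed
  then obtain u where u: "(\<lambda>n. \<Sum>j<n. a j *\<^sub>C b j) \<longlonglongrightarrow> u"
    using Cauchy_convergent convergent_def by blast
  have "cinner (b i) u = a i" for i
  proof (rule LIMSEQ_unique)
    show "(\<lambda>n. cinner (b i) (\<Sum>j<n. a j *\<^sub>C b j)) \<longlonglongrightarrow> cinner (b i) u"
      by (intro tendsto_intros u)
    show "(\<lambda>n. cinner (b i) (\<Sum>j<n. a j *\<^sub>C b j)) \<longlonglongrightarrow> a i"
      by (rule tendsto_eventually)
        (rule eventually_mono[OF eventually_gt_at_top[of i]], simp add: cinner_b_sum)
  qed
  with u show ?thesis using that by blast
qed

text \<open>The Fourier series converges to some vector with the same coefficients as
  \<open>u\<close>; totality leaves \<open>u\<close> as the only candidate.\<close>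

lemma expansion: "(\<lambda>n. \<Sum>j<n. cinner (b j) u *\<^sub>C b j) \<longlonglongrightarrow> u"
proof -
  obtain u' where u': "(\<lambda>n. \<Sum>j<n. cinner (b j) u *\<^sub>C b j) \<longlonglongrightarrow> u'"
    "\<And>j. cinner (b j) u' = cinner (b j) u"
    using Riesz_Fischer[OF summable_coefficients] by metis
  have "u' - u = 0"
    by (rule total) (simp add: cinner_diff_right u')
  with u' show ?thesis by simp
qed

lemma eqI: "(\<And>j. cinner (b j) u = cinner (b j) v) \<Longrightarrow> u = v"
  using total[of "u - v"] by (simp add: cinner_diff_right)

text \<open>Truncated images of the unit ball under the resolvent lie in such boxes. Each new basis
  vector adds, as a Minkowski sum, the continuous image of a compact disc.\<close>

lemma compact_coefficient_box:
  "compact {\<Sum>j<n. a j *\<^sub>C b j | a. \<forall>j<n. cmod (a j) \<le> M}"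
proof (induction n)
  case 0
  then show ?case by simp
next
  case (Suc n)
  let ?K = "{\<Sum>j<n. a j *\<^sub>C b j | a. \<forall>j<n. cmod (a j) \<le> M}"
  let ?L = "(\<lambda>c. c *\<^sub>C b n) ` cball 0 M"
  have "compact ?L"
    by (intro compact_continuous_image compact_cball
        bounded_linear.continuous_on[OF bounded_linear_scaleC_left] continuous_on_id)
  with Suc have "compact {x + y | x y. x \<in> ?K \<and> y \<in> ?L}"
    by (rule compact_sums)
  also have "{x + y | x y. x \<in> ?K \<and> y \<in> ?L}
      = {\<Sum>j<Suc n. a j *\<^sub>C b j | a. \<forall>j<Suc n. cmod (a j) \<le> M}" (is "?A = ?B")
  proof (intro equalityI subsetI)
    fix x assume "x \<in> ?A"
    then obtain a c where x: "x = (\<Sum>j<n. a j *\<^sub>C b j) + c *\<^sub>C b n"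
      and a: "\<forall>j<n. cmod (a j) \<le> M" and c: "cmod c \<le> M"
      by (auto simp: mem_cball_0)
    define a' where "a' = a(n := c)"
    have "(\<Sum>j<n. a j *\<^sub>C b j) = (\<Sum>j<n. a' j *\<^sub>C b j)"
      by (intro sum.cong) (auto simp: a'_def)
    moreover have "a' n = c" by (simp add: a'_def)
    ultimately have "x = (\<Sum>j<Suc n. a' j *\<^sub>C b j)" using x by simp
    moreover have "\<forall>j<Suc n. cmod (a' j) \<le> M"
      using a c by (auto simp: a'_def less_Suc_eq)
    ultimately show "x \<in> ?B" by blast
  next
    fix x assume "x \<in> ?B"
    then obtain a where x: "x = (\<Sum>j<Suc n. a j *\<^sub>C b j)" and a': "\<forall>j<Suc n. cmod (a j) \<le> M"
      by blast
    from a' have a: "\<forall>j<n. cmod (a j) \<le> M" "cmod (a n) \<le> M" by auto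
    from a(1) have "(\<Sum>j<n. a j *\<^sub>C b j) \<in> ?K" by blast
    moreover from a(2) have "a n *\<^sub>C b n \<in> ?L" by simp
    moreover from x have "x = (\<Sum>j<n. a j *\<^sub>C b j) + a n *\<^sub>C b n" by simp
    ultimately show "x \<in> ?A" by blast
  qed
  finally show ?case .
qed

end

section \<open>Diagonal operators\<close>

text \<open>The relation has maximal domain: \<open>u\<close> belongs to it as soon as the rescaled
  coefficients are those of some vector \<open>v\<close>. Nonnegativity of \<open>lam\<close> puts
  -1 into the resolvent set, and divergence of \<open>lam\<close> gives compactness.\<close>

locale diagonal_operator = orthonormal_basis b for b :: "nat \<Rightarrow> 'a::euclidean_space L2" +
  fixes lam :: "nat \<Rightarrow> real" and T :: "'a L2_op"
  assumes T_eq: "T = {(u, v). \<forall>j. cinner (b j) v = of_real (lam j) * cinner (b j) u}"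
    and lam_nonneg: "0 \<le> lam j"
    and lam_at_top: "filterlim lam at_top sequentially"
begin

lemma mem_iff: "(u, v) \<in> T \<longleftrightarrow> (\<forall>j. cinner (b j) v = of_real (lam j) * cinner (b j) u)"
  by (simp add: T_eq)

lemma basis_mem: "(b j, of_real (lam j) *\<^sub>C b j) \<in> T"
  by (simp add: mem_iff cinner_scaleC_right orthonormal)

lemma single_valued_T: "single_valued T"
  unfolding single_valued_def by (auto intro!: eqI simp: mem_iff)

lemma linear_operator_T: "linear_operator T"
  unfolding linear_operator_def
  by (auto simp: single_valued_T mem_iff cinner_add_right cinner_scaleC_right algebra_simps)

lemma partial_sum_mem:
  "(\<Sum>j<n. a j *\<^sub>C b j, \<Sum>j<n. (of_real (lam j) * a j) *\<^sub>C b j) \<in> T"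
  by (simp add: mem_iff cinner_b_sum)

lemma tendsto_quadratic_form:
  assumes "(u, v) \<in> T"
  shows "(\<lambda>n. \<Sum>j<n. of_real (lam j) * (cnj (cinner (b j) u) * cinner (b j) u')) \<longlonglongrightarrow> cinner v u'"
proof -
  have "(\<lambda>n. cinner (\<Sum>j<n. cinner (b j) v *\<^sub>C b j) u') \<longlonglongrightarrow> cinner v u'"
    by (intro tendsto_intros expansion)
  then show ?thesis
    using assms by (simp add: cinner_sum_left cinner_scaleC_left mem_iff mult.assoc)
qed

lemma symmetric:
  assumes "(u, v) \<in> T" "(u', v') \<in> T"
  shows "cinner u v' = cinner v u'"
proof (rule LIMSEQ_unique)
  show "(\<lambda>n. \<Sum>j<n. of_real (lam j) * (cnj (cinner (b j) u) * cinner (b j) u')) \<longlonglongrightarrow> cinner v u'"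
    by (rule tendsto_quadratic_form[OF assms(1)])
  have "(\<lambda>n. cinner (\<Sum>j<n. cinner (b j) u *\<^sub>C b j) v') \<longlonglongrightarrow> cinner u v'"
    by (intro tendsto_intros expansion)
  then show "(\<lambda>n. \<Sum>j<n. of_real (lam j) * (cnj (cinner (b j) u) * cinner (b j) u')) \<longlonglongrightarrow> cinner u v'"
    using assms(2) by (simp add: cinner_sum_left cinner_scaleC_left mem_iff mult.left_commute)
qed

text \<open>Testing the adjoint relation on basis vectors alone already yields the coefficient
  identity, since the \<open>lam j\<close> are real; by maximality of the domain this is membership
  in \<open>T\<close>. The converse inclusion is symmetry.\<close>

lemma adjoint_T: "adjoint_op T = T"
proof (intro equalityI subsetI; clarify)
  fix w z
  assume "(w, z) \<in> adjoint_op T"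
  then have "cinner w (of_real (lam j) *\<^sub>C b j) = cinner z (b j)" for j
    using basis_mem unfolding adjoint_op_def by blast
  then have "cnj (cinner w (of_real (lam j) *\<^sub>C b j)) = cnj (cinner z (b j))" for j
    by simp
  then have "cinner (b j) z = of_real (lam j) * cinner (b j) w" for j
    unfolding cinner_commute[symmetric] by (simp add: cinner_scaleC_left)
  then show "(w, z) \<in> T" by (simp add: mem_iff)
next
  fix w z
  assume "(w, z) \<in> T"
  then show "(w, z) \<in> adjoint_op T"
    by (auto simp: adjoint_op_def intro: symmetric)
qed

lemma closure_Domain: "closure (Domain T) = UNIV"
proof (intro equalityI subsetI UNIV_I)
  fix u
  have "(\<Sum>j<n. cinner (b j) u *\<^sub>C b j) \<in> Domain T" for n
    by (rule DomainI[OF partial_sum_mem])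
  then show "u \<in> closure (Domain T)"
    unfolding closure_sequential
    by (intro exI[of _ "\<lambda>n. \<Sum>j<n. cinner (b j) u *\<^sub>C b j"] conjI allI expansion)
qed

lemma self_adjoint_T: "self_adjoint T"
  by (simp add: self_adjoint_def linear_operator_T adjoint_T closure_Domain)

lemma Re_cinner_nonneg:
  assumes "(u, v) \<in> T"
  shows "0 \<le> Re (cinner v u)"
proof (rule tendsto_lowerbound)
  show "((\<lambda>n. Re (\<Sum>j<n. of_real (lam j) * (cnj (cinner (b j) u) * cinner (b j) u))) \<longlongrightarrow> Re (cinner v u))
      sequentially"
    by (intro tendsto_intros tendsto_quadratic_form assms)
  have "0 \<le> Re (\<Sum>j<n. of_real (lam j) * (cnj (cinner (b j) u) * cinner (b j) u))" for n
    using lam_nonneg by (auto intro!: sum_nonneg mult_nonneg_nonneg)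
  then show "\<forall>\<^sub>F n in sequentially. 0 \<le> Re (\<Sum>j<n. of_real (lam j) * (cnj (cinner (b j) u) * cinner (b j) u))"
    by simp
qed simp

lemma bounded_below_T: "bounded_below T"
  unfolding bounded_below_def
proof (intro exI[of _ 0] ballI, clarify)
  fix u v
  assume "(u, v) \<in> T"
  then show "0 * (norm u)\<^sup>2 \<le> Re (cinner u v)"
    using Re_cinner_nonneg by (subst cinner_commute) simp
qed

section \<open>Eigenvalues and compactness of the resolvent\<close>

lemma mem_eigenspace: "u \<in> eigenspace T z \<longleftrightarrow> (\<forall>j. z \<noteq> of_real (lam j) \<longrightarrow> cinner (b j) u = 0)"
  by (auto simp: eigenspace_def mem_iff cinner_scaleC_right)

lemma b_mem_eigenspace: "b j \<in> eigenspace T (of_real (lam j))"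
  by (auto simp: mem_eigenspace orthonormal)

lemma eigenvalues_T: "eigenvalues T = of_real ` range lam"
proof -
  have "(\<exists>u\<in>eigenspace T z. u \<noteq> 0) \<longleftrightarrow> (\<exists>j. z = of_real (lam j))" for z
  proof
    assume "\<exists>u\<in>eigenspace T z. u \<noteq> 0"
    then obtain u where u: "u \<in> eigenspace T z" "u \<noteq> 0" by blast
    then obtain j where "cinner (b j) u \<noteq> 0" using total[of u] by blast
    with u(1) show "\<exists>j. z = of_real (lam j)"
      unfolding mem_eigenspace by blast
  next
    assume "\<exists>j. z = of_real (lam j)"
    then show "\<exists>u\<in>eigenspace T z. u \<noteq> 0"
      using b_mem_eigenspace b_nonzero by blast
  qed
  then show ?thesis by (auto simp: eigenvalues_def)
qed

text \<open>The coefficients are divided by \<open>lam j + 1\<close>, which is at least 1. They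
  remain square summable and Riesz-Fischer supplies the preimage.\<close>

lemma minus_one_mem_resolvent_set: "-1 \<in> resolvent_set T"
proof -
  have ne: "of_real (lam j) + 1 \<noteq> (0 :: complex)" for j
    using lam_nonneg[of j] by (simp add: complex_eq_iff)
  have mem: "(u, (-1) *\<^sub>C u + v) \<in> T \<longleftrightarrow> (\<forall>j. cinner (b j) u = cinner (b j) v / (of_real (lam j) + 1))"
    for u v
    using ne by (auto simp: mem_iff cinner_add_right cinner_scaleC_right field_simps
        scaleC_minus_left cinner_minus_right cinner_diff_right)
  have ex: "\<exists>!u. (u, (-1) *\<^sub>C u + v) \<in> T" for v
  proof -
    have le: "cmod (cinner (b j) v / (of_real (lam j) + 1)) \<le> cmod (cinner (b j) v)" for j
    proof -
      have "1 \<le> cmod (of_real (lam j) + 1)"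
        using lam_nonneg[of j] complex_Re_le_cmod[of "of_real (lam j) + 1"] by simp
      then show ?thesis
        using mult_right_mono[of 1 "cmod (of_real (lam j) + 1)" "cmod (cinner (b j) v)"]
        unfolding norm_divide by (simp add: divide_le_eq mult.commute)
    qed
    have "summable (\<lambda>j. (cmod (cinner (b j) v / (of_real (lam j) + 1)))\<^sup>2)"
    proof (rule summable_comparison_test'[OF summable_coefficients[of v], of 0])
      show "norm ((cmod (cinner (b j) v / (of_real (lam j) + 1)))\<^sup>2) \<le> (cmod (cinner (b j) v))\<^sup>2" for j
        using power_mono[OF le norm_ge_zero, of j 2] by simp
    qed
    from Riesz_Fischer[OF this]
    obtain u where "\<And>j. cinner (b j) u = cinner (b j) v / (of_real (lam j) + 1)"
      by metis
    then show ?thesis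
      unfolding mem by (intro ex1I[of _ u]) (auto intro: eqI)
  qed
  define R where "R = resolvent T (-1)"
  have R: "(R v, (-1) *\<^sub>C R v + v) \<in> T" for v
    unfolding R_def resolvent_def by (rule theI'[OF ex])
  have Rb: "cinner (b j) (R v) = cinner (b j) v / (of_real (lam j) + 1)" for j v
    using R[of v] unfolding mem by blast
  have "bounded_linear R"
  proof (rule bounded_linear_intro[where K = 1])
    show "R (u + v) = R u + R v" for u v
      by (rule eqI) (simp add: Rb cinner_add_right add_divide_distrib)
    show "R (r *\<^sub>R u) = r *\<^sub>R R u" for r u
      by (rule eqI) (simp add: Rb scaleR_L2_def cinner_scaleC_right)
    show "norm (R v) \<le> norm v * 1" for v
    proof -
      \<comment> \<open>\<open>T\<close> maps \<open>R v\<close> to \<open>v - R v\<close>, so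
        positivity of \<open>T\<close> bounds the squared norm of \<open>R v\<close> by the inner
        product of \<open>v\<close> and \<open>R v\<close>.\<close>
      have "0 \<le> Re (cinner ((-1) *\<^sub>C R v + v) (R v))"
        by (rule Re_cinner_nonneg[OF R])
      then have "(norm (R v))\<^sup>2 \<le> v \<bullet> R v"
        by (simp add: cinner_add_left cinner_scaleC_left Re_cinner_self inner_L2_def
            scaleC_minus_left cinner_minus_left cinner_diff_left)
      also have "\<dots> \<le> norm v * norm (R v)"
        by (rule norm_cauchy_schwarz)
      finally show ?thesis
        by (cases "R v = 0") (auto simp: power2_eq_square)
    qed
  qed
  with ex show ?thesis by (simp add: resolvent_set_def R_def)
qed

text \<open>The resolvent divides the coefficients by \<open>lam j - z\<close>, whose modulus tends
  to infinity. Up to a small uniform error the image of the unit ball is therefore contained in a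
  compact coefficient box, hence totally bounded.\<close>

lemma compact_operator_resolvent:
  assumes z: "z \<in> resolvent_set T"
  shows "compact_operator (resolvent T z)"
proof -
  define R where "R = resolvent T z"
  have ex: "\<exists>!u. (u, z *\<^sub>C u + v) \<in> T" for v
    using z by (auto simp: resolvent_set_def)
  have bl: "bounded_linear R"
    using z by (auto simp: resolvent_set_def R_def)
  have R: "(R v, z *\<^sub>C R v + v) \<in> T" for v
    unfolding R_def resolvent_def by (rule theI'[OF ex])
  \<comment> \<open>At an eigenvalue, both 0 and \<open>b j\<close> would solve the resolvent
    equation with right-hand side 0.\<close>
  have zne: "z \<noteq> of_real (lam j)" for j
  proof
    assume "z = of_real (lam j)"
    then have "(b j, z *\<^sub>C b j + 0) \<in> T" "(0, z *\<^sub>C 0 + 0) \<in> T"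
      using basis_mem linear_operator_T by (auto simp: linear_operator_def)
    with ex[of 0] have "b j = 0" by blast
    with b_nonzero show False by blast
  qed
  have Rb: "cmod (cinner (b j) (R v)) * cmod (of_real (lam j) - z) = cmod (cinner (b j) v)" for j v
  proof -
    have "z * cinner (b j) (R v) + cinner (b j) v = of_real (lam j) * cinner (b j) (R v)"
      using R[of v] by (simp add: mem_iff cinner_add_right cinner_scaleC_right)
    then have "cinner (b j) v = cinner (b j) (R v) * (of_real (lam j) - z)"
      by (simp add: algebra_simps eq_diff_eq)
    then show ?thesis by (simp add: norm_mult)
  qed
  obtain M where M: "\<And>v. norm (R v) \<le> norm v * M"
    using bounded_linear.bounded[OF bl] by blast
  let ?S = "R ` cball 0 1"
  \<comment> \<open>From index \<open>n\<close> on, each coefficient of \<open>R v\<close> is at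
    most \<open>e\<close> times that of \<open>v\<close>, and Bessel's inequality sums these up
    uniformly over the unit ball.\<close>
  have tail: "norm (R v - (\<Sum>j<n. cinner (b j) (R v) *\<^sub>C b j)) \<le> e"
    if e: "0 < e" and n: "\<And>j. n \<le> j \<Longrightarrow> 1 / e \<le> cmod (of_real (lam j) - z)" and v: "norm v \<le> 1" for v n e
  proof (rule tendsto_upperbound)
    show "(\<lambda>m. norm ((\<Sum>j<m. cinner (b j) (R v) *\<^sub>C b j) - (\<Sum>j<n. cinner (b j) (R v) *\<^sub>C b j)))
        \<longlonglongrightarrow> norm (R v - (\<Sum>j<n. cinner (b j) (R v) *\<^sub>C b j))"
      by (intro tendsto_intros expansion)
    have "norm ((\<Sum>j<m. cinner (b j) (R v) *\<^sub>C b j) - (\<Sum>j<n. cinner (b j) (R v) *\<^sub>C b j)) \<le> e"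
      if "n \<le> m" for m
    proof (rule power2_le_imp_le)
      have "(\<Sum>j<m. cinner (b j) (R v) *\<^sub>C b j) - (\<Sum>j<n. cinner (b j) (R v) *\<^sub>C b j)
          = (\<Sum>j\<in>{n..<m}. cinner (b j) (R v) *\<^sub>C b j)"
        using sum_diff_nat_ivl[of 0 n m "\<lambda>j. cinner (b j) (R v) *\<^sub>C b j"] that
        by (simp add: lessThan_atLeast0)
      then have "(norm ((\<Sum>j<m. cinner (b j) (R v) *\<^sub>C b j) - (\<Sum>j<n. cinner (b j) (R v) *\<^sub>C b j)))\<^sup>2
          = (\<Sum>j\<in>{n..<m}. (cmod (cinner (b j) (R v)))\<^sup>2)"
        by (simp add: norm_sum_b)
      also have "\<dots> \<le> (\<Sum>j\<in>{n..<m}. e\<^sup>2 * (cmod (cinner (b j) v))\<^sup>2)"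
      proof (rule sum_mono)
        fix j assume "j \<in> {n..<m}"
        then have "cmod (cinner (b j) (R v)) * (1 / e) \<le> cmod (cinner (b j) v)"
          using n[of j] by (subst Rb[symmetric]) (simp add: mult_left_mono del: times_divide_eq_right)
        then have "cmod (cinner (b j) (R v)) \<le> e * cmod (cinner (b j) v)"
          using e by (simp add: field_simps)
        then have "(cmod (cinner (b j) (R v)))\<^sup>2 \<le> (e * cmod (cinner (b j) v))\<^sup>2"
          by (rule power_mono) simp
        then show "(cmod (cinner (b j) (R v)))\<^sup>2 \<le> e\<^sup>2 * (cmod (cinner (b j) v))\<^sup>2"
          by (simp add: power_mult_distrib)
      qed
      also have "\<dots> \<le> e\<^sup>2 * (\<Sum>j<m. (cmod (cinner (b j) v))\<^sup>2)"
        unfolding sum_distrib_left[symmetric] by (intro mult_left_mono sum_mono2) auto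
      also have "\<dots> \<le> e\<^sup>2 * (norm v)\<^sup>2"
        by (intro mult_left_mono Bessel) auto
      also have "\<dots> \<le> e\<^sup>2 * 1"
        using v by (intro mult_left_mono) (auto simp: power_le_one)
      finally show "(norm ((\<Sum>j<m. cinner (b j) (R v) *\<^sub>C b j) - (\<Sum>j<n. cinner (b j) (R v) *\<^sub>C b j)))\<^sup>2
          \<le> e\<^sup>2" by simp
    qed (use e in simp)
    then show "\<forall>\<^sub>F m in sequentially.
        norm ((\<Sum>j<m. cinner (b j) (R v) *\<^sub>C b j) - (\<Sum>j<n. cinner (b j) (R v) *\<^sub>C b j)) \<le> e"
      by (rule eventually_sequentiallyI)
  qed simp
  have "compact (closure ?S)"
    unfolding compact_eq_totally_bounded
  proof (intro conjI allI impI)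
    show "complete (closure ?S)" by (simp add: complete_eq_closed)
    fix e :: real
    assume "0 < e"
    then have e: "0 < e / 4" by simp
    have "\<forall>\<^sub>F j in sequentially. 4 / e + cmod z \<le> lam j"
      using lam_at_top by (simp add: filterlim_at_top)
    then obtain n where n: "\<And>j. n \<le> j \<Longrightarrow> 4 / e + cmod z \<le> lam j"
      by (auto simp: eventually_sequentially)
    \<comment> \<open>Subtracting \<open>cmod z\<close> leaves at least \<open>4 / e\<close>, the
      reciprocal of the tolerance \<open>e / 4\<close>. Together with an \<open>e / 4\<close>-net of
      the box this gives radius \<open>e / 2\<close>.\<close>
    have n': "1 / (e / 4) \<le> cmod (of_real (lam j) - z)" if "n \<le> j" for j
      using n[OF that] norm_triangle_ineq2[of "of_real (lam j)" z] by simp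
    define K where "K = {\<Sum>j<n. a j *\<^sub>C b j | a. \<forall>j<n. cmod (a j) \<le> \<bar>M\<bar>}"
    have "compact K" unfolding K_def by (rule compact_coefficient_box)
    then obtain k where k: "finite k" "K \<subseteq> (\<Union>x\<in>k. ball x (e / 4))"
      unfolding compact_eq_totally_bounded using e by blast
    \<comment> \<open>Closed balls of half the radius are used because this covering passes to the
      closure and still fits into open balls of radius \<open>e\<close>.\<close>
    have "?S \<subseteq> (\<Union>x\<in>k. cball x (e / 2))"
    proof
      fix u assume "u \<in> ?S"
      then obtain v where v: "norm v \<le> 1" and u: "u = R v" by auto
      define P where "P = (\<Sum>j<n. cinner (b j) (R v) *\<^sub>C b j)"
      have "norm (R v) \<le> \<bar>M\<bar>"
        using M[of v] mult_right_mono[OF v, of "\<bar>M\<bar>"] mult_left_mono[OF abs_ge_self[of M] norm_ge_zero[of v]]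
        by linarith
      then have "cmod (cinner (b j) (R v)) \<le> \<bar>M\<bar>" for j
        using cmod_cinner_le[of "b j" "R v"] by simp
      then have "P \<in> K"
        unfolding K_def P_def by (intro CollectI exI[of _ "\<lambda>j. cinner (b j) (R v)"]) auto
      then obtain x where x: "x \<in> k" "dist x P < e / 4" using k by auto
      have "norm (R v - P) \<le> e / 4"
        unfolding P_def by (rule tail[OF e n' v])
      then have "dist x u \<le> e / 2"
        using x(2) dist_triangle[of x u P] by (simp add: u dist_norm norm_minus_commute)
      then show "u \<in> (\<Union>x\<in>k. cball x (e / 2))" using x(1) by auto
    qed
    then have "closure ?S \<subseteq> (\<Union>x\<in>k. cball x (e / 2))"
      using k(1) by (intro closure_minimal) (auto intro: closed_UN)
    also have "\<dots> \<subseteq> (\<Union>x\<in>k. ball x e)"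
      using \<open>0 < e\<close> by (intro UN_mono) auto
    finally show "\<exists>k. finite k \<and> closure ?S \<subseteq> (\<Union>x\<in>k. ball x e)" using k(1) by blast
  qed
  with bl show ?thesis by (simp add: compact_operator_def R_def)
qed

lemma compact_resolvent_T: "compact_resolvent T"
  unfolding compact_resolvent_def
  using minus_one_mem_resolvent_set compact_operator_resolvent by blast

section \<open>Time reversal, parity and the parity of eigenvalues\<close>

lemma T_symmetric_T:
  assumes "\<And>j. conjugation (b j) = b j"
  shows "T_symmetric T"
proof -
  have "cinner (b j) (conjugation u) = cnj (cinner (b j) u)" for j u
    using cinner_conjugation[of "b j" u] assms by simp
  then show ?thesis by (auto simp: T_symmetric_def mem_iff)
qed

context
  fixes m :: "nat \<Rightarrow> nat"
  assumes parity_b: "parity (b j) = (-1) ^ m j *\<^sub>C b j"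
begin

lemma cinner_b_parity: "cinner (b j) (parity u) = (-1) ^ m j * cinner (b j) u"
  using cinner_parity_parity[of "b j" "parity u"]
  by (simp add: parity_b cinner_scaleC_left)

lemma P_symmetric_T: "P_symmetric T"
  by (auto simp: P_symmetric_def mem_iff cinner_b_parity)

text \<open>\<open>parity\<close> multiplies the j-th coefficient by \<open>(-1) ^ m j\<close>, and
  an eigenspace consists of the vectors supported on the indices with that value of
  \<open>lam\<close>. Evenness can thus be tested on the basis vectors in the eigenspace.\<close>

lemma even_eigenvalue_iff:
  "even_eigenvalue T (of_real (lam j)) \<longleftrightarrow> (\<forall>i. lam i = lam j \<longrightarrow> even (m i))"
proof
  assume e: "even_eigenvalue T (of_real (lam j))"
  show "\<forall>i. lam i = lam j \<longrightarrow> even (m i)"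
  proof (intro allI impI)
    fix i assume "lam i = lam j"
    then have "parity (b i) = b i"
      using e b_mem_eigenspace[of i] by (simp add: even_eigenvalue_def)
    then have "cinner (b i) (b i) = (-1) ^ m i * cinner (b i) (b i)"
      using cinner_b_parity[of i "b i"] by simp
    then show "even (m i)"
      by (cases "even (m i)") (simp_all add: orthonormal)
  qed
next
  assume *: "\<forall>i. lam i = lam j \<longrightarrow> even (m i)"
  have "parity u = u" if "u \<in> eigenspace T (of_real (lam j))" for u
  proof (rule eqI)
    fix i
    show "cinner (b i) (parity u) = cinner (b i) u"
      using that * by (cases "lam i = lam j") (auto simp: mem_eigenspace cinner_b_parity)
  qed
  then show "even_eigenvalue T (of_real (lam j))"
    by (simp add: even_eigenvalue_def eigenvalues_T)
qed

lemma odd_eigenvalue_iff: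
  "odd_eigenvalue T (of_real (lam j)) \<longleftrightarrow> (\<forall>i. lam i = lam j \<longrightarrow> odd (m i))"
proof
  assume e: "odd_eigenvalue T (of_real (lam j))"
  show "\<forall>i. lam i = lam j \<longrightarrow> odd (m i)"
  proof (intro allI impI)
    fix i assume "lam i = lam j"
    then have "parity (b i) = - b i"
      using e b_mem_eigenspace[of i] by (simp add: odd_eigenvalue_def)
    then have "- cinner (b i) (b i) = (-1) ^ m i * cinner (b i) (b i)"
      using cinner_b_parity[of i "b i"] by (simp add: cinner_minus_right)
    then show "odd (m i)"
      by (cases "even (m i)") (simp_all add: orthonormal)
  qed
next
  assume *: "\<forall>i. lam i = lam j \<longrightarrow> odd (m i)"
  have "parity u = - u" if "u \<in> eigenspace T (of_real (lam j))" for u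
  proof (rule eqI)
    fix i
    show "cinner (b i) (parity u) = cinner (b i) (- u)"
      using that * by (cases "lam i = lam j")
        (auto simp: mem_eigenspace cinner_b_parity cinner_minus_right)
  qed
  then show "odd_eigenvalue T (of_real (lam j))"
    by (simp add: odd_eigenvalue_def eigenvalues_T)
qed

text \<open>Only the range of \<open>l\<close> matters, and it equals the range of
  \<open>lam\<close>. What remains is whether the value of \<open>lam\<close> determines the parity
  of \<open>m\<close>, a purely arithmetical question.\<close>

lemma definite_parity_iff:
  assumes l: "enumerates_eigenvalues l T"
  shows "definite_parity l T \<longleftrightarrow> (\<forall>i j. lam i = lam j \<longrightarrow> even (m i) = even (m j))"
proof -
  have "range l = range lam"
    using l by (simp add: enumerates_eigenvalues_def eigenvalues_T inj_image_eq_iff inj_of_real)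
  then have "definite_parity l T \<longleftrightarrow>
      (\<forall>j. even_eigenvalue T (of_real (lam j)) \<or> odd_eigenvalue T (of_real (lam j)))"
    unfolding definite_parity_def by (metis rangeE rangeI)
  then show ?thesis
    unfolding even_eigenvalue_iff odd_eigenvalue_iff by metis
qed

end

end

section \<open>Polynomials times Gaussians and Hermite polynomials\<close>

text \<open>The product form makes integrability a matter of one variable, and the decay is only
  polynomial, so Schwartz functions lie below a multiple of it.\<close>

definition cauchy_weight :: "real^'n \<Rightarrow> real" where
  "cauchy_weight x = (\<Prod>k\<in>UNIV. 1 / (1 + (x $ k)\<^sup>2))"

lemma one_plus_square_pos: "0 < 1 + (y::real)\<^sup>2"
  by (simp add: add_pos_nonneg)

lemma cauchy_weight_pos: "0 < cauchy_weight x"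
  unfolding cauchy_weight_def by (intro prod_pos) (simp add: one_plus_square_pos)

lemma cauchy_weight_le_1: "cauchy_weight x \<le> 1"
  unfolding cauchy_weight_def by (intro prod_le_1) (simp add: one_plus_square_pos less_imp_le)

lemma prod_Basis_vec: "(\<Prod>b\<in>(Basis :: (real^'n) set). h b) = (\<Prod>k\<in>UNIV. h (axis k 1))"
proof -
  have B: "(Basis :: (real^'n) set) = range (\<lambda>k. axis k 1)"
    by (auto simp: Basis_vec_def)
  have "inj (\<lambda>k. axis k (1::real) :: real^'n)"
    by (auto simp: inj_on_def axis_eq_axis)
  then show ?thesis unfolding B by (simp add: prod.reindex)
qed

lemma integrable_inverse_one_plus_square: "integrable lborel (\<lambda>y::real. 1 / (1 + y\<^sup>2))"
  using integrable_inverse_1_plus_square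
  by (simp add: set_integrable_def einterval_def inverse_eq_divide)

lemma integrable_cauchy_weight: "integrable lborel (cauchy_weight :: real^'n \<Rightarrow> real)"
proof (rule integrableI_bounded)
  show "(cauchy_weight :: real^'n \<Rightarrow> real) \<in> borel_measurable lborel"
    unfolding cauchy_weight_def by (auto intro!: borel_measurable_continuous_onI continuous_intros
        simp: add_nonneg_eq_0_iff)
  have "(\<integral>\<^sup>+x. ennreal (norm (cauchy_weight (x :: real^'n))) \<partial>lborel)
      = (\<integral>\<^sup>+x. (\<Prod>b\<in>(Basis :: (real^'n) set). ennreal (1 / (1 + (x \<bullet> b)\<^sup>2))) \<partial>lborel)"
    using cauchy_weight_pos
    by (intro nn_integral_cong) (simp add: less_imp_le prod_Basis_vec cauchy_weight_def inner_axis
        prod_ennreal abs_prod)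
  also have "\<dots> = (\<Prod>b\<in>(Basis :: (real^'n) set). \<integral>\<^sup>+y. ennreal (1 / (1 + y\<^sup>2)) \<partial>lborel)"
    by (rule nn_integral_lborel_prod) auto
  also have "\<dots> < \<infinity>"
    by (simp add: nn_integral_eq_integral[OF integrable_inverse_one_plus_square]
        prod_ennreal integral_nonneg_AE ennreal_power)
  finally show "(\<integral>\<^sup>+x. ennreal (norm (cauchy_weight (x :: real^'n))) \<partial>lborel) < \<infinity>" .
qed

text \<open>The weight is at most 1, so the square of the bound is again dominated by a multiple of
  the weight.\<close>

lemma square_integrable_weight_bound:
  fixes f :: "real^'n \<Rightarrow> complex"
  assumes m: "f \<in> borel_measurable borel" and b: "\<And>x. cmod (f x) \<le> C * cauchy_weight x"
  shows "f \<in> square_integrable"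
proof -
  have "integrable lborel (\<lambda>x. (cmod (f x))\<^sup>2)"
  proof (rule Bochner_Integration.integrable_bound)
    show "integrable lborel (\<lambda>x :: real^'n. C\<^sup>2 * cauchy_weight x)"
      by (intro integrable_mult_right integrable_cauchy_weight)
    have "(cmod (f x))\<^sup>2 \<le> C\<^sup>2 * cauchy_weight x" for x
    proof -
      have "(cmod (f x))\<^sup>2 \<le> (C * cauchy_weight x)\<^sup>2"
        by (rule power_mono[OF b norm_ge_zero])
      also have "\<dots> = C\<^sup>2 * cauchy_weight x * cauchy_weight x"
        by (simp add: power2_eq_square)
      also have "\<dots> \<le> C\<^sup>2 * cauchy_weight x"
        using cauchy_weight_le_1[of x] cauchy_weight_pos[of x] by (intro mult_left_le) auto
      finally show ?thesis .
    qed
    then show "AE x in lborel. norm ((cmod (f x))\<^sup>2) \<le> norm (C\<^sup>2 * cauchy_weight x)"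
      using cauchy_weight_pos by (intro AE_I2) (simp add: abs_mult abs_of_pos[OF cauchy_weight_pos])
  qed (use m in measurable)
  with m show ?thesis by (simp add: square_integrable_def)
qed

section \<open>Gaussian decay of polynomials and products over the coordinates\<close>

lemma poly_le_exp:
  fixes p :: "real poly"
  obtains C j where "0 \<le> C" "0 \<le> j" "\<And>x. \<bar>poly p x\<bar> \<le> C * exp (j * \<bar>x\<bar>)"
proof -
  have "\<exists>C j. 0 \<le> C \<and> 0 \<le> j \<and> (\<forall>x. \<bar>poly p x\<bar> \<le> C * exp (j * \<bar>x\<bar>))"
  proof (induction p)
    case 0
    then show ?case by (intro exI[of _ 0]) auto
  next
    case (pCons a p)
    then obtain C j where Cj: "0 \<le> C" "0 \<le> j" "\<And>x. \<bar>poly p x\<bar> \<le> C * exp (j * \<bar>x\<bar>)" by auto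
    have "\<bar>poly (pCons a p) x\<bar> \<le> (\<bar>a\<bar> + C) * exp ((j + 1) * \<bar>x\<bar>)" for x
    proof -
      have "\<bar>poly (pCons a p) x\<bar> \<le> \<bar>a\<bar> * 1 + \<bar>x\<bar> * \<bar>poly p x\<bar>"
        using abs_triangle_ineq[of a "x * poly p x"] by (simp add: abs_mult)
      also have "\<bar>a\<bar> * 1 \<le> \<bar>a\<bar> * exp ((j + 1) * \<bar>x\<bar>)"
        using Cj(2) by (intro mult_left_mono) auto
      also have "\<bar>x\<bar> * \<bar>poly p x\<bar> \<le> exp \<bar>x\<bar> * (C * exp (j * \<bar>x\<bar>))"
        using exp_ge_add_one_self[of "\<bar>x\<bar>"] Cj(3)[of x] by (intro mult_mono) linarith+
      also have "\<dots> = C * exp ((j + 1) * \<bar>x\<bar>)"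
        by (simp add: exp_add algebra_simps)
      finally show ?thesis by (simp add: algebra_simps)
    qed
    then show ?case using Cj by (intro exI[of _ "\<bar>a\<bar> + C"] exI[of _ "j + 1"]) auto
  qed
  then show ?thesis using that by blast
qed

lemma poly_exp_gauss_bound:
  fixes p :: "real poly" and c t :: real
  assumes "0 < c"
  obtains C where "0 \<le> C"
    "\<And>x. \<bar>poly p x\<bar> * exp (- (c * x\<^sup>2 / 2)) * exp (t * \<bar>x\<bar>) \<le> C / (1 + x\<^sup>2)"
proof -
  obtain C j where Cj: "0 \<le> C" "0 \<le> j" "\<And>x. \<bar>poly p x\<bar> \<le> C * exp (j * \<bar>x\<bar>)"
    by (rule poly_le_exp[of p]) blast
  \<comment> \<open>The exponential rates collected: \<open>j\<close> bounds the polynomial,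
    \<open>t\<close> is prescribed, and 1 absorbs the factor \<open>1 + x\<^sup>2\<close>.\<close>
  define s where "s = j + t + 1"
  have "\<bar>poly p x\<bar> * exp (- (c * x\<^sup>2 / 2)) * exp (t * \<bar>x\<bar>) \<le> (2 * C * exp (s\<^sup>2 / (2 * c))) / (1 + x\<^sup>2)"
    for x
  proof -
    have e2: "1 + x\<^sup>2 \<le> 2 * exp \<bar>x\<bar>"
      using exp_lower_Taylor_quadratic[of "\<bar>x\<bar>"] by (simp add: field_simps)
    \<comment> \<open>Completing the square: the linear exponent is traded for the Gaussian plus a
      constant.\<close>
    have "s * \<bar>x\<bar> \<le> s\<^sup>2 / (2 * c) + c * x\<^sup>2 / 2"
    proof -
      have "0 \<le> (s - c * \<bar>x\<bar>)\<^sup>2" by simp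
      then have "2 * c * (s * \<bar>x\<bar>) \<le> s\<^sup>2 + c * c * x\<^sup>2"
        by (simp add: power2_diff power_mult_distrib) (simp add: power2_eq_square ac_simps)
      then have "(2 * c * (s * \<bar>x\<bar>)) / (2 * c) \<le> (s\<^sup>2 + c * c * x\<^sup>2) / (2 * c)"
        using assms by (intro divide_right_mono) auto
      then show ?thesis using assms by (simp add: add_divide_distrib)
    qed
    then have e: "exp (s * \<bar>x\<bar>) * exp (- (c * x\<^sup>2 / 2)) \<le> exp (s\<^sup>2 / (2 * c))"
      by (simp flip: exp_add)
    have "\<bar>poly p x\<bar> * exp (- (c * x\<^sup>2 / 2)) * exp (t * \<bar>x\<bar>) * (1 + x\<^sup>2)
        \<le> (C * exp (j * \<bar>x\<bar>)) * exp (- (c * x\<^sup>2 / 2)) * exp (t * \<bar>x\<bar>) * (2 * exp \<bar>x\<bar>)"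
      by (intro mult_mono e2 Cj mult_nonneg_nonneg) (use Cj in auto)
    also have "\<dots> = 2 * C * (exp (s * \<bar>x\<bar>) * exp (- (c * x\<^sup>2 / 2)))"
      by (simp add: s_def distrib_right exp_add)
    also have "\<dots> \<le> 2 * C * exp (s\<^sup>2 / (2 * c))"
      using e Cj by (intro mult_left_mono) auto
    finally show ?thesis
      using one_plus_square_pos[of x] by (simp add: le_divide_eq)
  qed
  then show ?thesis using that[of "2 * C * exp (s\<^sup>2 / (2 * c))"] Cj(1) by auto
qed

text \<open>One polynomial per coordinate gives a class that contains the Hermite functions and
  their iterated partial derivatives, and also the bare Gaussians used as majorants.\<close>

definition gauss_poly :: "('n::finite \<Rightarrow> real) \<Rightarrow> ('n \<Rightarrow> real poly) \<Rightarrow> real^'n \<Rightarrow> real" where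
  "gauss_poly c P x = (\<Prod>k\<in>UNIV. poly (P k) (x $ k) * exp (- (c k * (x $ k)\<^sup>2 / 2)))"

text \<open>The exponential factor serves twice: it dominates all powers of the norm for membership
  in \<open>schwartz\<close>, and it gives the exponential integrability behind the moment
  argument.\<close>

lemma gauss_poly_bound:
  fixes c :: "'n::finite \<Rightarrow> real"
  assumes "\<And>k. 0 < c k"
  shows "\<exists>C\<ge>0. \<forall>x. \<bar>gauss_poly c P x\<bar> * exp (t * (\<Sum>k\<in>UNIV. \<bar>x $ k\<bar>)) \<le> C * cauchy_weight x"
proof -
  have "\<exists>C. 0 \<le> C \<and> (\<forall>y. \<bar>poly (P k) y\<bar> * exp (- (c k * y\<^sup>2 / 2)) * exp (t * \<bar>y\<bar>) \<le> C / (1 + y\<^sup>2))" for k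
    using poly_exp_gauss_bound[OF assms[of k], of "P k" t] by metis
  then obtain C where C: "\<And>k. 0 \<le> C k"
    "\<And>k y. \<bar>poly (P k) y\<bar> * exp (- (c k * y\<^sup>2 / 2)) * exp (t * \<bar>y\<bar>) \<le> C k / (1 + y\<^sup>2)"
    by metis
  have "\<bar>gauss_poly c P x\<bar> * exp (t * (\<Sum>k\<in>UNIV. \<bar>x $ k\<bar>)) \<le> (\<Prod>k\<in>UNIV. C k) * cauchy_weight x" for x
  proof -
    have "\<bar>gauss_poly c P x\<bar> * exp (t * (\<Sum>k\<in>UNIV. \<bar>x $ k\<bar>))
        = (\<Prod>k\<in>UNIV. \<bar>poly (P k) (x $ k)\<bar> * exp (- (c k * (x $ k)\<^sup>2 / 2)) * exp (t * \<bar>x $ k\<bar>))"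
      by (simp add: gauss_poly_def abs_prod abs_mult exp_sum sum_distrib_left prod.distrib)
    also have "\<dots> \<le> (\<Prod>k\<in>UNIV. C k / (1 + (x $ k)\<^sup>2))"
      by (intro prod_mono) (auto intro: C)
    also have "\<dots> = (\<Prod>k\<in>UNIV. C k) * cauchy_weight x"
      by (simp add: cauchy_weight_def prod_dividef)
    finally show ?thesis .
  qed
  moreover have "0 \<le> (\<Prod>k\<in>UNIV. C k)"
    by (intro prod_nonneg) (use C in auto)
  ultimately show ?thesis by blast
qed

text \<open>The polynomial factor of the derivative of
  \<open>p(y) * exp (- c * y\<^sup>2 / 2)\<close>.\<close>

definition gauss_deriv :: "real \<Rightarrow> real poly \<Rightarrow> real poly" where
  "gauss_deriv c p = pderiv p - [:0, c:] * p"

lemma gauss_poly_remove: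
  "gauss_poly c P x = poly (P k) (x $ k) * exp (- (c k * (x $ k)\<^sup>2 / 2)) *
     (\<Prod>l\<in>UNIV - {k}. poly (P l) (x $ l) * exp (- (c l * (x $ l)\<^sup>2 / 2)))"
  unfolding gauss_poly_def by (rule prod.remove) auto

text \<open>Along the k-th axis all other factors are constant, so only the k-th polynomial changes
  and iterated derivatives never leave the class.\<close>

lemma partial_deriv_gauss_poly:
  fixes c :: "'n::finite \<Rightarrow> real"
  shows
  "partial_deriv k (\<lambda>x. complex_of_real (gauss_poly c P x)) =
     (\<lambda>x. complex_of_real (gauss_poly c (P(k := gauss_deriv (c k) (P k))) x))"
proof
  fix x :: "real^'n"
  define R where "R = (\<Prod>l\<in>UNIV - {k}. poly (P l) (x $ l) * exp (- (c l * (x $ l)\<^sup>2 / 2)))"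
  define h where "h y = poly (P k) y * exp (- (c k * y\<^sup>2 / 2))" for y
  have g: "gauss_poly c P (x + t *\<^sub>R axis k 1) = h (x $ k + t) * R" for t
  proof -
    have "(\<Prod>l\<in>UNIV - {k}. poly (P l) ((x + t *\<^sub>R axis k 1) $ l) * exp (- (c l * ((x + t *\<^sub>R axis k 1) $ l)\<^sup>2 / 2))) = R"
      unfolding R_def by (intro prod.cong) (auto simp: axis_def)
    then show ?thesis
      by (simp add: gauss_poly_remove[of c P _ k] h_def)
  qed
  have g': "gauss_poly c (P(k := gauss_deriv (c k) (P k))) x
      = (poly (gauss_deriv (c k) (P k)) (x $ k) * exp (- (c k * (x $ k)\<^sup>2 / 2))) * R"
    unfolding gauss_poly_remove[of c _ x k] R_def by (auto intro!: prod.cong)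
  have "((\<lambda>t. h (x $ k + t) * R) has_real_derivative
      (poly (gauss_deriv (c k) (P k)) (x $ k) * exp (- (c k * (x $ k)\<^sup>2 / 2))) * R) (at 0)"
    unfolding h_def gauss_deriv_def
    by (auto intro!: derivative_eq_intros DERIV_chain2[OF poly_DERIV] simp: algebra_simps)
  then have "((\<lambda>t. gauss_poly c P (x + t *\<^sub>R axis k 1)) has_vector_derivative
      gauss_poly c (P(k := gauss_deriv (c k) (P k))) x) (at 0)"
    by (simp only: g g' has_real_derivative_iff_has_vector_derivative)
  then have "((\<lambda>t. complex_of_real (gauss_poly c P (x + t *\<^sub>R axis k 1))) has_vector_derivative
      complex_of_real (gauss_poly c (P(k := gauss_deriv (c k) (P k))) x)) (at 0)"
    by (intro has_vector_derivative_of_real)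
      (simp only: has_real_derivative_iff_has_vector_derivative)
  then show "partial_deriv k (\<lambda>x. complex_of_real (gauss_poly c P x)) x
      = complex_of_real (gauss_poly c (P(k := gauss_deriv (c k) (P k))) x)"
    unfolding partial_deriv_def by (rule vector_derivative_at)
qed

text \<open>Membership in \<open>schwartz\<close> asks for total differentiability, which existence
  of partial derivatives alone does not give.\<close>

lemma differentiable_gauss_poly:
  fixes c :: "'n::finite \<Rightarrow> real"
  shows "(\<lambda>x. complex_of_real (gauss_poly c P x)) differentiable (at x)"
proof -
  have "(\<lambda>x. complex_of_real (poly (P k) (x $ k) * exp (- (c k * (x $ k)\<^sup>2 / 2)))) differentiable (at x)"
    for k and x :: "real^'n"
  proof -
    have "((\<lambda>y. poly (P k) y * exp (- (c k * y\<^sup>2 / 2))) has_real_derivative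
        poly (pderiv (P k)) (x $ k) * exp (- (c k * (x $ k)\<^sup>2 / 2)) +
        poly (P k) (x $ k) * (exp (- (c k * (x $ k)\<^sup>2 / 2)) * (- c k * (x $ k)))) (at (x $ k))"
      by (auto intro!: derivative_eq_intros poly_DERIV simp: algebra_simps)
    then have "((\<lambda>y. complex_of_real (poly (P k) y * exp (- (c k * y\<^sup>2 / 2)))) has_vector_derivative
        complex_of_real (poly (pderiv (P k)) (x $ k) * exp (- (c k * (x $ k)\<^sup>2 / 2)) +
        poly (P k) (x $ k) * (exp (- (c k * (x $ k)\<^sup>2 / 2)) * (- c k * (x $ k))))) (at (x $ k))"
      by (intro has_vector_derivative_of_real)
        (simp add: has_real_derivative_iff_has_vector_derivative)
    then have "(\<lambda>y. complex_of_real (poly (P k) y * exp (- (c k * y\<^sup>2 / 2)))) differentiable (at (x $ k))"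
      unfolding has_vector_derivative_def differentiable_def by blast
    moreover have "(\<lambda>x :: real^'n. x $ k) differentiable (at x)"
      by (rule bounded_linear_imp_differentiable) (rule bounded_linear_vec_nth)
    ultimately show ?thesis
      using differentiable_chain_at[of "\<lambda>x :: real^'n. x $ k" x
          "\<lambda>y. complex_of_real (poly (P k) y * exp (- (c k * y\<^sup>2 / 2)))"]
      by (simp add: o_def)
  qed
  then have "\<forall>k. \<exists>D. ((\<lambda>x. complex_of_real (poly (P k) (x $ k) * exp (- (c k * (x $ k)\<^sup>2 / 2)))) has_derivative D) (at x)"
    unfolding differentiable_def by blast
  from choice[OF this]
  obtain D where D: "\<And>k. ((\<lambda>x. complex_of_real (poly (P k) (x $ k) * exp (- (c k * (x $ k)\<^sup>2 / 2)))) has_derivative D k) (at x)"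
    by blast
  have "((\<lambda>x. \<Prod>k\<in>UNIV. complex_of_real (poly (P k) (x $ k) * exp (- (c k * (x $ k)\<^sup>2 / 2)))) has_derivative
      (\<lambda>y. \<Sum>i\<in>UNIV. D i y * (\<Prod>j\<in>UNIV - {i}. complex_of_real (poly (P j) (x $ j) * exp (- (c j * (x $ j)\<^sup>2 / 2)))))) (at x)"
    by (rule has_derivative_prod) (rule D)
  then show ?thesis
    unfolding differentiable_def gauss_poly_def of_real_prod by blast
qed

lemma foldr_partial_deriv_gauss_poly:
  fixes c :: "'n::finite \<Rightarrow> real"
  shows
  "\<exists>Q. foldr partial_deriv ks (\<lambda>x. complex_of_real (gauss_poly c P x)) =
     (\<lambda>x. complex_of_real (gauss_poly c Q x))"
  by (induction ks) (auto simp: partial_deriv_gauss_poly)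

lemma gauss_poly_schwartz:
  fixes c :: "'n::finite \<Rightarrow> real"
  assumes "\<And>k. 0 < c k"
  shows "(\<lambda>x. complex_of_real (gauss_poly c P x)) \<in> schwartz"
  unfolding schwartz_def
proof (intro CollectI allI conjI)
  fix ks and m :: nat
  obtain Q where Q: "foldr partial_deriv ks (\<lambda>x. complex_of_real (gauss_poly c P x)) =
     (\<lambda>x. complex_of_real (gauss_poly c Q x))"
    using foldr_partial_deriv_gauss_poly by blast
  show "foldr partial_deriv ks (\<lambda>x. complex_of_real (gauss_poly c P x)) differentiable_on UNIV"
    unfolding Q differentiable_on_def by (simp add: differentiable_gauss_poly)
  obtain C where C: "0 \<le> C"
    "\<And>x. \<bar>gauss_poly c Q x\<bar> * exp (real m * (\<Sum>k\<in>UNIV. \<bar>x $ k\<bar>)) \<le> C * cauchy_weight x"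
    using gauss_poly_bound[of c Q "real m"] assms by blast
  have "norm (norm x ^ m *\<^sub>R complex_of_real (gauss_poly c Q x)) \<le> C" for x
  proof -
    have "norm x \<le> exp (\<Sum>k\<in>UNIV. \<bar>x $ k\<bar>)"
      using norm_le_l1_cart[of x] exp_ge_add_one_self[of "\<Sum>k\<in>UNIV. \<bar>x $ k\<bar>"] by linarith
    then have "norm x ^ m \<le> exp (\<Sum>k\<in>UNIV. \<bar>x $ k\<bar>) ^ m"
      by (rule power_mono) simp
    also have "\<dots> = exp (real m * (\<Sum>k\<in>UNIV. \<bar>x $ k\<bar>))"
      by (rule exp_of_nat_mult[symmetric])
    finally have "\<bar>gauss_poly c Q x\<bar> * norm x ^ m \<le> \<bar>gauss_poly c Q x\<bar> * exp (real m * (\<Sum>k\<in>UNIV. \<bar>x $ k\<bar>))"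
      by (rule mult_left_mono) simp
    also have "\<dots> \<le> C * cauchy_weight x" by (rule C)
    also have "\<dots> \<le> C" using C(1) cauchy_weight_le_1[of x] by (simp add: mult_left_le)
    finally show ?thesis by (simp add: mult.commute)
  qed
  then show "bounded (range (\<lambda>x. norm x ^ m *\<^sub>R foldr partial_deriv ks (\<lambda>x. complex_of_real (gauss_poly c P x)) x))"
    unfolding Q bounded_iff by blast
qed

text \<open>The raising recursion. For \<open>c = 1\<close> these are the physicists' Hermite
  polynomials; for positive \<open>c\<close> they are \<open>c\<close> to the power n/2 times the
  n-th one at \<open>sqrt c * x\<close>.\<close>

primrec hermite :: "real \<Rightarrow> nat \<Rightarrow> real poly" where
  "hermite c 0 = 1"
| "hermite c (Suc n) = [:0, 2 * c:] * hermite c n - pderiv (hermite c n)"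

text \<open>The equation for \<open>n\<close> turns the recursion into the lowering relation that
  the derivative of \<open>hermite c (Suc n)\<close> is \<open>2 * c * (n + 1)\<close> times
  \<open>hermite c n\<close>. Inserted into the equation for \<open>Suc n\<close>, this reproduces
  the recursion.\<close>

lemma hermite_ode:
  "[:0, 2 * c:] * pderiv (hermite c n) - pderiv (pderiv (hermite c n)) = smult (2 * c * real n) (hermite c n)"
proof (induction n)
  case (Suc n)
  define X where "X = [:0, 2 * c:]"
  define H where "H = hermite c n"
  have X': "pderiv X = [:2 * c:]" by (simp add: X_def pderiv_pCons)
  have IH: "pderiv (pderiv H) = X * pderiv H - smult (2 * c * real n) H"
    using Suc by (simp add: H_def X_def algebra_simps)
  have S: "hermite c (Suc n) = X * H - pderiv H"
    by (simp only: hermite.simps X_def H_def)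
  have "pderiv (hermite c (Suc n)) = smult (2 * c) H + smult (2 * c * real n) H"
    unfolding S by (simp add: pderiv_diff pderiv_mult X' IH)
  also have "\<dots> = smult (2 * c * real (Suc n)) H"
    by (simp add: smult_add_left[symmetric] algebra_simps)
  finally have 1: "pderiv (hermite c (Suc n)) = smult (2 * c * real (Suc n)) H" .
  show ?case
    unfolding 1 pderiv_smult unfolding S X_def[symmetric]
    by (simp add: smult_diff_right)
qed simp

text \<open>The eigenvalue equation of the one-dimensional oscillator with the Gaussian divided
  out.\<close>

lemma gauss_deriv_hermite:
  "gauss_deriv c (gauss_deriv c (hermite c n)) =
     [:0, 0, c\<^sup>2:] * hermite c n - smult (c * (2 * real n + 1)) (hermite c n)"
proof -
  define H where "H = hermite c n"
  define X where "X = [:0, c:]"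
  have X': "pderiv X = [:c:]" by (simp add: X_def pderiv_pCons)
  have XX: "X * X = [:0, 0, c\<^sup>2:]" by (simp add: X_def power2_eq_square)
  have "[:0, 2 * c:] = X + X" by (simp add: X_def)
  then have e: "pderiv (pderiv H) = (X + X) * pderiv H - smult (2 * c * real n) H"
    using hermite_ode[of c n] by (simp add: H_def algebra_simps)
  have "gauss_deriv c (gauss_deriv c H) = X * X * H - (smult (2 * c * real n) H + smult c H)"
    by (simp add: gauss_deriv_def X_def[symmetric] pderiv_diff pderiv_mult X' e algebra_simps)
  then show ?thesis
    by (simp add: XX H_def smult_add_left[symmetric] algebra_simps)
qed

lemma hermite_pcompose_uminus: "pcompose (hermite c n) [:0, -1:] = smult ((-1) ^ n) (hermite c n)"
proof (induction n)
  case (Suc n)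
  have "pderiv (pcompose (hermite c n) [:0, -1:]) = - pcompose (pderiv (hermite c n)) [:0, -1:]"
    by (simp add: pderiv_pcompose pderiv_pCons)
  then have "pcompose (pderiv (hermite c n)) [:0, -1:] = - smult ((-1) ^ n) (pderiv (hermite c n))"
    by (simp add: Suc pderiv_smult)
  then show ?case
    by (simp add: pcompose_diff pcompose_mult pcompose_smult Suc pcompose_pCons smult_diff_right algebra_simps)
qed (simp add: pcompose_1)

lemma poly_hermite_uminus: "poly (hermite c n) (- x) = (-1) ^ n * poly (hermite c n) x"
  using arg_cong[OF hermite_pcompose_uminus, of "\<lambda>p. poly p x" c n] by (simp add: poly_pcompose)

lemma degree_hermite_le: "degree (hermite c n) \<le> n"
proof (induction n)
  case (Suc n)
  have "degree ([:0, 2 * c:] * hermite c n) \<le> 1 + n"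
    using degree_mult_le[of "[:0, 2 * c:]" "hermite c n"] Suc by (simp split: if_splits)
  moreover have "degree (pderiv (hermite c n)) \<le> Suc n"
    using Suc by (simp add: degree_pderiv)
  ultimately show ?case by (simp add: degree_diff_le)
qed simp

text \<open>For nonzero \<open>c\<close> the degree is exactly \<open>n\<close>. This gives both
  nonvanishing of the Hermite functions and the reduction of arbitrary polynomials to Hermite
  polynomials.\<close>

lemma coeff_hermite: "coeff (hermite c n) n = (2 * c) ^ n"
proof (induction n)
  case (Suc n)
  have "coeff (pderiv (hermite c n)) (Suc n) = 0"
    using degree_hermite_le[of c n] by (intro coeff_eq_0) (simp add: degree_pderiv)
  then show ?case using Suc by (simp add: mult_pCons_left)
qed simp

section \<open>Integration by parts for Schwartz functions\<close>

text \<open>\<open>partial_deriv\<close> only looks at parameter 0 of a line; total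
  differentiability identifies it with the derivative at any other parameter.\<close>

lemma has_vector_derivative_line:
  fixes f :: "real^'n \<Rightarrow> complex"
  assumes "f differentiable (at (x + t *\<^sub>R axis k 1))"
  shows "((\<lambda>s. f (x + s *\<^sub>R axis k 1)) has_vector_derivative partial_deriv k f (x + t *\<^sub>R axis k 1)) (at t)"
proof -
  obtain D where D: "(f has_derivative D) (at (x + t *\<^sub>R axis k 1))"
    using assms by (auto simp: differentiable_def)
  then have lin: "D (h *\<^sub>R axis k 1) = h *\<^sub>R D (axis k 1)" for h
    by (intro linear_scale has_derivative_linear)
  \<comment> \<open>The base point stays free: the fact is applied at the moved point with parameter
    0 and at \<open>x\<close> with parameter \<open>t\<close>.\<close>
  have *: "((\<lambda>s. f (y + s *\<^sub>R axis k 1)) has_vector_derivative D (axis k 1)) (at r)"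
    if "y + r *\<^sub>R axis k 1 = x + t *\<^sub>R axis k 1" for y r
  proof -
    have "((\<lambda>s. y + s *\<^sub>R axis k 1) has_derivative (\<lambda>h. h *\<^sub>R axis k (1::real))) (at r)"
      by (auto intro!: derivative_eq_intros)
    then have "((\<lambda>s. f (y + s *\<^sub>R axis k 1)) has_derivative (\<lambda>h. D (h *\<^sub>R axis k 1))) (at r)"
      by (rule has_derivative_compose) (use D that in simp)
    then show ?thesis by (simp add: has_vector_derivative_def lin)
  qed
  have "partial_deriv k f (x + t *\<^sub>R axis k 1) = D (axis k 1)"
    unfolding partial_deriv_def by (rule vector_derivative_at) (rule *, simp)
  then show ?thesis using *[of x t] by simp
qed

section \<open>Partial derivatives and decay of Schwartz functions\<close>

lemma partial_deriv_eqI: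
  "((\<lambda>t. f (x + t *\<^sub>R axis k 1)) has_vector_derivative d) (at 0) \<Longrightarrow> partial_deriv k f x = d"
  unfolding partial_deriv_def by (rule vector_derivative_at)

lemma has_vector_derivative_partial_deriv:
  fixes f :: "real^'n \<Rightarrow> complex"
  assumes "f differentiable (at x)"
  shows "((\<lambda>t. f (x + t *\<^sub>R axis k 1)) has_vector_derivative partial_deriv k f x) (at 0)"
  using has_vector_derivative_line[of f x 0 k] assms by simp

lemma partial_deriv_lincomb:
  fixes f g :: "real^'n \<Rightarrow> complex"
  assumes "f differentiable (at x)" "g differentiable (at x)"
  shows "partial_deriv k (\<lambda>x. a * f x + b * g x) x = a * partial_deriv k f x + b * partial_deriv k g x"
  by (rule partial_deriv_eqI)
    (intro has_vector_derivative_add has_vector_derivative_mult_right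
      has_vector_derivative_partial_deriv assms)

lemma partial_deriv_mult:
  fixes f g :: "real^'n \<Rightarrow> complex"
  assumes "f differentiable (at x)" "g differentiable (at x)"
  shows "partial_deriv k (\<lambda>x. f x * g x) x = f x * partial_deriv k g x + partial_deriv k f x * g x"
  by (rule partial_deriv_eqI)
    (use has_vector_derivative_mult[OF has_vector_derivative_partial_deriv[OF assms(1), of k]
      has_vector_derivative_partial_deriv[OF assms(2), of k]] in simp)

lemma schwartz_differentiable: "f \<in> schwartz \<Longrightarrow> f differentiable (at x)"
  unfolding schwartz_def differentiable_on_def
  by (metis (mono_tags, lifting) UNIV_I foldr_Nil id_apply mem_Collect_eq)

lemma schwartz_partial_deriv: "f \<in> schwartz \<Longrightarrow> partial_deriv k f \<in> schwartz"
  unfolding schwartz_def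
proof (intro CollectI allI, elim CollectE)
  fix ks
  assume *: "\<forall>ks. foldr partial_deriv ks f differentiable_on UNIV \<and>
    (\<forall>m::nat. bounded (range (\<lambda>x. norm x ^ m *\<^sub>R foldr partial_deriv ks f x)))"
  have "foldr partial_deriv ks (partial_deriv k f) = foldr partial_deriv (ks @ [k]) f"
    by simp
  with * show "foldr partial_deriv ks (partial_deriv k f) differentiable_on UNIV \<and>
    (\<forall>m::nat. bounded (range (\<lambda>x. norm x ^ m *\<^sub>R foldr partial_deriv ks (partial_deriv k f) x)))"
    by metis
qed

lemma schwartz_foldr: "f \<in> schwartz \<Longrightarrow> foldr partial_deriv ks f \<in> schwartz"
  by (induction ks) (auto intro: schwartz_partial_deriv)

lemma schwartz_bounded:
  fixes f :: "real^'n \<Rightarrow> complex"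
  assumes "f \<in> schwartz"
  shows "\<exists>B. \<forall>x. norm (norm x ^ m *\<^sub>R f x) \<le> B"
proof -
  have "bounded (range (\<lambda>x. norm x ^ m *\<^sub>R foldr partial_deriv [] f x))"
    using assms unfolding schwartz_def by blast
  then show ?thesis unfolding bounded_iff by auto
qed

lemma schwartz_lincomb:
  fixes f g :: "real^'n \<Rightarrow> complex"
  assumes f: "f \<in> schwartz" and g: "g \<in> schwartz"
  shows "(\<lambda>x. a * f x + b * g x) \<in> schwartz"
proof -
  have eq: "foldr partial_deriv ks (\<lambda>x. a * f x + b * g x) =
      (\<lambda>x. a * foldr partial_deriv ks f x + b * foldr partial_deriv ks g x)" for ks
  proof (induction ks)
    case (Cons k ks)
    have "partial_deriv k (\<lambda>x. a * foldr partial_deriv ks f x + b * foldr partial_deriv ks g x) x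
        = a * partial_deriv k (foldr partial_deriv ks f) x + b * partial_deriv k (foldr partial_deriv ks g) x" for x
      by (intro partial_deriv_lincomb schwartz_differentiable schwartz_foldr f g)
    with Cons show ?case by auto
  qed simp
  show ?thesis
    unfolding schwartz_def
  proof (intro CollectI allI conjI)
    fix ks and m :: nat
    show "foldr partial_deriv ks (\<lambda>x. a * f x + b * g x) differentiable_on UNIV"
      unfolding eq differentiable_on_def
      using schwartz_differentiable[OF schwartz_foldr[OF f]] schwartz_differentiable[OF schwartz_foldr[OF g]]
      by (simp add: differentiable_add differentiable_mult)
    obtain A B where AB: "\<And>x. norm (norm x ^ m *\<^sub>R foldr partial_deriv ks f x) \<le> A"
      "\<And>x. norm (norm x ^ m *\<^sub>R foldr partial_deriv ks g x) \<le> B"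
      using schwartz_bounded[OF schwartz_foldr[OF f], of m ks] schwartz_bounded[OF schwartz_foldr[OF g], of m ks]
      by blast
    have "norm (norm x ^ m *\<^sub>R (a * foldr partial_deriv ks f x + b * foldr partial_deriv ks g x))
        \<le> cmod a * A + cmod b * B" for x
    proof -
      have "norm x ^ m *\<^sub>R (a * foldr partial_deriv ks f x + b * foldr partial_deriv ks g x)
          = a * (norm x ^ m *\<^sub>R foldr partial_deriv ks f x) + b * (norm x ^ m *\<^sub>R foldr partial_deriv ks g x)"
        by (simp add: scaleR_add_right)
      also have "norm \<dots> \<le> norm (a * (norm x ^ m *\<^sub>R foldr partial_deriv ks f x))
          + norm (b * (norm x ^ m *\<^sub>R foldr partial_deriv ks g x))"
        by (rule norm_triangle_ineq)
      also have "\<dots> \<le> cmod a * A + cmod b * B"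
        unfolding norm_mult[of a] norm_mult[of b] by (intro add_mono mult_left_mono AB) auto
      finally show ?thesis .
    qed
    then show "bounded (range (\<lambda>x. norm x ^ m *\<^sub>R foldr partial_deriv ks (\<lambda>x. a * f x + b * g x) x))"
      unfolding eq bounded_iff by blast
  qed
qed

text \<open>Each factor \<open>1 + (x $ k)\<^sup>2\<close> is at most
  \<open>1 + (norm x)\<^sup>2\<close>. Hence \<open>CARD('n)\<close> extra powers of decay buy one
  factor \<open>cauchy_weight\<close>.\<close>

lemma inverse_cauchy_weight_le: "1 \<le> cauchy_weight x * (1 + (norm x)\<^sup>2) ^ CARD('n)"
  for x :: "real^'n"
proof -
  have "(\<Prod>k\<in>UNIV. 1 + (x $ k)\<^sup>2) \<le> (\<Prod>k\<in>(UNIV :: 'n set). 1 + (norm x)\<^sup>2)"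
    using component_le_norm_cart[of x] by (intro prod_mono) (auto intro: abs_le_square_iff[THEN iffD1])
  moreover have "0 < (\<Prod>k\<in>UNIV. 1 + (x $ k)\<^sup>2)"
    by (intro prod_pos) (simp add: one_plus_square_pos)
  ultimately show ?thesis
    by (simp add: cauchy_weight_def prod_dividef le_divide_eq)
qed

lemma schwartz_decay:
  fixes f :: "real^'n \<Rightarrow> complex"
  assumes "f \<in> schwartz"
  shows "\<exists>C\<ge>0. \<forall>x. cmod (f x) * (1 + (norm x)\<^sup>2) ^ m \<le> C"
proof -
  obtain A B where AB: "\<And>x. norm (norm x ^ (2 * m) *\<^sub>R f x) \<le> A" "\<And>x. norm (norm x ^ 0 *\<^sub>R f x) \<le> B"
    using schwartz_bounded[OF assms, of "2 * m"] schwartz_bounded[OF assms, of 0] by blast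
  have "cmod (f x) * (1 + (norm x)\<^sup>2) ^ m \<le> 2 ^ m * (A + B)" for x
  proof -
    have "(1 + (norm x)\<^sup>2) ^ m \<le> (2 * max 1 ((norm x)\<^sup>2)) ^ m"
      by (intro power_mono) auto
    also have "\<dots> = 2 ^ m * max 1 ((norm x)\<^sup>2) ^ m" by (simp add: power_mult_distrib)
    also have "max 1 ((norm x)\<^sup>2) ^ m \<le> 1 + norm x ^ (2 * m)"
      by (simp add: max_def power_mult)
    finally have "(1 + (norm x)\<^sup>2) ^ m \<le> 2 ^ m * (1 + norm x ^ (2 * m))" by simp
    then have "cmod (f x) * (1 + (norm x)\<^sup>2) ^ m \<le> cmod (f x) * (2 ^ m * (1 + norm x ^ (2 * m)))"
      by (rule mult_left_mono) simp
    also have "\<dots> = 2 ^ m * (norm (norm x ^ (2 * m) *\<^sub>R f x) + norm (norm x ^ 0 *\<^sub>R f x))"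
      by (simp add: algebra_simps)
    also have "\<dots> \<le> 2 ^ m * (A + B)"
      by (intro mult_left_mono add_mono AB) auto
    finally show ?thesis .
  qed
  moreover from this[of 0] have "0 \<le> 2 ^ m * (A + B)"
    using order_trans[OF norm_ge_zero[of "f 0"]] by simp
  ultimately show ?thesis by blast
qed

lemma schwartz_weight_decay:
  fixes f :: "real^'n \<Rightarrow> complex"
  assumes "f \<in> schwartz"
  shows "\<exists>C\<ge>0. \<forall>x. cmod (f x) * (1 + (norm x)\<^sup>2) ^ m \<le> C * cauchy_weight x"
proof -
  obtain C where C: "0 \<le> C" "\<And>x. cmod (f x) * (1 + (norm x)\<^sup>2) ^ (m + CARD('n)) \<le> C"
    using schwartz_decay[OF assms, of "m + CARD('n)"] by blast
  have "cmod (f x) * (1 + (norm x)\<^sup>2) ^ m \<le> C * cauchy_weight x" for x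
  proof -
    have "cmod (f x) * (1 + (norm x)\<^sup>2) ^ m * 1
        \<le> cmod (f x) * (1 + (norm x)\<^sup>2) ^ m * (cauchy_weight x * (1 + (norm x)\<^sup>2) ^ CARD('n))"
      by (intro mult_left_mono inverse_cauchy_weight_le) auto
    also have "\<dots> = cmod (f x) * (1 + (norm x)\<^sup>2) ^ (m + CARD('n)) * cauchy_weight x"
      by (simp add: power_add)
    also have "\<dots> \<le> C * cauchy_weight x"
      by (intro mult_right_mono C less_imp_le cauchy_weight_pos)
    finally show ?thesis by simp
  qed
  with C(1) show ?thesis by blast
qed

lemma schwartz_continuous: "f \<in> schwartz \<Longrightarrow> continuous_on UNIV f"
  by (simp add: continuous_at_imp_continuous_on differentiable_imp_continuous_within schwartz_differentiable)

lemma schwartz_measurable: "f \<in> schwartz \<Longrightarrow> f \<in> borel_measurable borel"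
  by (intro borel_measurable_continuous_onI schwartz_continuous)

lemma schwartz_square_integrable: "f \<in> schwartz \<Longrightarrow> f \<in> square_integrable"
  using schwartz_weight_decay[of f 0]
  by (auto intro: square_integrable_weight_bound schwartz_measurable)

lemma square_integrable_coord_square:
  fixes f :: "real^'n \<Rightarrow> complex"
  assumes f: "f \<in> schwartz"
  shows "(\<lambda>x. complex_of_real (c * (x $ k)\<^sup>2) * f x) \<in> square_integrable"
proof -
  obtain C where C: "\<And>x. cmod (f x) * (1 + (norm x)\<^sup>2) ^ 1 \<le> C * cauchy_weight x"
    using schwartz_weight_decay[OF f, of 1] by blast
  have "(\<lambda>x. complex_of_real ((x $ k)\<^sup>2) * f x) \<in> square_integrable"
  proof (rule square_integrable_weight_bound)
    show "(\<lambda>x. complex_of_real ((x $ k)\<^sup>2) * f x) \<in> borel_measurable borel"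
      using f by (intro borel_measurable_continuous_onI continuous_intros schwartz_continuous)
    fix x :: "real^'n"
    have "(x $ k)\<^sup>2 \<le> 1 + (norm x)\<^sup>2"
      using component_le_norm_cart[of x k] abs_le_square_iff[of "x $ k" "norm x"] by simp
    then have "cmod (f x) * (x $ k)\<^sup>2 \<le> cmod (f x) * (1 + (norm x)\<^sup>2) ^ 1"
      by (intro mult_left_mono) auto
    also have "\<dots> \<le> C * cauchy_weight x" by (rule C)
    finally show "cmod (complex_of_real ((x $ k)\<^sup>2) * f x) \<le> C * cauchy_weight x"
      by (simp add: norm_mult mult.commute del: of_real_power)
  qed
  from square_integrable_cmult[OF this, of "complex_of_real c"] show ?thesis
    by (simp add: mult.assoc)
qed

lemma square_integrable_mult:
  assumes "f \<in> square_integrable" "g \<in> square_integrable"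
  shows "integrable lborel (\<lambda>x. f x * g x)"
  using square_integrable_cnj_mult[OF square_integrable_cnj[OF assms(1)] assms(2)] by simp

lemma square_integrable_sum:
  "(\<And>i. i \<in> A \<Longrightarrow> f i \<in> square_integrable) \<Longrightarrow> (\<lambda>x. \<Sum>i\<in>A. f i x) \<in> square_integrable"
  by (induction A rule: infinite_finite_induct)
    (auto intro: square_integrable_zero square_integrable_add)

text \<open>Translation invariance makes the integrals of the difference quotients vanish.\<close>

lemma integral_partial_deriv_eq_0:
  fixes F :: "real^'n \<Rightarrow> complex"
  assumes d: "\<And>x. F differentiable (at x)"
    and F: "integrable lborel F"
    and m: "partial_deriv k F \<in> borel_measurable borel"
    and C: "\<And>x. cmod (partial_deriv k F x) * (1 + (norm x)\<^sup>2) ^ CARD('n) \<le> C"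
  shows "(LINT x|lborel. partial_deriv k F x) = 0"
proof -
  define e :: "real^'n" where "e = axis k 1"
  define t :: "nat \<Rightarrow> real" where "t n = inverse (real (Suc n))" for n
  have t: "0 < t n" "t n \<le> 1" for n
    by (simp_all add: t_def inverse_le_1_iff)
  define u where "u n x = (F (x + t n *\<^sub>R e) - F x) /\<^sub>R t n" for n x
  have Fm: "F \<in> borel_measurable borel"
    using F by (auto dest: borel_measurable_integrable)
  \<comment> \<open>A shift by at most 1 changes \<open>1 + (norm x)\<^sup>2\<close> by a factor of
    at most 3, so one majorant serves all difference quotients.\<close>
  have shift: "cmod (partial_deriv k F (x + s *\<^sub>R e)) \<le> C * 3 ^ CARD('n) * cauchy_weight x"
    if s: "0 \<le> s" "s \<le> 1" for x s
  proof -
    define y where "y = x + s *\<^sub>R e"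
    have e1: "norm e = 1" by (simp add: e_def)
    have "norm x \<le> norm y + s"
      using norm_triangle_ineq4[of y "s *\<^sub>R e"] s by (simp add: y_def e1)
    then have "norm x \<le> norm y + 1" using s by simp
    then have "(norm x)\<^sup>2 \<le> (norm y + 1)\<^sup>2" by (rule power_mono) simp
    also have "(norm y + 1)\<^sup>2 \<le> 2 * (norm y)\<^sup>2 + 2"
      using sum_squares_bound[of "norm y" 1] by (simp add: power2_sum)
    finally have "1 + (norm x)\<^sup>2 \<le> 3 + 2 * (norm y)\<^sup>2" by simp
    also have "\<dots> \<le> 3 * (1 + (norm y)\<^sup>2)" by simp
    finally have le: "1 + (norm x)\<^sup>2 \<le> 3 * (1 + (norm y)\<^sup>2)" .
    have "cmod (partial_deriv k F y) * 1
        \<le> cmod (partial_deriv k F y) * (cauchy_weight x * (1 + (norm x)\<^sup>2) ^ CARD('n))"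
      by (intro mult_left_mono inverse_cauchy_weight_le) auto
    also have "\<dots> \<le> cmod (partial_deriv k F y) * (cauchy_weight x * (3 * (1 + (norm y)\<^sup>2)) ^ CARD('n))"
      by (intro mult_left_mono power_mono[OF le] less_imp_le[OF cauchy_weight_pos] norm_ge_zero) simp
    also have "\<dots> = (cmod (partial_deriv k F y) * (1 + (norm y)\<^sup>2) ^ CARD('n)) * 3 ^ CARD('n) * cauchy_weight x"
      unfolding power_mult_distrib by simp
    also have "\<dots> \<le> C * 3 ^ CARD('n) * cauchy_weight x"
      by (intro mult_right_mono C less_imp_le cauchy_weight_pos) auto
    finally show ?thesis by (simp add: y_def)
  qed
  \<comment> \<open>The mean value inequality replaces the difference quotient by the derivative at
    an intermediate point, to which \<open>shift\<close> applies.\<close>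
  have bound: "norm (u n x) \<le> C * 3 ^ CARD('n) * cauchy_weight x" for n x
  proof -
    have der: "((\<lambda>s. F (x + s *\<^sub>R e)) has_derivative (\<lambda>h. h *\<^sub>R partial_deriv k F (x + s *\<^sub>R e))) (at s)" for s
      using has_vector_derivative_line[OF d, where k = k and x = x and t = s]
      by (simp add: has_vector_derivative_def e_def)
    have "\<exists>s\<in>{0<..<t n}. norm (F (x + t n *\<^sub>R e) - F (x + 0 *\<^sub>R e))
        \<le> norm ((t n - 0) *\<^sub>R partial_deriv k F (x + s *\<^sub>R e))"
    proof (rule mvt_general[where f' = "\<lambda>s h. h *\<^sub>R partial_deriv k F (x + s *\<^sub>R e)"])
      show "continuous_on {0..t n} (\<lambda>s. F (x + s *\<^sub>R e))"
        by (intro continuous_at_imp_continuous_on ballI has_derivative_continuous[OF der])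
    qed (use t der in auto)
    then obtain s where s: "0 < s" "s < t n"
      "norm (F (x + t n *\<^sub>R e) - F x) \<le> t n * norm (partial_deriv k F (x + s *\<^sub>R e))"
      using t[of n] by auto
    have "norm (u n x) = norm (F (x + t n *\<^sub>R e) - F x) / t n"
      using t[of n] by (simp add: u_def divide_inverse mult.commute)
    also have "\<dots> \<le> norm (partial_deriv k F (x + s *\<^sub>R e))"
      using s(3) t[of n] by (simp add: divide_le_eq mult.commute)
    also have "\<dots> \<le> C * 3 ^ CARD('n) * cauchy_weight x"
      using s t[of n] by (intro shift) auto
    finally show ?thesis .
  qed
  have lim: "(\<lambda>n. u n x) \<longlonglongrightarrow> partial_deriv k F x" for x
  proof -
    have "((\<lambda>s. (F (x + s *\<^sub>R e) - F x) /\<^sub>R s) \<longlongrightarrow> partial_deriv k F x) (at 0)"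
      using has_vector_derivative_partial_deriv[OF d, where k = k and x = x]
      unfolding has_vector_derivative_def has_derivative_iff_norm e_def[symmetric]
    proof (elim conjE)
      assume "((\<lambda>y. norm (F (x + y *\<^sub>R e) - F (x + 0 *\<^sub>R e) - (y - 0) *\<^sub>R partial_deriv k F x) / norm (y - 0))
        \<longlongrightarrow> 0) (at 0)"
      then have "((\<lambda>s. norm ((F (x + s *\<^sub>R e) - F x) /\<^sub>R s - partial_deriv k F x)) \<longlongrightarrow> 0) (at 0)"
      proof (rule Lim_transform_eventually)
        show "\<forall>\<^sub>F y in at 0. norm (F (x + y *\<^sub>R e) - F (x + 0 *\<^sub>R e) - (y - 0) *\<^sub>R partial_deriv k F x) / norm (y - 0)
            = norm ((F (x + y *\<^sub>R e) - F x) /\<^sub>R y - partial_deriv k F x)"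
          unfolding eventually_at_topological
        proof (intro exI[of _ UNIV] conjI ballI impI)
          fix y :: real assume "y \<noteq> 0"
          then have "(F (x + y *\<^sub>R e) - F x) /\<^sub>R y - partial_deriv k F x
              = (F (x + y *\<^sub>R e) - F x - y *\<^sub>R partial_deriv k F x) /\<^sub>R y"
            by (simp add: scaleR_diff_right)
          then show "norm (F (x + y *\<^sub>R e) - F (x + 0 *\<^sub>R e) - (y - 0) *\<^sub>R partial_deriv k F x) / norm (y - 0)
            = norm ((F (x + y *\<^sub>R e) - F x) /\<^sub>R y - partial_deriv k F x)"
            by (simp add: divide_inverse mult.commute)
        qed auto
      qed
      then show ?thesis
        by (subst Lim_null) (rule tendsto_norm_zero_cancel)
    qed
    moreover have "filterlim t (at 0) sequentially"
      unfolding filterlim_at using t LIMSEQ_inverse_real_of_nat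
      by (auto simp: t_def[abs_def] intro!: always_eventually)
    ultimately show ?thesis
      unfolding u_def by (rule filterlim_compose)
  qed
  have Ft: "integrable lborel (\<lambda>x. F (x + c))" "(LINT x|lborel. F (x + c)) = (LINT x|lborel. F x)" for c
  proof -
    have D: "distr lborel borel ((+) c) = (lborel :: (real^'n) measure)" by (rule lborel_distr_plus)
    have "integrable (distr lborel borel ((+) c)) F" using F by (simp only: D)
    then show "integrable lborel (\<lambda>x. F (x + c))"
      by (subst (asm) integrable_distr_eq) (use Fm in \<open>auto simp: add.commute\<close>)
    have "(LINT x|lborel. F x) = (LINT x|distr lborel borel ((+) c). F x)" by (simp only: D)
    also have "\<dots> = (LINT x|lborel. F (x + c))"
      by (subst integral_distr) (use Fm in \<open>auto simp: add.commute\<close>)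
    finally show "(LINT x|lborel. F (x + c)) = (LINT x|lborel. F x)" ..
  qed
  have "(\<lambda>n. LINT x|lborel. u n x) \<longlonglongrightarrow> (LINT x|lborel. partial_deriv k F x)"
  proof (rule integral_dominated_convergence)
    show "integrable lborel (\<lambda>x :: real^'n. C * 3 ^ CARD('n) * cauchy_weight x)"
      by (intro integrable_mult_right integrable_cauchy_weight)
    show "u n \<in> borel_measurable lborel" for n
      unfolding u_def using Ft(1) F by (auto dest!: borel_measurable_integrable)
  qed (use m lim bound in auto)
  moreover have "(LINT x|lborel. u n x) = 0" for n
    unfolding u_def using Ft F by (simp add: Bochner_Integration.integral_diff)
  ultimately show ?thesis by (simp add: LIMSEQ_const_iff)
qed

text \<open>The partial derivative of the Wronskian-like expression \<open>f' * g - f * g'\<close>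
  is \<open>f'' * g - f * g''\<close>, and its integral vanishes.\<close>

lemma integral_second_deriv_swap:
  fixes f g :: "real^'n \<Rightarrow> complex"
  assumes f: "f \<in> schwartz" and g: "g \<in> schwartz"
  shows "(LINT x|lborel. partial_deriv k (partial_deriv k f) x * g x)
    = (LINT x|lborel. f x * partial_deriv k (partial_deriv k g) x)"
proof -
  let ?f' = "partial_deriv k f" and ?g' = "partial_deriv k g"
  let ?f'' = "partial_deriv k ?f'" and ?g'' = "partial_deriv k ?g'"
  note S = schwartz_partial_deriv
  note Q = schwartz_square_integrable
  define F where "F x = 1 * (?f' x * g x) + (-1) * (f x * ?g' x)" for x
  have d1: "(\<lambda>x. ?f' x * g x) differentiable (at x)" "(\<lambda>x. f x * ?g' x) differentiable (at x)" for x
    by (intro derivative_intros schwartz_differentiable S f g)+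
  have F': "partial_deriv k F x = ?f'' x * g x - f x * ?g'' x" for x
    unfolding F_def[abs_def] partial_deriv_lincomb[OF d1]
    by (simp add: partial_deriv_mult schwartz_differentiable S f g)
  have i: "integrable lborel (\<lambda>x. ?f'' x * g x)" "integrable lborel (\<lambda>x. f x * ?g'' x)"
    "integrable lborel (\<lambda>x. ?f' x * g x)" "integrable lborel (\<lambda>x. f x * ?g' x)"
    by (intro square_integrable_mult Q S f g)+
  obtain A B C D where bd: "\<And>x. cmod (?f'' x) * (1 + (norm x)\<^sup>2) ^ CARD('n) \<le> A"
    "\<And>x. cmod (g x) * (1 + (norm x)\<^sup>2) ^ 0 \<le> B"
    "\<And>x. cmod (f x) * (1 + (norm x)\<^sup>2) ^ 0 \<le> C"
    "\<And>x. cmod (?g'' x) * (1 + (norm x)\<^sup>2) ^ CARD('n) \<le> D"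
    and pos: "0 \<le> A" "0 \<le> B" "0 \<le> C" "0 \<le> D"
    using schwartz_decay[OF S[OF S[OF f]], where m = "CARD('n)"] schwartz_decay[OF g, of 0]
      schwartz_decay[OF f, of 0] schwartz_decay[OF S[OF S[OF g]], where m = "CARD('n)"]
    by blast
  have "(LINT x|lborel. partial_deriv k F x) = 0"
  proof (rule integral_partial_deriv_eq_0)
    show "F differentiable (at x)" for x
      unfolding F_def[abs_def] by (intro derivative_intros d1)
    show "integrable lborel F"
      unfolding F_def[abs_def] using i by simp
    show "partial_deriv k F \<in> borel_measurable borel"
      unfolding F'[abs_def] using i by (auto dest!: borel_measurable_integrable)
    show "cmod (partial_deriv k F x) * (1 + (norm x)\<^sup>2) ^ CARD('n) \<le> A * B + C * D" for x
    proof -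
      have "cmod (partial_deriv k F x) * (1 + (norm x)\<^sup>2) ^ CARD('n)
          \<le> (cmod (?f'' x) * cmod (g x) + cmod (f x) * cmod (?g'' x)) * (1 + (norm x)\<^sup>2) ^ CARD('n)"
        unfolding F' norm_mult[symmetric] by (intro mult_right_mono norm_triangle_ineq4) auto
      also have "\<dots> = (cmod (?f'' x) * (1 + (norm x)\<^sup>2) ^ CARD('n)) * (cmod (g x) * (1 + (norm x)\<^sup>2) ^ 0)
          + (cmod (f x) * (1 + (norm x)\<^sup>2) ^ 0) * (cmod (?g'' x) * (1 + (norm x)\<^sup>2) ^ CARD('n))"
        by (simp add: algebra_simps)
      also have "\<dots> \<le> A * B + C * D"
        by (intro add_mono mult_mono bd pos) auto
      finally show ?thesis .
    qed
  qed
  then show ?thesis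
    unfolding F' using i by simp
qed

text \<open>Twice the k-th summand of the Hamiltonian. Its eigenvalue reveals the single quantum
  number \<open>n k\<close>, even where total energies are degenerate.\<close>

definition oscillator_coord ::
    "('n::finite \<Rightarrow> real) \<Rightarrow> 'n \<Rightarrow> (real^'n \<Rightarrow> complex) \<Rightarrow> real^'n \<Rightarrow> complex" where
  "oscillator_coord \<omega> k f x =
     - partial_deriv k (partial_deriv k f) x + complex_of_real ((\<omega> k)\<^sup>2 * (x $ k)\<^sup>2) * f x"

lemma oscillator_expr_eq: "oscillator_expr \<omega> f x = (1 / 2) * (\<Sum>k\<in>UNIV. oscillator_coord \<omega> k f x)"
  by (simp add: oscillator_expr_def oscillator_coord_def)

lemma oscillator_coord_square_integrable:
  fixes f :: "real^'n \<Rightarrow> complex"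
  assumes "f \<in> schwartz"
  shows "oscillator_coord \<omega> k f \<in> square_integrable"
proof -
  have "(\<lambda>x. (-1) * partial_deriv k (partial_deriv k f) x + complex_of_real ((\<omega> k)\<^sup>2 * (x $ k)\<^sup>2) * f x)
      \<in> square_integrable"
    by (intro square_integrable_add square_integrable_cmult square_integrable_coord_square
        schwartz_square_integrable schwartz_partial_deriv assms)
  then show ?thesis by (simp add: oscillator_coord_def[abs_def])
qed

lemma oscillator_expr_square_integrable:
  fixes f :: "real^'n \<Rightarrow> complex"
  assumes "f \<in> schwartz"
  shows "oscillator_expr \<omega> f \<in> square_integrable"
  unfolding oscillator_expr_eq[abs_def]
  by (intro square_integrable_cmult square_integrable_sum oscillator_coord_square_integrable assms)

lemma integral_oscillator_coord_swap:
  fixes f g :: "real^'n \<Rightarrow> complex"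
  assumes f: "f \<in> schwartz" and g: "g \<in> schwartz"
  shows "(LINT x|lborel. oscillator_coord \<omega> k f x * g x) = (LINT x|lborel. f x * oscillator_coord \<omega> k g x)"
proof -
  let ?V = "\<lambda>x :: real^'n. complex_of_real ((\<omega> k)\<^sup>2 * (x $ k)\<^sup>2)"
  note Q = schwartz_square_integrable
  note S = schwartz_partial_deriv
  have i: "integrable lborel (\<lambda>x. partial_deriv k (partial_deriv k f) x * g x)"
    "integrable lborel (\<lambda>x. f x * partial_deriv k (partial_deriv k g) x)"
    by (intro square_integrable_mult Q S f g)+
  have iV: "integrable lborel (\<lambda>x. (?V x * f x) * g x)"
    by (intro square_integrable_mult Q square_integrable_coord_square f g)
  have "(LINT x|lborel. oscillator_coord \<omega> k f x * g x)
      = (LINT x|lborel. (?V x * f x) * g x - partial_deriv k (partial_deriv k f) x * g x)"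
    by (rule Bochner_Integration.integral_cong) (auto simp: oscillator_coord_def algebra_simps)
  also have "\<dots> = (LINT x|lborel. (?V x * f x) * g x) - (LINT x|lborel. partial_deriv k (partial_deriv k f) x * g x)"
    by (rule Bochner_Integration.integral_diff[OF iV i(1)])
  also have "\<dots> = (LINT x|lborel. (?V x * f x) * g x) - (LINT x|lborel. f x * partial_deriv k (partial_deriv k g) x)"
    by (simp only: integral_second_deriv_swap[OF f g])
  also have "\<dots> = (LINT x|lborel. (?V x * f x) * g x - f x * partial_deriv k (partial_deriv k g) x)"
    by (rule Bochner_Integration.integral_diff[OF iV i(2), symmetric])
  also have "\<dots> = (LINT x|lborel. f x * oscillator_coord \<omega> k g x)"
    by (rule Bochner_Integration.integral_cong) (auto simp: oscillator_coord_def algebra_simps)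
  finally show ?thesis .
qed

text \<open>The pairing is bilinear, without conjugation; this suffices because one of the two
  functions will be a real-valued Hermite function.\<close>

lemma integral_oscillator_expr_swap:
  fixes f g :: "real^'n \<Rightarrow> complex"
  assumes f: "f \<in> schwartz" and g: "g \<in> schwartz"
  shows "(LINT x|lborel. f x * oscillator_expr \<omega> g x) = (LINT x|lborel. oscillator_expr \<omega> f x * g x)"
proof -
  have i: "integrable lborel (\<lambda>x. f x * oscillator_coord \<omega> k g x)"
    "integrable lborel (\<lambda>x. oscillator_coord \<omega> k f x * g x)" for k
    by (intro square_integrable_mult schwartz_square_integrable oscillator_coord_square_integrable f g)+
  have "(LINT x|lborel. f x * oscillator_expr \<omega> g x)
      = (LINT x|lborel. (1 / 2) * (\<Sum>k\<in>UNIV. f x * oscillator_coord \<omega> k g x))"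
    by (rule Bochner_Integration.integral_cong) (auto simp: oscillator_expr_eq sum_distrib_left mult_ac)
  also have "\<dots> = (1 / 2) * (\<Sum>k\<in>UNIV. LINT x|lborel. f x * oscillator_coord \<omega> k g x)"
    using i by (simp add: Bochner_Integration.integral_sum)
  also have "\<dots> = (1 / 2) * (\<Sum>k\<in>UNIV. LINT x|lborel. oscillator_coord \<omega> k f x * g x)"
    by (simp only: integral_oscillator_coord_swap[OF f g])
  also have "\<dots> = (LINT x|lborel. (1 / 2) * (\<Sum>k\<in>UNIV. oscillator_coord \<omega> k f x * g x))"
    using i by (simp add: Bochner_Integration.integral_sum)
  also have "\<dots> = (LINT x|lborel. oscillator_expr \<omega> f x * g x)"
    by (rule Bochner_Integration.integral_cong) (auto simp: oscillator_expr_eq sum_distrib_right sum_distrib_left mult_ac)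
  finally show ?thesis .
qed

lemma oscillator_expr_lincomb:
  fixes f g :: "real^'n \<Rightarrow> complex"
  assumes f: "f \<in> schwartz" and g: "g \<in> schwartz"
  shows "oscillator_expr \<omega> (\<lambda>x. a * f x + b * g x) x = a * oscillator_expr \<omega> f x + b * oscillator_expr \<omega> g x"
proof -
  have 1: "partial_deriv k (\<lambda>x. a * f x + b * g x) = (\<lambda>x. a * partial_deriv k f x + b * partial_deriv k g x)" for k
    by (intro ext partial_deriv_lincomb schwartz_differentiable f g)
  have 2: "partial_deriv k (\<lambda>x. a * partial_deriv k f x + b * partial_deriv k g x) x
      = a * partial_deriv k (partial_deriv k f) x + b * partial_deriv k (partial_deriv k g) x" for k
    by (intro partial_deriv_lincomb schwartz_differentiable schwartz_partial_deriv f g)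
  have "oscillator_coord \<omega> k (\<lambda>x. a * f x + b * g x) x
      = a * oscillator_coord \<omega> k f x + b * oscillator_coord \<omega> k g x" for k
    unfolding oscillator_coord_def 1 2 by (simp add: algebra_simps)
  then show ?thesis
    by (simp add: oscillator_expr_eq sum.distrib sum_distrib_left distrib_left mult_ac)
qed

section \<open>Totality of the Hermite functions\<close>

text \<open>Levy's theorem concerns probability measures, whereas \<open>g\<close> is signed. Its
  positive and negative parts, normalised and pushed forward by \<open>X\<close>, are two
  distributions on the line with the same characteristic function.\<close>

lemma integral_indicator_eq_0_if_char_eq_0:
  fixes g :: "'a \<Rightarrow> real"
  assumes g: "integrable M g" and X [measurable]: "X \<in> borel_measurable M"
    and char0: "\<And>t. (LINT x|M. complex_of_real (g x) * iexp (t * X x)) = 0"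
    and B [measurable]: "B \<in> sets borel"
  shows "(LINT x|M. g x * indicator B (X x)) = 0"
proof -
  have gm [measurable]: "g \<in> borel_measurable M" using g by auto
  define gp where "gp x = max 0 (g x)" for x
  define gn where "gn x = max 0 (- g x)" for x
  have nn: "0 \<le> gp x" "0 \<le> gn x" for x by (simp_all add: gp_def gn_def)
  have m [measurable]: "gp \<in> borel_measurable M" "gn \<in> borel_measurable M"
    unfolding gp_def gn_def by measurable
  have int: "integrable M gp" "integrable M gn"
    unfolding gp_def gn_def using g by auto
  have g_eq: "g x = gp x - gn x" for x by (simp add: gp_def gn_def)
  have bint: "integrable M (\<lambda>x. complex_of_real (h x) * iexp (t * X x))"
    if "integrable M h" for h :: "'a \<Rightarrow> real" and t
    using that by (intro Bochner_Integration.integrable_bound[OF that])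
      (auto simp: norm_mult)
  have char_eq: "(LINT x|M. complex_of_real (gp x) * iexp (t * X x))
      = (LINT x|M. complex_of_real (gn x) * iexp (t * X x))" for t
  proof -
    have "(LINT x|M. complex_of_real (gp x) * iexp (t * X x) - complex_of_real (gn x) * iexp (t * X x)) = 0"
      using char0[of t] by (simp add: g_eq left_diff_distrib)
    then show ?thesis
      using Bochner_Integration.integral_diff[OF bint[OF int(1)] bint[OF int(2)], of t t] by simp
  qed
  define c where "c = (LINT x|M. gp x)"
  \<comment> \<open>Equality of the characteristic functions at 0 says that both parts have the same
    mass.\<close>
  have cn: "(LINT x|M. gn x) = c"
    using char_eq[of 0] by (simp add: c_def)
  have c0: "0 \<le> c" unfolding c_def by (simp add: nn integral_nonneg_AE)
  show ?thesis
  \<comment> \<open>Without mass there is nothing to normalise, but then \<open>g\<close> vanishes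
    almost everywhere.\<close>
  proof (cases "c = 0")
    case True
    have "AE x in M. gp x = 0"
      using integral_nonneg_eq_0_iff_AE[OF int(1)] nn True by (simp add: c_def)
    moreover have "AE x in M. gn x = 0"
      using integral_nonneg_eq_0_iff_AE[OF int(2)] nn True cn by simp
    ultimately have "AE x in M. g x * indicator B (X x) = 0"
      by eventually_elim (simp add: g_eq)
    then show ?thesis by (rule integral_eq_zero_AE)
  next
    case False
    with c0 have c: "0 < c" by simp
    define N where "N h = distr (density M (\<lambda>x. ennreal (h x / c))) borel X" for h :: "'a \<Rightarrow> real"
    have N_integral: "integral\<^sup>L (N h) \<phi> = (LINT x|M. (h x / c) *\<^sub>R \<phi> (X x))"
      if [measurable]: "h \<in> borel_measurable M" and "\<And>x. 0 \<le> h x" and [measurable]: "\<phi> \<in> borel_measurable borel"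
      for h and \<phi> :: "real \<Rightarrow> 'b::{banach, second_countable_topology}"
      unfolding N_def using c that(2) by (simp add: integral_distr integral_density)
    have N_real: "real_distribution (N h)"
      if [measurable]: "h \<in> borel_measurable M" and h: "\<And>x. 0 \<le> h x" "integrable M h" "(LINT x|M. h x) = c" for h
    proof -
      interpret prob_space "density M (\<lambda>x. ennreal (h x / c))"
      proof
        have "emeasure (density M (\<lambda>x. ennreal (h x / c))) (space M) = (\<integral>\<^sup>+x. ennreal (h x / c) \<partial>M)"
          by (subst emeasure_density) (auto intro!: nn_integral_cong)
        also have "\<dots> = ennreal (LINT x|M. h x / c)"
          using h c by (intro nn_integral_eq_integral) auto
        finally show "emeasure (density M (\<lambda>x. ennreal (h x / c))) (space (density M (\<lambda>x. ennreal (h x / c)))) = 1"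
          using h c by simp
      qed
      show ?thesis unfolding N_def by (rule real_distribution_distr) simp
    qed
    have "N gp = N gn"
    proof (rule Levy_uniqueness)
      show "real_distribution (N gp)" "real_distribution (N gn)"
        by (rule N_real; use nn int cn in \<open>simp add: c_def\<close>)+
      show "char (N gp) = char (N gn)"
      proof
        fix t
        have "char (N h) t = (LINT x|M. complex_of_real (h x) * iexp (t * X x)) / complex_of_real c"
          if "h \<in> borel_measurable M" "\<And>x. 0 \<le> h x" for h
          unfolding char_def
          by (subst N_integral[OF that]) (auto simp: scaleR_conv_of_real)
        then show "char (N gp) t = char (N gn) t"
          using nn char_eq by simp
      qed
    qed
    then have "integral\<^sup>L (N gp) (indicat_real B) = integral\<^sup>L (N gn) (indicat_real B)" by simp
    then have "(LINT x|M. (gp x / c) *\<^sub>R indicat_real B (X x)) = (LINT x|M. (gn x / c) *\<^sub>R indicat_real B (X x))"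
      by (subst (asm) (1 2) N_integral) (use nn in simp_all)
    then have eq: "(LINT x|M. gp x * indicator B (X x)) = (LINT x|M. gn x * indicator B (X x))"
      using c by simp
    have "integrable M (\<lambda>x. h x * indicator B (X x))" if "integrable M h" for h :: "'a \<Rightarrow> real"
      using that by (intro Bochner_Integration.integrable_bound[OF that]) (auto simp: indicator_def)
    then have "(LINT x|M. gp x * indicator B (X x) - gn x * indicator B (X x)) = 0"
      using int eq by (subst Bochner_Integration.integral_diff) auto
    then show ?thesis by (simp add: g_eq left_diff_distrib)
  qed
qed

text \<open>A power is at most \<open>fact m\<close> times the exponential, being a single term of
  its series up to that factor.\<close>

lemma integrable_mult_power:
  fixes g X :: "'a \<Rightarrow> real"
  assumes X [measurable]: "X \<in> borel_measurable M"
    and e: "integrable M (\<lambda>x. g x * exp \<bar>X x\<bar>)" and gm [measurable]: "g \<in> borel_measurable M"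
  shows "integrable M (\<lambda>x. g x * X x ^ m)"
proof (rule Bochner_Integration.integrable_bound)
  show "integrable M (\<lambda>x. fact m * (g x * exp \<bar>X x\<bar>))"
    using e by (rule integrable_mult_right)
  have "norm (g x * X x ^ m) \<le> norm (fact m * (g x * exp \<bar>X x\<bar>))" for x
  proof -
    have "(\<Sum>i\<in>{m}. \<bar>X x\<bar> ^ i /\<^sub>R fact i) \<le> (\<Sum>i. \<bar>X x\<bar> ^ i /\<^sub>R fact i)"
      by (rule sum_le_suminf[OF summable_exp_generic]) auto
    then have "\<bar>X x\<bar> ^ m \<le> fact m * exp \<bar>X x\<bar>"
      by (simp add: exp_def divide_simps mult.commute)
    then have "\<bar>g x\<bar> * \<bar>X x\<bar> ^ m \<le> \<bar>g x\<bar> * (fact m * exp \<bar>X x\<bar>)"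
      by (rule mult_left_mono) simp
    then show ?thesis by (simp add: abs_mult power_abs mult_ac)
  qed
  then show "AE x in M. norm (g x * X x ^ m) \<le> norm (fact m * (g x * exp \<bar>X x\<bar>))" by simp
qed measurable

text \<open>The exponential series is integrated term by term. Its partial sums are dominated by
  \<open>\<bar>g\<bar>\<close> times \<open>exp (\<bar>t\<bar> * \<bar>X\<bar>)\<close>; this is
  where exponential integrability rules out moment indeterminacy.\<close>

lemma char_eq_0_if_moments_eq_0:
  fixes g X :: "'a \<Rightarrow> real"
  assumes X [measurable]: "X \<in> borel_measurable M" and gm [measurable]: "g \<in> borel_measurable M"
    and e: "\<And>t. integrable M (\<lambda>x. g x * exp (t * \<bar>X x\<bar>))"
    and mom: "\<And>m. (LINT x|M. g x * X x ^ m) = 0"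
  shows "(LINT x|M. complex_of_real (g x) * iexp (t * X x)) = 0"
proof -
  define s where "s n x = (\<Sum>m<n. ((\<i> * t) ^ m / fact m) * complex_of_real (g x * X x ^ m))" for n x
  have im: "integrable M (\<lambda>x. g x * X x ^ m)" for m
    using integrable_mult_power[of X M g m] e[of 1] by simp
  have "(\<lambda>n. LINT x|M. s n x) \<longlonglongrightarrow> (LINT x|M. complex_of_real (g x) * iexp (t * X x))"
  proof (rule integral_dominated_convergence)
    show "integrable M (\<lambda>x. norm (g x * exp (\<bar>t\<bar> * \<bar>X x\<bar>)))"
      using e by (rule integrable_norm)
    show "s n \<in> borel_measurable M" for n
      unfolding s_def by measurable
    have s_eq: "s n x = complex_of_real (g x) * (\<Sum>m<n. (\<i> * complex_of_real (t * X x)) ^ m /\<^sub>R fact m)" for n x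
      by (simp add: s_def sum_distrib_left power_mult_distrib scaleR_conv_of_real divide_inverse mult_ac)
    have "(\<lambda>n. s n x) \<longlonglongrightarrow> complex_of_real (g x) * iexp (t * X x)" for x
      unfolding s_eq using exp_converges[of "\<i> * complex_of_real (t * X x)"]
      by (intro tendsto_intros) (simp add: sums_def)
    then show "AE x in M. (\<lambda>n. s n x) \<longlonglongrightarrow> complex_of_real (g x) * iexp (t * X x)" by simp
    have "norm (s n x) \<le> norm (g x * exp (\<bar>t\<bar> * \<bar>X x\<bar>))" for n x
    proof -
      have "norm (\<Sum>m<n. (\<i> * complex_of_real (t * X x)) ^ m /\<^sub>R fact m) \<le> (\<Sum>m<n. \<bar>t * X x\<bar> ^ m /\<^sub>R fact m)"
        by (rule order_trans[OF norm_sum]) (simp add: norm_power norm_mult abs_mult)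
      also have "\<dots> \<le> (\<Sum>m. \<bar>t * X x\<bar> ^ m /\<^sub>R fact m)"
        by (rule sum_le_suminf[OF summable_exp_generic]) auto
      also have "\<dots> = exp (\<bar>t\<bar> * \<bar>X x\<bar>)"
        by (simp add: exp_def abs_mult)
      finally show ?thesis
        unfolding s_eq norm_mult by (simp add: mult_left_mono)
    qed
    then show "AE x in M. norm (s n x) \<le> norm (g x * exp (\<bar>t\<bar> * \<bar>X x\<bar>))" for n by simp
  qed measurable
  moreover have "(LINT x|M. s n x) = 0" for n
  proof -
    have "(LINT x|M. s n x) = (\<Sum>m<n. LINT x|M. ((\<i> * t) ^ m / fact m) * complex_of_real (g x * X x ^ m))"
      unfolding s_def by (rule Bochner_Integration.integral_sum) (intro integrable_mult_right integrable_of_real im)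
    also have "\<dots> = 0"
      by (intro sum.neutral ballI) (simp only: integral_mult_right_zero integral_complex_of_real mom, simp)
    finally show ?thesis .
  qed
  ultimately show ?thesis by (simp add: LIMSEQ_const_iff)
qed

text \<open>Subtracting the multiple of \<open>hermite c (Suc n)\<close> that cancels the leading
  coefficient lowers the degree, so Hermite polynomials span all polynomials.\<close>

lemma moments_eq_0_if_hermite_eq_0:
  fixes g X :: "'a \<Rightarrow> real"
  assumes X [measurable]: "X \<in> borel_measurable M" and gm [measurable]: "g \<in> borel_measurable M"
    and e: "integrable M (\<lambda>x. g x * exp \<bar>X x\<bar>)" and c: "c \<noteq> 0"
    and her: "\<And>n. (LINT x|M. g x * poly (hermite c n) (X x)) = 0"
  shows "(LINT x|M. g x * X x ^ m) = 0"
proof -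
  have ip: "integrable M (\<lambda>x. g x * poly p (X x))" for p
  proof -
    have "g x * poly p (X x) = (\<Sum>i\<le>degree p. coeff p i * (g x * X x ^ i))" for x
      by (simp add: poly_altdef sum_distrib_left mult_ac)
    then show ?thesis
      by (simp only:) (intro Bochner_Integration.integrable_sum integrable_mult_right
          integrable_mult_power[OF X e gm])
  qed
  have "(LINT x|M. g x * poly p (X x)) = 0" if "degree p \<le> n" for p n
    using that
  proof (induction n arbitrary: p)
    case 0
    then obtain a where "p = [:a:]" by (auto elim: degree_eq_zeroE)
    then show ?case using her[of 0] by simp
  next
    case (Suc n)
    define a where "a = coeff p (Suc n) / (2 * c) ^ Suc n"
    define r where "r = p - smult a (hermite c (Suc n))"
    have "coeff r i = 0" if "i > n" for i
    proof (cases "i = Suc n")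
      case True
      then show ?thesis using c coeff_hermite[of c "Suc n"] by (simp add: r_def a_def)
    next
      case False
      with that have "i > Suc n" by simp
      then have "coeff p i = 0" "coeff (hermite c (Suc n)) i = 0"
        using Suc.prems degree_hermite_le[of c "Suc n"] by (intro coeff_eq_0; linarith)+
      then show ?thesis by (simp add: r_def)
    qed
    then have "degree r \<le> n" by (intro degree_le) auto
    then have "(LINT x|M. g x * poly r (X x)) = 0" by (rule Suc.IH)
    moreover have "g x * poly p (X x) = g x * poly r (X x) + a * (g x * poly (hermite c (Suc n)) (X x))" for x
      by (simp add: r_def algebra_simps)
    ultimately show ?case
      using ip her by (simp add: Bochner_Integration.integral_add del: hermite.simps)
  qed
  from this[of "monom 1 m" m] show ?thesis
    by (simp add: degree_monom_le poly_monom)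
qed

lemma integral_indicator_eq_0_if_hermite_eq_0:
  fixes g X :: "'a \<Rightarrow> real"
  assumes X: "X \<in> borel_measurable M" and gm: "g \<in> borel_measurable M"
    and e: "\<And>t. integrable M (\<lambda>x. g x * exp (t * \<bar>X x\<bar>))" and c: "c \<noteq> 0"
    and her: "\<And>n. (LINT x|M. g x * poly (hermite c n) (X x)) = 0"
    and B: "B \<in> sets borel"
  shows "(LINT x|M. g x * indicator B (X x)) = 0"
proof (rule integral_indicator_eq_0_if_char_eq_0)
  show "integrable M g" using e[of 0] by simp
  have "(LINT x|M. g x * X x ^ m) = 0" for m
    using moments_eq_0_if_hermite_eq_0[OF X gm _ c her] e[of 1] by simp
  then show "(LINT x|M. complex_of_real (g x) * iexp (t * X x)) = 0" for t
    by (rule char_eq_0_if_moments_eq_0[OF X gm e])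
qed fact+

text \<open>The positive and negative parts of \<open>u\<close> are densities of two measures that
  agree on boxes, an intersection-stable generator of the Borel sets. The measures, and hence the
  densities, coincide, and both parts can be equal only where they are zero.\<close>

lemma AE_eq_0_if_box_integrals_eq_0:
  fixes u :: "'a::euclidean_space \<Rightarrow> real"
  assumes u: "integrable lborel u"
    and box: "\<And>a b. (LINT x|lborel. u x * indicator (box a b) x) = 0"
  shows "AE x in lborel. u x = 0"
proof -
  have um [measurable]: "u \<in> borel_measurable borel" using u by auto
  have int: "integrable lborel (\<lambda>x. max 0 (u x))" "integrable lborel (\<lambda>x. max 0 (- u x))"
    using u by auto
  have e: "emeasure (density lborel (\<lambda>x. ennreal (max 0 (h x)))) A
      = ennreal (LINT x|lborel. max 0 (h x) * indicator A x)"
    if h: "integrable lborel h" and [measurable]: "A \<in> sets borel" for h :: "'a \<Rightarrow> real" and A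
  proof -
    have [measurable]: "h \<in> borel_measurable borel" using h by auto
    have "integrable lborel (\<lambda>x. max 0 (h x) * indicator A x)"
      using h by (intro integrable_real_mult_indicator) auto
    then have "(\<integral>\<^sup>+x. ennreal (max 0 (h x) * indicator A x) \<partial>lborel) = ennreal (LINT x|lborel. max 0 (h x) * indicator A x)"
      by (intro nn_integral_eq_integral) auto
    then show ?thesis
      by (subst emeasure_density) (auto simp: ennreal_mult'' ennreal_indicator)
  qed
  have "density lborel (\<lambda>x. ennreal (max 0 (u x))) = density lborel (\<lambda>x. ennreal (max 0 (- u x)))"
  proof (rule measure_eqI_generator_eq)
    let ?E = "range (\<lambda>(a, b). box a b :: 'a set)"
    show "Int_stable ?E"
      by (auto simp: Int_stable_def box_Int_box)
    show "?E \<subseteq> Pow UNIV" "sets (density lborel (\<lambda>x. ennreal (max 0 (u x)))) = sigma_sets UNIV ?E"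
      "sets (density lborel (\<lambda>x. ennreal (max 0 (- u x)))) = sigma_sets UNIV ?E"
      by (simp_all add: borel_eq_box)
    let ?A = "\<lambda>n::nat. box (- (real n *\<^sub>R One)) (real n *\<^sub>R One) :: 'a set"
    show "range ?A \<subseteq> ?E" "(\<Union>i. ?A i) = UNIV"
      unfolding UN_box_eq_UNIV by auto
    show "emeasure (density lborel (\<lambda>x. ennreal (max 0 (u x)))) (?A i) \<noteq> \<infinity>" for i
      using u by (simp add: e)
    fix S :: "'a set" assume "S \<in> ?E"
    then obtain a b where S: "S = box a b" by auto
    have "(LINT x|lborel. max 0 (u x) * indicator S x) - (LINT x|lborel. max 0 (- u x) * indicator S x)
        = (LINT x|lborel. max 0 (u x) * indicator S x - max 0 (- u x) * indicator S x)"
      by (rule Bochner_Integration.integral_diff[symmetric])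
        (use int S in \<open>auto intro!: integrable_real_mult_indicator\<close>)
    also have "\<dots> = (LINT x|lborel. u x * indicator S x)"
      by (rule Bochner_Integration.integral_cong) (auto simp: max_def indicator_def)
    also have "\<dots> = 0" unfolding S by (rule box)
    finally show "emeasure (density lborel (\<lambda>x. ennreal (max 0 (u x)))) S
        = emeasure (density lborel (\<lambda>x. ennreal (max 0 (- u x)))) S"
      using u S by (simp add: e)
  qed
  then have "AE x in lborel. ennreal (max 0 (u x)) = ennreal (max 0 (- u x))"
    by (subst (asm) sigma_finite_measure.density_unique_iff) (auto intro: lborel.sigma_finite_measure_axioms)
  then show ?thesis
    by eventually_elim (auto simp: max_def split: if_splits)
qed

text \<open>
  The Hermite functions are traded for indicator functions one coordinate at a time; the
  remaining coordinates enter as a fixed factor of the integrable weight.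
\<close>

lemma hermite_functions_total_real:
  fixes f :: "real^'n \<Rightarrow> real" and \<omega> :: "'n \<Rightarrow> real"
  assumes \<omega>: "\<And>k. 0 < \<omega> k"
    and fm [measurable]: "f \<in> borel_measurable borel" and f2: "integrable lborel (\<lambda>x. (f x)\<^sup>2)"
    and orth: "\<And>n. (LINT x|lborel. f x * gauss_poly \<omega> (\<lambda>k. hermite (\<omega> k) (n k)) x) = 0"
  shows "AE x in lborel. f x = 0"
proof -
  define G where "G l y = exp (- (\<omega> l * y\<^sup>2 / 2))" for l y
  \<comment> \<open>Coordinates in \<open>S\<close> already carry indicators, the others still carry
    Hermite polynomials.\<close>
  define fac where "fac S n B l y = (if l \<in> S then indicat_real (B l) y else poly (hermite (\<omega> l) (n l)) y)"
    for S :: "'n set" and n :: "'n \<Rightarrow> nat" and B :: "'n \<Rightarrow> real set" and l y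
  have int: "integrable lborel (\<lambda>x. f x * h x)"
    if [measurable]: "h \<in> borel_measurable borel" and h: "\<And>x. \<bar>h x\<bar> \<le> C * cauchy_weight x" for h C
  proof (rule Bochner_Integration.integrable_bound)
    show "integrable lborel (\<lambda>x. (f x)\<^sup>2 + C\<^sup>2 * cauchy_weight x)"
      by (intro Bochner_Integration.integrable_add f2 integrable_mult_right integrable_cauchy_weight)
    have "norm (f x * h x) \<le> norm ((f x)\<^sup>2 + C\<^sup>2 * cauchy_weight x)" for x
    proof -
      have w: "0 < cauchy_weight x" "cauchy_weight x \<le> 1"
        by (rule cauchy_weight_pos cauchy_weight_le_1)+
      have "(h x)\<^sup>2 \<le> (C * cauchy_weight x)\<^sup>2"
        using power_mono[OF h[of x] abs_ge_zero, of 2] by simp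
      also have "\<dots> = C\<^sup>2 * (cauchy_weight x * cauchy_weight x)"
        by (simp add: power2_eq_square)
      also have "\<dots> \<le> C\<^sup>2 * cauchy_weight x"
        using w by (intro mult_left_mono mult_left_le) auto
      finally have h2: "(h x)\<^sup>2 \<le> C\<^sup>2 * cauchy_weight x" .
      have "2 * (\<bar>f x\<bar> * \<bar>h x\<bar>) \<le> (f x)\<^sup>2 + (h x)\<^sup>2"
        using sum_squares_bound[of "\<bar>f x\<bar>" "\<bar>h x\<bar>"] by (simp add: mult.assoc)
      moreover have "0 \<le> \<bar>f x\<bar> * \<bar>h x\<bar>" by simp
      ultimately have "\<bar>f x\<bar> * \<bar>h x\<bar> \<le> (f x)\<^sup>2 + C\<^sup>2 * cauchy_weight x"
        using h2 by linarith
      then show ?thesis by (simp add: abs_mult)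
    qed
    then show "AE x in lborel. norm (f x * h x) \<le> norm ((f x)\<^sup>2 + C\<^sup>2 * cauchy_weight x)" by simp
  qed measurable
  have main: "(LINT x|lborel. f x * (\<Prod>l\<in>UNIV. fac S n B l (x $ l) * G l (x $ l))) = 0"
    if "finite S" and "\<And>l. B l \<in> sets borel" for S n B
    using that
  \<comment> \<open>The multi-index must stay free: converting coordinate \<open>k\<close> uses the
    hypothesis for every value of \<open>n k\<close>.\<close>
  proof (induction S arbitrary: n)
    case empty
    then show ?case
      using orth[of n] by (simp add: gauss_poly_def fac_def G_def)
  next
    case (insert k S)
    have [measurable]: "B l \<in> sets borel" for l by (rule insert.prems)
    \<comment> \<open>All factors except the polynomial or indicator in coordinate \<open>k\<close>.
      The Gaussian of that coordinate is kept here, since it provides the exponential integrability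
      in \<open>x $ k\<close>.\<close>
    define R where "R x = G k (x $ k) * (\<Prod>l\<in>UNIV - {k}. fac S n B l (x $ l) * G l (x $ l))" for x :: "real^'n"
    define g where "g x = f x * R x" for x
    have fac_meas: "fac S n B l \<in> borel_measurable borel" for l
    proof (cases "l \<in> S")
      case True
      then show ?thesis unfolding fac_def by simp
    next
      case False
      then show ?thesis
        unfolding fac_def by (auto intro!: borel_measurable_continuous_onI continuous_intros)
    qed
    have Gm: "G l \<in> borel_measurable borel" for l
      unfolding G_def by measurable
    have nth: "(\<lambda>x :: real^'n. x $ l) \<in> borel_measurable borel" for l
      by (intro borel_measurable_continuous_onI continuous_intros)
    have Rm [measurable]: "R \<in> borel_measurable borel"
      unfolding R_def[abs_def]
      by (intro borel_measurable_times borel_measurable_prod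
          measurable_compose[OF nth fac_meas] measurable_compose[OF nth Gm])
    have split: "f x * (\<Prod>l\<in>UNIV. fac S' n' B l (x $ l) * G l (x $ l)) = g x * fac S' n' B k (x $ k)"
      if "\<And>l. l \<noteq> k \<Longrightarrow> fac S' n' B l = fac S n B l" for x :: "real^'n" and S' n'
    proof -
      have "(\<Prod>l\<in>UNIV. fac S' n' B l (x $ l) * G l (x $ l))
          = (fac S' n' B k (x $ k) * G k (x $ k)) * (\<Prod>l\<in>UNIV - {k}. fac S' n' B l (x $ l) * G l (x $ l))"
        by (rule prod.remove) auto
      also have "(\<Prod>l\<in>UNIV - {k}. fac S' n' B l (x $ l) * G l (x $ l))
          = (\<Prod>l\<in>UNIV - {k}. fac S n B l (x $ l) * G l (x $ l))"
        using that by (intro prod.cong) auto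
      finally show ?thesis by (simp add: g_def R_def mult_ac)
    qed
    have "(LINT x|lborel. g x * indicator (B k) (x $ k)) = 0"
    proof (rule integral_indicator_eq_0_if_hermite_eq_0)
      show "(\<lambda>x :: real^'n. x $ k) \<in> borel_measurable lborel" using nth[of k] by simp
      show "g \<in> borel_measurable lborel" unfolding g_def[abs_def] by measurable
      show "\<omega> k \<noteq> 0" using \<omega>[of k] by simp
      fix m
      have "fac S (n(k := m)) B k (x $ k) = poly (hermite (\<omega> k) m) (x $ k)" for x :: "real^'n"
        using insert.hyps by (simp add: fac_def)
      then have "(LINT x|lborel. g x * poly (hermite (\<omega> k) m) (x $ k))
          = (LINT x|lborel. f x * (\<Prod>l\<in>UNIV. fac S (n(k := m)) B l (x $ l) * G l (x $ l)))"
        by (subst split) (auto simp: fac_def)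
      also have "\<dots> = 0" by (rule insert.IH) (rule insert.prems)
      finally show "(LINT x|lborel. g x * poly (hermite (\<omega> k) m) (x $ k)) = 0" .
    next
      fix t
      \<comment> \<open>Indicators are bounded by the constant polynomial 1 and coordinate
        \<open>k\<close> contributes only its Gaussian, so \<open>R\<close> lies below a member of
        the Gaussian class.\<close>
      define P where "P l = (if l = k \<or> l \<in> S then 1 else hermite (\<omega> l) (n l))" for l
      obtain C where C: "0 \<le> C" "\<And>x. \<bar>gauss_poly \<omega> P x\<bar> * exp (\<bar>t\<bar> * (\<Sum>k\<in>UNIV. \<bar>x $ k\<bar>)) \<le> C * cauchy_weight x"
        using gauss_poly_bound[of \<omega> P "\<bar>t\<bar>"] \<omega> by blast
      have "\<bar>R x * exp (t * \<bar>x $ k\<bar>)\<bar> \<le> C * cauchy_weight x" for x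
      proof -
        have "\<bar>R x\<bar> = G k (x $ k) * (\<Prod>l\<in>UNIV - {k}. \<bar>fac S n B l (x $ l)\<bar> * G l (x $ l))"
          by (simp add: R_def G_def abs_mult abs_prod)
        also have "\<dots> \<le> G k (x $ k) * (\<Prod>l\<in>UNIV - {k}. \<bar>poly (P l) (x $ l)\<bar> * G l (x $ l))"
          by (intro mult_left_mono prod_mono)
            (auto simp: G_def P_def fac_def indicator_def intro!: mult_right_mono)
        also have "\<dots> = \<bar>gauss_poly \<omega> P x\<bar>"
          by (subst gauss_poly_remove[of _ _ _ k]) (simp add: P_def G_def abs_mult abs_prod)
        finally have "\<bar>R x\<bar> \<le> \<bar>gauss_poly \<omega> P x\<bar>" .
        moreover have "t * \<bar>x $ k\<bar> \<le> \<bar>t\<bar> * (\<Sum>k\<in>UNIV. \<bar>x $ k\<bar>)"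
          by (intro mult_mono member_le_sum) auto
        ultimately have "\<bar>R x\<bar> * exp (t * \<bar>x $ k\<bar>) \<le> \<bar>gauss_poly \<omega> P x\<bar> * exp (\<bar>t\<bar> * (\<Sum>k\<in>UNIV. \<bar>x $ k\<bar>))"
          by (intro mult_mono) auto
        also have "\<dots> \<le> C * cauchy_weight x" by (rule C)
        finally show ?thesis by (simp add: abs_mult)
      qed
      then have "integrable lborel (\<lambda>x. f x * (R x * exp (t * \<bar>x $ k\<bar>)))"
        using nth[of k] by (intro int) measurable
      then show "integrable lborel (\<lambda>x. g x * exp (t * \<bar>x $ k\<bar>))"
        by (simp add: g_def mult.assoc)
    qed (rule insert.prems)
    moreover have "fac (insert k S) n B k (x $ k) = indicator (B k) (x $ k)" for x :: "real^'n"
      by (simp add: fac_def)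
    ultimately show ?case
      by (subst split) (auto simp: fac_def)
  qed
  define E where "E x = (\<Prod>l\<in>UNIV. G l (x $ l))" for x
  have E_gauss: "E x = gauss_poly \<omega> (\<lambda>_. 1) x" for x
    by (simp add: E_def G_def gauss_poly_def)
  have "AE x in lborel. f x * E x = 0"
  proof (rule AE_eq_0_if_box_integrals_eq_0)
    obtain C where "0 \<le> C" "\<And>x. \<bar>E x\<bar> * exp (0 * (\<Sum>k\<in>UNIV. \<bar>x $ k\<bar>)) \<le> C * cauchy_weight x"
      unfolding E_gauss using gauss_poly_bound[of \<omega> "\<lambda>_. 1" 0] \<omega> by blast
    moreover have "E \<in> borel_measurable borel"
      unfolding E_def[abs_def] G_def by (intro borel_measurable_continuous_onI continuous_intros) auto
    ultimately show "integrable lborel (\<lambda>x. f x * E x)"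
      by (intro int[where C = C]) auto
    fix a b :: "real^'n"
    \<comment> \<open>A box is a product of intervals, the case of \<open>main\<close> with every
      coordinate converted.\<close>
    have "indicator (box a b) x = (\<Prod>l\<in>UNIV. indicat_real {a $ l<..<b $ l} (x $ l))" for x
    proof (cases "x \<in> box a b")
      case True
      then show ?thesis by (simp add: mem_box_cart)
    next
      case False
      then obtain l where "indicat_real {a $ l<..<b $ l} (x $ l) = 0"
        by (auto simp: mem_box_cart indicator_def)
      then have "(\<Prod>l\<in>UNIV. indicat_real {a $ l<..<b $ l} (x $ l)) = 0"
        by (intro prod_zero) auto
      with False show ?thesis by simp
    qed
    then have "f x * E x * indicator (box a b) x
        = f x * (\<Prod>l\<in>UNIV. fac UNIV (\<lambda>_. 0) (\<lambda>l. {a $ l<..<b $ l}) l (x $ l) * G l (x $ l))" for x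
      by (simp add: E_def fac_def prod.distrib mult_ac)
    then show "(LINT x|lborel. f x * E x * indicator (box a b) x) = 0"
      by (simp only:) (rule main, simp_all)
  qed
  moreover have "E x \<noteq> 0" for x
    by (simp add: E_def G_def)
  ultimately show ?thesis by simp
qed

text \<open>The Hermite functions are real, so orthogonality passes to the real and the imaginary
  part separately.\<close>

lemma hermite_functions_total:
  fixes f :: "real^'n \<Rightarrow> complex" and \<omega> :: "'n \<Rightarrow> real"
  assumes \<omega>: "\<And>k. 0 < \<omega> k" and f: "f \<in> square_integrable"
    and orth: "\<And>n. (LINT x|lborel. complex_of_real (gauss_poly \<omega> (\<lambda>k. hermite (\<omega> k) (n k)) x) * f x) = 0"
  shows "AE x in lborel. f x = 0"
proof -
  have fm [measurable]: "f \<in> borel_measurable borel"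
    using square_integrable_measurable[OF f] by simp
  have f2: "integrable lborel (\<lambda>x. (cmod (f x))\<^sup>2)"
    using f by (simp add: square_integrable_def)
  have i: "integrable lborel (\<lambda>x. complex_of_real (gauss_poly \<omega> (\<lambda>k. hermite (\<omega> k) (n k)) x) * f x)" for n
    by (intro square_integrable_mult schwartz_square_integrable gauss_poly_schwartz \<omega> f)
  have "AE x in lborel. Re (f x) = 0"
  proof (rule hermite_functions_total_real[OF \<omega>])
    show "integrable lborel (\<lambda>x. (Re (f x))\<^sup>2)"
      by (rule Bochner_Integration.integrable_bound[OF f2]) (auto simp: cmod_power2)
    show "(LINT x|lborel. Re (f x) * gauss_poly \<omega> (\<lambda>k. hermite (\<omega> k) (n k)) x) = 0" for n
      using integral_Re[OF i[of n]] orth[of n] by (simp add: mult.commute)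
  qed measurable
  moreover have "AE x in lborel. Im (f x) = 0"
  proof (rule hermite_functions_total_real[OF \<omega>])
    show "integrable lborel (\<lambda>x. (Im (f x))\<^sup>2)"
      by (rule Bochner_Integration.integrable_bound[OF f2]) (auto simp: cmod_power2)
    show "(LINT x|lborel. Im (f x) * gauss_poly \<omega> (\<lambda>k. hermite (\<omega> k) (n k)) x) = 0" for n
      using integral_Im[OF i[of n]] orth[of n] by (simp add: mult.commute)
  qed measurable
  ultimately show ?thesis
    by eventually_elim (simp add: complex_eq_iff)
qed

section \<open>Spectral decomposition of the harmonic oscillator\<close>

definition hermite_function :: "('n::finite \<Rightarrow> real) \<Rightarrow> ('n \<Rightarrow> nat) \<Rightarrow> real^'n \<Rightarrow> complex" where
  "hermite_function \<omega> n x = complex_of_real (gauss_poly \<omega> (\<lambda>k. hermite (\<omega> k) (n k)) x)"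

definition oscillator_energy :: "('n::finite \<Rightarrow> real) \<Rightarrow> ('n \<Rightarrow> nat) \<Rightarrow> real" where
  "oscillator_energy \<omega> n = (\<Sum>k\<in>UNIV. \<omega> k * (real (n k) + 1 / 2))"

lemma gauss_poly_upd:
  "gauss_poly c (P(k := p)) x = poly p (x $ k) * exp (- (c k * (x $ k)\<^sup>2 / 2)) *
     (\<Prod>l\<in>UNIV - {k}. poly (P l) (x $ l) * exp (- (c l * (x $ l)\<^sup>2 / 2)))"
  unfolding gauss_poly_remove[of c "P(k := p)" x k] by (auto intro!: prod.cong)

lemma oscillator_coord_hermite_function:
  fixes \<omega> :: "'n::finite \<Rightarrow> real"
  shows "oscillator_coord \<omega> k (hermite_function \<omega> n) x
    = complex_of_real (\<omega> k * (2 * real (n k) + 1)) * hermite_function \<omega> n x"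
proof -
  define P where "P k = hermite (\<omega> k) (n k)" for k
  have h: "hermite_function \<omega> n = (\<lambda>x. complex_of_real (gauss_poly \<omega> P x))"
    by (simp add: hermite_function_def[abs_def] P_def[abs_def])
  have d: "partial_deriv k (partial_deriv k (hermite_function \<omega> n)) x
      = complex_of_real (gauss_poly \<omega> (P(k := gauss_deriv (\<omega> k) (gauss_deriv (\<omega> k) (P k)))) x)"
    by (simp add: h partial_deriv_gauss_poly)
  have p: "poly (gauss_deriv (\<omega> k) (gauss_deriv (\<omega> k) (P k))) y
      = ((\<omega> k)\<^sup>2 * y\<^sup>2 - \<omega> k * (2 * real (n k) + 1)) * poly (P k) y" for y
    unfolding P_def gauss_deriv_hermite by (simp add: algebra_simps power2_eq_square)
  have g: "gauss_poly \<omega> (P(k := gauss_deriv (\<omega> k) (gauss_deriv (\<omega> k) (P k)))) x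
      = ((\<omega> k)\<^sup>2 * (x $ k)\<^sup>2 - \<omega> k * (2 * real (n k) + 1)) * gauss_poly \<omega> P x"
    unfolding gauss_poly_upd p by (subst gauss_poly_remove[of \<omega> P x k]) (simp add: mult.assoc)
  have "oscillator_coord \<omega> k (hermite_function \<omega> n) x
      = complex_of_real ((\<omega> k)\<^sup>2 * (x $ k)\<^sup>2 * gauss_poly \<omega> P x
          - ((\<omega> k)\<^sup>2 * (x $ k)\<^sup>2 - \<omega> k * (2 * real (n k) + 1)) * gauss_poly \<omega> P x)"
    unfolding oscillator_coord_def d g by (simp add: h)
  also have "\<dots> = complex_of_real (\<omega> k * (2 * real (n k) + 1) * gauss_poly \<omega> P x)"
    by (rule arg_cong[of _ _ complex_of_real]) (simp add: algebra_simps)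
  finally show ?thesis by (simp add: h)
qed

lemma oscillator_expr_hermite_function:
  fixes \<omega> :: "'n::finite \<Rightarrow> real"
  shows "oscillator_expr \<omega> (hermite_function \<omega> n)
    = (\<lambda>x. complex_of_real (oscillator_energy \<omega> n) * hermite_function \<omega> n x)"
proof
  fix x :: "real^'n"
  have "oscillator_expr \<omega> (hermite_function \<omega> n) x
      = (1 / 2) * ((\<Sum>k\<in>UNIV. complex_of_real (\<omega> k * (2 * real (n k) + 1))) * hermite_function \<omega> n x)"
    unfolding oscillator_expr_eq oscillator_coord_hermite_function sum_distrib_right ..
  also have "\<dots> = complex_of_real ((1 / 2) * (\<Sum>k\<in>UNIV. \<omega> k * (2 * real (n k) + 1))) * hermite_function \<omega> n x"
    by simp
  also have "(1 / 2) * (\<Sum>k\<in>UNIV. \<omega> k * (2 * real (n k) + 1)) = oscillator_energy \<omega> n"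
    unfolding oscillator_energy_def sum_distrib_left by (intro sum.cong) (auto simp: algebra_simps)
  finally show "oscillator_expr \<omega> (hermite_function \<omega> n) x
      = complex_of_real (oscillator_energy \<omega> n) * hermite_function \<omega> n x" .
qed

lemma cnj_hermite_function [simp]: "cnj (hermite_function \<omega> n x) = hermite_function \<omega> n x"
  by (simp add: hermite_function_def)

lemma hermite_function_uminus:
  "hermite_function \<omega> n (- x) = (-1) ^ (\<Sum>k\<in>UNIV. n k) * hermite_function \<omega> n x"
  by (simp add: hermite_function_def gauss_poly_def poly_hermite_uminus prod.distrib power_sum mult.assoc)

lemma abs_L2_eq_0D:
  assumes f: "f \<in> square_integrable" and "abs_L2 f = 0"
  shows "AE x in lborel. f x = 0"
proof -
  have "(LINT x|lborel. (cmod (f x))\<^sup>2) = 0"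
    using norm_abs_L2[OF f] assms(2) by simp
  then have "AE x in lborel. (cmod (f x))\<^sup>2 = 0"
    using f by (subst (asm) integral_nonneg_eq_0_iff_AE) (auto simp: square_integrable_def)
  then show ?thesis by simp
qed

lemma hermite_nonzero: "c \<noteq> 0 \<Longrightarrow> hermite c n \<noteq> 0"
  using coeff_hermite[of c n] by auto

context
  fixes \<omega> :: "'n::finite \<Rightarrow> real"
  assumes \<omega>_pos: "0 < \<omega> k"
begin

lemma hermite_function_schwartz: "hermite_function \<omega> n \<in> schwartz"
  unfolding hermite_function_def[abs_def] by (rule gauss_poly_schwartz) (rule \<omega>_pos)

lemma hermite_function_square_integrable: "hermite_function \<omega> n \<in> square_integrable"
  by (rule schwartz_square_integrable[OF hermite_function_schwartz])

text \<open>The nonzero set of a continuous function is open, so it is empty once it is a null set;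
  but choosing a non-root in each coordinate gives a point in it.\<close>

lemma abs_L2_hermite_function_nonzero: "abs_L2 (hermite_function \<omega> n) \<noteq> 0"
proof
  let ?h = "hermite_function \<omega> n"
  assume "abs_L2 ?h = 0"
  then have "AE x in lborel. ?h x = 0"
    by (intro abs_L2_eq_0D hermite_function_square_integrable)
  moreover have "open {x. ?h x \<noteq> 0}"
    using open_Collect_neq[OF schwartz_continuous[OF hermite_function_schwartz] continuous_on_const]
    by blast
  ultimately have "{x. ?h x \<noteq> 0} \<in> null_sets lborel"
    by (subst (asm) AE_iff_null) auto
  then have "negligible {x. ?h x \<noteq> 0}"
    unfolding negligible_iff_null_sets by (rule null_sets_completionI)
  with \<open>open {x. ?h x \<noteq> 0}\<close> have "{x. ?h x \<noteq> 0} = {}"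
    using open_not_negligible by blast
  moreover have "\<exists>y. poly (hermite (\<omega> k) (n k)) y \<noteq> 0" for k
    using poly_all_0_iff_0[of "hermite (\<omega> k) (n k)"] hermite_nonzero[of "\<omega> k" "n k"] \<omega>_pos[of k] by auto
  then obtain y where "\<And>k. poly (hermite (\<omega> k) (n k)) (y k) \<noteq> 0" by metis
  then have "?h (vec_lambda y) \<noteq> 0"
    by (simp add: hermite_function_def gauss_poly_def)
  ultimately show False by blast
qed

lemma cinner_hermite_function:
  "f \<in> square_integrable \<Longrightarrow>
     cinner (abs_L2 (hermite_function \<omega> n)) (abs_L2 f) = (LINT x|lborel. hermite_function \<omega> n x * f x)"
  by (simp add: cinner.abs_eq hermite_function_square_integrable)

text \<open>In a coordinate where the indices differ, the coordinate operator has two different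
  eigenvalues, and its symmetry forces the integral to vanish.\<close>

lemma hermite_functions_orthogonal:
  assumes "n \<noteq> m"
  shows "cinner (abs_L2 (hermite_function \<omega> n)) (abs_L2 (hermite_function \<omega> m)) = 0"
proof -
  from assms obtain k where k: "n k \<noteq> m k" by auto
  define I where "I = (LINT x|lborel. hermite_function \<omega> n x * hermite_function \<omega> m x)"
  have "complex_of_real (\<omega> k * (2 * real (n k) + 1)) * I = complex_of_real (\<omega> k * (2 * real (m k) + 1)) * I"
    using integral_oscillator_coord_swap[where \<omega> = \<omega> and k = k,
        OF hermite_function_schwartz[of n] hermite_function_schwartz[of m]]
    unfolding oscillator_coord_hermite_function I_def
    by (simp only: mult.assoc mult.left_commute[of _ "complex_of_real _"] integral_mult_right_zero)
  then have "I = 0"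
    using k \<omega>_pos[of k] by (simp del: of_real_mult of_real_add)
  then show ?thesis
    by (simp add: cinner_hermite_function hermite_function_square_integrable I_def)
qed

lemma cinner_hermite_function_oscillator:
  assumes "f \<in> schwartz"
  shows "cinner (abs_L2 (hermite_function \<omega> n)) (abs_L2 (oscillator_expr \<omega> f))
    = complex_of_real (oscillator_energy \<omega> n) * cinner (abs_L2 (hermite_function \<omega> n)) (abs_L2 f)"
  using assms
  by (simp add: cinner_hermite_function oscillator_expr_square_integrable schwartz_square_integrable
      integral_oscillator_expr_swap hermite_function_schwartz oscillator_expr_hermite_function mult.assoc)

definition oscillator_core :: "(real^'n) L2_op" where
  "oscillator_core = {(abs_L2 f, abs_L2 (oscillator_expr \<omega> f)) | f. f \<in> schwartz}"

lemma oscillator_core_lincomb: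
  assumes "(u, v) \<in> oscillator_core" "(u', v') \<in> oscillator_core"
  shows "(a *\<^sub>C u + c *\<^sub>C u', a *\<^sub>C v + c *\<^sub>C v') \<in> oscillator_core"
proof -
  from assms obtain f g where fg: "f \<in> schwartz" "u = abs_L2 f" "v = abs_L2 (oscillator_expr \<omega> f)"
    "g \<in> schwartz" "u' = abs_L2 g" "v' = abs_L2 (oscillator_expr \<omega> g)"
    unfolding oscillator_core_def by blast
  have L: "a *\<^sub>C abs_L2 f + c *\<^sub>C abs_L2 g = abs_L2 (\<lambda>x. a * f x + c * g x)"
    if "f \<in> square_integrable" "g \<in> square_integrable" for f g :: "real^'n \<Rightarrow> complex"
    using that by (simp add: scaleC.abs_eq plus_L2.abs_eq square_integrable_cmult)
  have "oscillator_expr \<omega> (\<lambda>x. a * f x + c * g x)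
      = (\<lambda>x. a * oscillator_expr \<omega> f x + c * oscillator_expr \<omega> g x)"
    by (intro ext oscillator_expr_lincomb fg)
  then have "a *\<^sub>C v + c *\<^sub>C v' = abs_L2 (oscillator_expr \<omega> (\<lambda>x. a * f x + c * g x))"
    using fg by (simp add: L oscillator_expr_square_integrable)
  moreover have "a *\<^sub>C u + c *\<^sub>C u' = abs_L2 (\<lambda>x. a * f x + c * g x)"
    using fg by (simp add: L schwartz_square_integrable)
  moreover have "(\<lambda>x. a * f x + c * g x) \<in> schwartz"
    using fg by (intro schwartz_lincomb)
  ultimately show ?thesis unfolding oscillator_core_def by blast
qed

lemma hermite_function_core:
  "(abs_L2 (hermite_function \<omega> n), complex_of_real (oscillator_energy \<omega> n) *\<^sub>C abs_L2 (hermite_function \<omega> n))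
    \<in> oscillator_core"
proof -
  have "complex_of_real (oscillator_energy \<omega> n) *\<^sub>C abs_L2 (hermite_function \<omega> n)
      = abs_L2 (oscillator_expr \<omega> (hermite_function \<omega> n))"
    by (simp add: oscillator_expr_hermite_function scaleC.abs_eq hermite_function_square_integrable)
  then show ?thesis unfolding oscillator_core_def using hermite_function_schwartz by blast
qed

text \<open>The half of the diagonalisation that rests on symmetry: the coefficient relation holds
  on the core and survives limits in the graph by continuity of the inner product.\<close>

lemma closure_oscillator_core_subset:
  "closure oscillator_core \<subseteq> {(u, v). \<forall>n. cinner (abs_L2 (hermite_function \<omega> n)) v
      = complex_of_real (oscillator_energy \<omega> n) * cinner (abs_L2 (hermite_function \<omega> n)) u}"
proof (rule closure_minimal)
  show "oscillator_core \<subseteq> {(u, v). \<forall>n. cinner (abs_L2 (hermite_function \<omega> n)) v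
      = complex_of_real (oscillator_energy \<omega> n) * cinner (abs_L2 (hermite_function \<omega> n)) u}"
    by (auto simp: oscillator_core_def cinner_hermite_function_oscillator)
  have "closed {w. cinner (abs_L2 (hermite_function \<omega> n)) (snd w)
      = complex_of_real (oscillator_energy \<omega> n) * cinner (abs_L2 (hermite_function \<omega> n)) (fst w)}" for n
    by (intro closed_Collect_eq continuous_intros)
  then show "closed {(u, v). \<forall>n. cinner (abs_L2 (hermite_function \<omega> n)) v
      = complex_of_real (oscillator_energy \<omega> n) * cinner (abs_L2 (hermite_function \<omega> n)) u}"
    unfolding case_prod_beta by (rule closed_Collect_all)
qed

lemma hermite_functions_total_L2:
  assumes "\<And>n. cinner (abs_L2 (hermite_function \<omega> n)) u = 0"
  shows "u = 0"
proof -
  obtain f where f: "f \<in> square_integrable" "u = abs_L2 f" by (rule abs_L2_cases)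
  have "AE x in lborel. f x = 0"
  proof (rule hermite_functions_total[OF \<omega>_pos f(1)])
    show "(LINT x|lborel. complex_of_real (gauss_poly \<omega> (\<lambda>k. hermite (\<omega> k) (n k)) x) * f x) = 0" for n
      using assms[of n] f by (simp add: cinner_hermite_function hermite_function_def)
  qed
  then show ?thesis
    unfolding f(2) zero_L2.abs_eq by (intro abs_L2_eqI f square_integrable_zero)
qed

text \<open>Each quantum number is bounded by \<open>C / \<omega> k\<close>. Finiteness of sublevel
  sets makes the energies diverge along any enumeration of the multi-indices.\<close>

lemma finite_oscillator_energy_le: "finite {n. oscillator_energy \<omega> n \<le> C}"
proof (rule finite_subset)
  define B where "B k = nat \<lceil>C / \<omega> k\<rceil>" for k
  show "{n. oscillator_energy \<omega> n \<le> C} \<subseteq> Pi\<^sub>E UNIV (\<lambda>k. {..B k})"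
  proof (intro subsetI PiE_I)
    fix n k
    assume "n \<in> {n. oscillator_energy \<omega> n \<le> C}"
    then have "oscillator_energy \<omega> n \<le> C" by simp
    moreover have "\<omega> k * (real (n k) + 1 / 2) \<le> oscillator_energy \<omega> n"
      unfolding oscillator_energy_def
      by (rule member_le_sum) (auto intro!: mult_nonneg_nonneg less_imp_le[OF \<omega>_pos])
    moreover have "\<omega> k * real (n k) \<le> \<omega> k * (real (n k) + 1 / 2)"
      using \<omega>_pos[of k] by (intro mult_left_mono) auto
    ultimately have "\<omega> k * real (n k) \<le> C" by linarith
    then have "real (n k) \<le> C / \<omega> k" using \<omega>_pos[of k] by (simp add: field_simps)
    then show "n k \<in> {..B k}" unfolding B_def by (simp add: le_nat_iff) linarith
  qed simp
qed (intro finite_PiE; simp)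

text \<open>An arbitrary bijection serves to index the basis, since the order of the energies does
  not enter the diagonal description.\<close>

lemma harmonic_oscillator_diagonal:
  assumes \<phi>: "bij (\<phi> :: nat \<Rightarrow> 'n \<Rightarrow> nat)"
  defines "b \<equiv> \<lambda>j. complex_of_real (inverse (norm (abs_L2 (hermite_function \<omega> (\<phi> j)))))
      *\<^sub>C abs_L2 (hermite_function \<omega> (\<phi> j))"
  shows "diagonal_operator b (\<lambda>j. oscillator_energy \<omega> (\<phi> j)) (harmonic_oscillator \<omega>)"
    and "parity (b j) = (-1) ^ (\<Sum>k\<in>UNIV. \<phi> j k) *\<^sub>C b j"
    and "conjugation (b j) = b j"
proof -
  define e where "e n = abs_L2 (hermite_function \<omega> n)" for n
  define r where "r j = complex_of_real (inverse (norm (e (\<phi> j))))" for j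
  have b: "b j = r j *\<^sub>C e (\<phi> j)" for j
    by (simp add: b_def r_def e_def)
  have e0: "norm (e n) \<noteq> 0" for n
    by (simp add: e_def abs_L2_hermite_function_nonzero)
  have r0: "r j \<noteq> 0" for j
    using e0 by (simp add: r_def)
  have ee: "cinner (e n) (e n) = complex_of_real ((norm (e n))\<^sup>2)" for n
    using cinner_commute[of "e n" "e n"] Re_cinner_self[of "e n"]
    by (simp add: complex_eq_iff)
  have \<phi>_all: "(\<forall>n. P n) \<longleftrightarrow> (\<forall>j. P (\<phi> j))" for P
    using \<phi> by (metis bij_pointE)
  interpret orthonormal_basis b
  proof
    fix i j
    show "cinner (b i) (b j) = (if i = j then 1 else 0)"
    proof (cases "i = j")
      case True
      have "cinner (b j) (b j) = complex_of_real (inverse (norm (e (\<phi> j))) * inverse (norm (e (\<phi> j))) * (norm (e (\<phi> j)))\<^sup>2)"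
        by (simp add: b r_def cinner_scaleC_left cinner_scaleC_right ee mult.assoc)
      also have "inverse (norm (e (\<phi> j))) * inverse (norm (e (\<phi> j))) * (norm (e (\<phi> j)))\<^sup>2 = 1"
        using e0[of "\<phi> j"] by (simp add: power2_eq_square field_simps)
      finally show ?thesis using True by simp
    next
      case False
      then have "\<phi> i \<noteq> \<phi> j" using \<phi> by (metis bij_pointE)
      then show ?thesis using False
        by (simp add: b cinner_scaleC_left cinner_scaleC_right e_def hermite_functions_orthogonal)
    qed
  next
    fix u
    assume *: "\<And>j. cinner (b j) u = 0"
    have "cinner (e (\<phi> j)) u = 0" for j
      using *[of j] r0[of j] by (simp add: b cinner_scaleC_left)
    then have "\<forall>n. cinner (e n) u = 0" by (subst \<phi>_all) simp
    then show "u = 0"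
      using hermite_functions_total_L2 by (simp add: e_def)
  qed
  let ?lam = "\<lambda>j. oscillator_energy \<omega> (\<phi> j)"
  have iff: "(\<forall>n. cinner (e n) v = complex_of_real (oscillator_energy \<omega> n) * cinner (e n) u)
      \<longleftrightarrow> (\<forall>j. cinner (b j) v = complex_of_real (?lam j) * cinner (b j) u)" for u v
    using r0 by (subst \<phi>_all) (simp add: b cinner_scaleC_left)
  have T: "harmonic_oscillator \<omega> = closure oscillator_core"
    by (simp add: harmonic_oscillator_def oscillator_core_def)
  \<comment> \<open>Finite combinations of Hermite functions are Schwartz functions, so truncations
    lie in the core itself. The empty sum is obtained as a combination with zero
    coefficients.\<close>
  have sums: "(\<Sum>j<n. a j *\<^sub>C b j, \<Sum>j<n. (complex_of_real (?lam j) * a j) *\<^sub>C b j) \<in> oscillator_core" for a n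
  proof (induction n)
    case 0
    show ?case
      using oscillator_core_lincomb[OF hermite_function_core hermite_function_core, where a=0 and c=0] by simp
  next
    case (Suc n)
    show ?case
      using oscillator_core_lincomb[OF Suc hermite_function_core[of "\<phi> n"], where a=1 and c="a n * r n"]
      by (simp add: b scaleC_scaleC e_def[symmetric] mult_ac)
  qed
  show "diagonal_operator b ?lam (harmonic_oscillator \<omega>)"
  proof
    show "harmonic_oscillator \<omega> = {(u, v). \<forall>j. cinner (b j) v = complex_of_real (?lam j) * cinner (b j) u}"
    proof (intro equalityI subsetI; clarify)
      fix u v j
      assume "(u, v) \<in> harmonic_oscillator \<omega>"
      then have "\<forall>n. cinner (e n) v = complex_of_real (oscillator_energy \<omega> n) * cinner (e n) u"
        using closure_oscillator_core_subset unfolding T e_def by blast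
      then show "cinner (b j) v = complex_of_real (?lam j) * cinner (b j) u"
        using iff by blast
    next
      fix u v
      assume uv: "\<forall>j. cinner (b j) v = complex_of_real (?lam j) * cinner (b j) u"
      \<comment> \<open>Convergence takes place in both components of the graph at once: by
        \<open>uv\<close>, the truncation of \<open>v\<close> is the image of the truncation of
        \<open>u\<close>.\<close>
      have "(\<lambda>n. (\<Sum>j<n. cinner (b j) u *\<^sub>C b j, \<Sum>j<n. cinner (b j) v *\<^sub>C b j)) \<longlonglongrightarrow> (u, v)"
        by (intro tendsto_Pair expansion)
      moreover have "(\<Sum>j<n. cinner (b j) u *\<^sub>C b j, \<Sum>j<n. cinner (b j) v *\<^sub>C b j) \<in> oscillator_core" for n
        using sums[where a="\<lambda>j. cinner (b j) u" and n=n] uv by simp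
      ultimately show "(u, v) \<in> harmonic_oscillator \<omega>"
        unfolding T closure_sequential
        by (intro exI[of _ "\<lambda>n. (\<Sum>j<n. cinner (b j) u *\<^sub>C b j, \<Sum>j<n. cinner (b j) v *\<^sub>C b j)"] conjI allI)
    qed
    show "0 \<le> ?lam j" for j
      unfolding oscillator_energy_def
      by (intro sum_nonneg mult_nonneg_nonneg less_imp_le[OF \<omega>_pos]) auto
    show "filterlim ?lam at_top sequentially"
      unfolding filterlim_at_top
    proof
      fix Z
      have "{j. ?lam j < Z} \<subseteq> \<phi> -` {n. oscillator_energy \<omega> n \<le> Z}" by auto
      moreover have "finite (\<phi> -` {n. oscillator_energy \<omega> n \<le> Z})"
        by (intro finite_vimageI finite_oscillator_energy_le bij_is_inj \<phi>)
      ultimately have "finite {j. \<not> Z \<le> ?lam j}"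
        by (simp add: not_le finite_subset)
      then show "\<forall>\<^sub>F j in sequentially. Z \<le> ?lam j"
        by (simp add: cofinite_eq_sequentially[symmetric] eventually_cofinite)
    qed
  qed
  have scale: "b j = abs_L2 (\<lambda>x. r j * hermite_function \<omega> (\<phi> j) x)"
    by (simp add: b e_def scaleC.abs_eq hermite_function_square_integrable)
  note sq = square_integrable_cmult[OF hermite_function_square_integrable]
  show "parity (b j) = (-1) ^ (\<Sum>k\<in>UNIV. \<phi> j k) *\<^sub>C b j"
    unfolding scale using sq
    by (simp add: parity.abs_eq scaleC.abs_eq hermite_function_uminus mult_ac)
  show "conjugation (b j) = b j"
    unfolding scale using sq by (simp add: conjugation.abs_eq r_def)
qed

end

section \<open>Arithmetic of commensurable frequencies\<close>

lemma bij_nat_fun_finite: "\<exists>\<phi> :: nat \<Rightarrow> ('n::finite \<Rightarrow> nat). bij \<phi>"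
proof -
  have "inj (\<lambda>(m::nat) (_ :: 'n). m)"
    by (auto simp: inj_def fun_eq_iff)
  then have "infinite (UNIV :: ('n \<Rightarrow> nat) set)"
    using finite_imageD[of "\<lambda>(m::nat) (_ :: 'n). m" UNIV] by (metis finite_subset infinite_UNIV_nat subset_UNIV)
  then have "bij_betw (from_nat_into (UNIV :: ('n \<Rightarrow> nat) set)) UNIV UNIV"
    by (intro bij_betw_from_nat_into) auto
  then show ?thesis by blast
qed

lemma even_sum_odd_weights:
  "finite A \<Longrightarrow> (\<And>k. k \<in> A \<Longrightarrow> odd (w k)) \<Longrightarrow> even (\<Sum>k\<in>A. w k * n k) \<longleftrightarrow> even (\<Sum>k\<in>A. n k :: nat)"
  by (induction A rule: finite_induct) auto

text \<open>Oddness of \<open>p k\<close> and \<open>q k\<close> depends on the base frequency: with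
  \<open>p k = 2\<close> and \<open>q k = 1\<close> in both coordinates the oscillator is isotropic
  and has definite parity. Necessity therefore asserts odd representations for a suitable base
  frequency \<open>\<omega>\<^sub>0'\<close>.\<close>

theorem theorem3:
  fixes \<omega>\<^sub>0 :: real and p q :: "'n::finite \<Rightarrow> nat" and \<omega> :: "'n \<Rightarrow> real"
  assumes "\<omega>\<^sub>0 > 0"
    and "\<And>k. p k > 0" and "\<And>k. q k > 0" and "\<And>k. coprime (p k) (q k)"
    and "\<And>k. \<omega> k = real (p k) / real (q k) * \<omega>\<^sub>0"
  shows "\<exists>l. enumerates_eigenvalues l (harmonic_oscillator \<omega>) \<and>
    ((\<forall>k. odd (p k) \<and> odd (q k)) \<longrightarrow>
       self_adjoint (harmonic_oscillator \<omega>) \<and>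
       bounded_below (harmonic_oscillator \<omega>) \<and>
       compact_resolvent (harmonic_oscillator \<omega>) \<and>
       P_symmetric (harmonic_oscillator \<omega>) \<and>
       T_symmetric (harmonic_oscillator \<omega>) \<and>
       gap l > 0 \<and>
       definite_parity l (harmonic_oscillator \<omega>)) \<and>
    (CARD('n) = 2 \<longrightarrow>
       (definite_parity l (harmonic_oscillator \<omega>) \<longrightarrow>
          (\<exists>\<omega>\<^sub>0' (p' :: 'n \<Rightarrow> nat) (q' :: 'n \<Rightarrow> nat). \<omega>\<^sub>0' > 0 \<and>
             (\<forall>k. coprime (p' k) (q' k) \<and> odd (p' k) \<and> odd (q' k) \<and>
                  \<omega> k = real (p' k) / real (q' k) * \<omega>\<^sub>0'))) \<and>
       gap l > 0)"
proof -
  have \<omega>_pos: "0 < \<omega> k" for k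
    using assms(1,5) assms(2,3)[of k] by simp
  define Q where "Q = (\<Prod>k\<in>UNIV. q k)"
  \<comment> \<open>Clearing denominators: every frequency is an integer multiple \<open>w k\<close>
    of \<open>\<omega>\<^sub>0 / Q\<close>.\<close>
  define w where "w k = p k * (Q div q k)" for k
  define \<delta> where "\<delta> = \<omega>\<^sub>0 / real Q"
  have Q0: "0 < Q" unfolding Q_def by (intro prod_pos) (use assms(3) in auto)
  have qQ: "q k dvd Q" for k unfolding Q_def by (rule dvd_prodI) auto
  have \<delta>0: "0 < \<delta>" using assms(1) Q0 by (simp add: \<delta>_def)
  have \<omega>w: "\<omega> k = \<delta> * real (w k)" for k
    using assms(3)[of k] Q0 qQ[of k]
    by (simp add: assms(5) \<delta>_def w_def real_of_nat_div)
  have w0: "0 < w k" for k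
    using \<omega>_pos[of k] \<delta>0 by (simp add: \<omega>w zero_less_mult_iff)
  define N where "N n = (\<Sum>k\<in>UNIV. w k * n k)" for n :: "'n \<Rightarrow> nat"
  define E0 where "E0 = (\<Sum>k\<in>UNIV. \<omega> k / 2)"
  have energy: "oscillator_energy \<omega> n = \<delta> * real (N n) + E0" for n
    unfolding oscillator_energy_def N_def E0_def of_nat_sum sum_distrib_left sum.distrib[symmetric]
    by (intro sum.cong refl) (simp add: \<omega>w algebra_simps)
  have energy_eq_iff: "oscillator_energy \<omega> n = oscillator_energy \<omega> m \<longleftrightarrow> N n = N m" for n m
    using \<delta>0 by (simp add: energy)
  obtain \<phi> :: "nat \<Rightarrow> 'n \<Rightarrow> nat" where \<phi>: "bij \<phi>"
    using bij_nat_fun_finite by blast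
  define b where "b j = complex_of_real (inverse (norm (abs_L2 (hermite_function \<omega> (\<phi> j)))))
      *\<^sub>C abs_L2 (hermite_function \<omega> (\<phi> j))" for j
  let ?lam = "\<lambda>j. oscillator_energy \<omega> (\<phi> j)"
  let ?T = "harmonic_oscillator \<omega>"
  interpret diagonal_operator b ?lam ?T
    unfolding b_def[abs_def] by (rule harmonic_oscillator_diagonal(1)[OF \<omega>_pos \<phi>])
  have par: "parity (b j) = (-1) ^ (\<Sum>k\<in>UNIV. \<phi> j k) *\<^sub>C b j" for j
    unfolding b_def by (rule harmonic_oscillator_diagonal(2)[OF \<omega>_pos \<phi>])
  have con: "conjugation (b j) = b j" for j
    unfolding b_def by (rule harmonic_oscillator_diagonal(3)[OF \<omega>_pos \<phi>])
  \<comment> \<open>The energies are an increasing affine image of the integers attained by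
    \<open>N\<close>, so the increasing enumeration of \<open>range N\<close> lists them without
    repetition.\<close>
  define l where "l r = \<delta> * real (enumerate (range N) r) + E0" for r
  have inf: "infinite (range N)"
  proof -
    \<comment> \<open>On constant multi-indices \<open>N\<close> is multiplication by the positive
      sum of the weights.\<close>
    have "inj (\<lambda>m. N (\<lambda>_. m))"
    proof (rule injI)
      fix m m' assume "N (\<lambda>_. m) = N (\<lambda>_. m')"
      then have "(\<Sum>k\<in>UNIV. w k) * m = (\<Sum>k\<in>UNIV. w k) * m'"
        by (simp add: N_def sum_distrib_right)
      moreover have "0 < (\<Sum>k\<in>UNIV. w k)"
        by (intro sum_pos) (auto simp: w0)
      ultimately show "m = m'" using nat_mult_eq_cancel1 by blast
    qed
    then have "infinite (range (\<lambda>m. N (\<lambda>_. m)))"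
      by (rule range_inj_infinite)
    then show ?thesis by (rule infinite_super[rotated]) auto
  qed
  have step: "enumerate (range N) r < enumerate (range N) (Suc r)" for r
    by (rule enumerate_step[OF inf])
  have "range l = (\<lambda>m. \<delta> * real m + E0) ` range N"
    using range_enumerate[OF inf] by (metis (no_types, lifting) image_cong image_image l_def)
  also have "\<dots> = range (\<lambda>n. oscillator_energy \<omega> n)"
    by (simp add: image_image energy)
  also have "\<dots> = range ?lam"
    using bij_is_surj[OF \<phi>] by (metis image_image)
  finally have "range l = range ?lam" .
  moreover have "strict_mono l"
    unfolding strict_mono_Suc_iff l_def using step \<delta>0 by simp
  ultimately have enum: "enumerates_eigenvalues l ?T"
    by (simp add: enumerates_eigenvalues_def eigenvalues_T)
  have gap: "0 < gap l"
  proof -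
    \<comment> \<open>Consecutive elements of \<open>range N\<close> differ by at least 1, whatever
      the parities.\<close>
    have "\<delta> \<le> l (Suc r) - l r" for r
    proof -
      have "\<delta> * 1 \<le> \<delta> * (real (enumerate (range N) (Suc r)) - real (enumerate (range N) r))"
        using step[of r] \<delta>0 by (intro mult_left_mono) auto
      then show ?thesis by (simp add: l_def algebra_simps)
    qed
    then have "\<delta> \<le> (INF r. l (Suc r) - l r)"
      by (intro cINF_greatest) auto
    with \<delta>0 show ?thesis by (simp add: gap_def)
  qed
  have "definite_parity l ?T" if odd: "\<forall>k. odd (p k) \<and> odd (q k)"
  proof -
    have "odd Q" unfolding Q_def using odd by (auto simp: even_prod_iff)
    then have "odd (Q div q k)" for k
      using qQ[of k] by (metis dvd_div_mult_self even_mult_iff)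
    then have "odd (w k)" for k using odd by (simp add: w_def)
    then have "even (N n) \<longleftrightarrow> even (\<Sum>k\<in>UNIV. n k)" for n
      unfolding N_def by (intro even_sum_odd_weights) auto
    then show ?thesis
      unfolding definite_parity_iff[OF par enum] energy_eq_iff by metis
  qed
  moreover have "\<exists>\<omega>\<^sub>0' (p' :: 'n \<Rightarrow> nat) (q' :: 'n \<Rightarrow> nat). \<omega>\<^sub>0' > 0 \<and>
             (\<forall>k. coprime (p' k) (q' k) \<and> odd (p' k) \<and> odd (q' k) \<and>
                  \<omega> k = real (p' k) / real (q' k) * \<omega>\<^sub>0')"
    if card: "CARD('n) = 2" and dp: "definite_parity l ?T"
  proof -
    obtain a c :: 'n where ac: "UNIV = {a, c}" "a \<noteq> c"
      using card by (auto simp: card_2_iff)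
    define g where "g = gcd (w a) (w c)"
    define p' where "p' k = w k div g" for k
    have g0: "0 < g" using w0[of a] by (simp add: g_def)
    have all: "k = a \<or> k = c" for k using ac(1) by blast
    have wg: "w k = g * p' k" for k
      using all[of k] by (auto simp: p'_def g_def)
    have cop: "coprime (p' a) (p' c)"
      unfolding p'_def g_def using w0[of a] by (intro div_gcd_coprime) auto
    \<comment> \<open>Crossing the two reduced weights makes both energies equal, while the total
      degrees are \<open>p' c\<close> and \<open>p' a\<close>.\<close>
    define n where "n k = (if k = a then p' c else 0)" for k
    define m where "m k = (if k = c then p' a else 0)" for k
    have "N n = w a * p' c" "N m = w c * p' a" "(\<Sum>k\<in>UNIV. n k) = p' c" "(\<Sum>k\<in>UNIV. m k) = p' a"
      unfolding N_def ac(1) using ac(2) by (auto simp: n_def m_def)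
    moreover have "w a * p' c = w c * p' a" by (simp add: wg mult_ac)
    moreover obtain i j where "\<phi> i = n" "\<phi> j = m"
      using \<phi> by (metis bij_pointE)
    ultimately have "even (p' c) = even (p' a)"
      using dp unfolding definite_parity_iff[OF par enum] energy_eq_iff by metis
    \<comment> \<open>The two numbers have equal parity, and coprimality excludes 2 as a common
      divisor.\<close>
    with cop have "odd (p' a)" "odd (p' c)"
      using coprime_common_divisor_nat[of "p' a" "p' c" 2] by auto
    then have "odd (p' k)" for k using all[of k] by auto
    \<comment> \<open>The new base frequency is \<open>\<delta> * real g\<close>, with numerators
      \<open>p' k\<close> and all denominators equal to 1, which is odd and coprime to
      everything.\<close>
    moreover have "\<omega> k = real (p' k) / real 1 * (\<delta> * real g)" for k
      by (simp add: \<omega>w wg)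
    ultimately show ?thesis
      using \<delta>0 g0 by (intro exI[of _ "\<delta> * real g"] exI[of _ p'] exI[of _ "\<lambda>_. 1"]) auto
  qed
  ultimately show ?thesis
    using enum gap self_adjoint_T bounded_below_T compact_resolvent_T P_symmetric_T[OF par]
      T_symmetric_T[OF con] by blast
qed

end
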